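(* Let $D$ be an expanding $d\times d$ matrix with integer coefficients. Let $K$ be the attractor of an IFS $\Phi=\{f_1,\dots,f_k\}$, where for each $i\in\Lambda=\{1,\dots,k\}$, $f_i:\mathbb{R}^d\to\mathbb{R}^d$ is given by $$f_i(x)=D^{-r_i}x+t_i$$ for some $t_i\in\mathbb{R}^d$ and $r_i\in\mathbb{N}$. Assume that (the image in $\mathbb{T}^d$ of) the set $$\left\{(\mathbb{I}_d-D^{r_i})D^{r_j}t_j-(\mathbb{I}_d-D^{r_j})D^{r_i}t_i:\ i,j\in\Lambda\right\}$$ is not contained in any proper closed subgroup of $\mathbb{T}^d$. Then, for every $\Phi$-Bernoulli measure $\mu$ on $K$, for $\mu$-almost every $x\in K$, the sequence $\{D^mx\}_{m=1}^\infty$ (taken mod $\mathbb{Z}^d$) is equidistributed in $\mathbb{T}^d$ with respect to Haar measure.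
   Context: $\mathbb{N}=\{1,2,\dots\}$, $\mathbb{T}^d=\mathbb{R}^d/\mathbb{Z}^d$, $\mathbb{I}_d$ is the identity matrix, and Haar measure is the Haar probability measure. A matrix is expanding if all of its complex eigenvalues have modulus greater than $1$. An IFS is a finite collection of maps, each contracting with respect to some common norm on $\mathbb{R}^d$ (when $D$ is expanding, such a norm exists for the maps $f_i$). Its attractor is the unique non-empty compact set $K$ with $K=\bigcup_{i\in\Lambda}f_i(K)$. The coding map is $\pi_\Phi:\Lambda^{\mathbb{N}}\to K$, $\pi_\Phi(i_1,i_2,\dots)=\lim_{n\to\infty}f_{i_1}\circ\cdots\circ f_{i_n}(0)$. A $\Phi$-Bernoulli measure on $K$ is a measure of the form $(\pi_\Phi)_*P^{\otimes\mathbb{N}}$, where $P$ is a probability measure on $\Lambda$ with $P(\{i\})>0$ for all $i\in\Lambda$. A sequence $(y_m)$ in a compact space $Y$ is equidistributed with respect to a probability measure $\lambda$ if $\frac1N\sum_{m=1}^N f(y_m)\to\int f\,d\lambda$ for every $f\in C(Y)$. *)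

theory Defs
  imports "HOL-Analysis.Analysis" "HOL-Probability.Probability"
begin

definition integer_matrix :: "real^'n^'m \<Rightarrow> bool" where
  "integer_matrix A \<longleftrightarrow> (\<forall>i j. A $ i $ j \<in> \<int>)"

text \<open>The library's power operation on the type of square matrices is entrywise, so the
  power with respect to the matrix product needs its own name.\<close>

primrec matpow :: "'a::semiring_1^'n^'n \<Rightarrow> nat \<Rightarrow> 'a^'n^'n" where
  "matpow A 0 = mat 1"
| "matpow A (Suc n) = A ** matpow A n"

definition complex_eigenvalue :: "real^'n^'n \<Rightarrow> complex \<Rightarrow> bool" where
  "complex_eigenvalue A c \<longleftrightarrow>
     (\<exists>v :: complex^'n. v \<noteq> 0 \<and> map_matrix complex_of_real A *v v = c *s v)"

definition expanding :: "real^'n^'n \<Rightarrow> bool" where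
  "expanding A \<longleftrightarrow> (\<forall>c. complex_eigenvalue A c \<longrightarrow> 1 < cmod c)"

definition int_congruent :: "real^'n \<Rightarrow> real^'n \<Rightarrow> bool" where
  "int_congruent x y \<longleftrightarrow> (\<forall>i. x $ i - y $ i \<in> \<int>)"

lemma equivp_int_congruent: "equivp (int_congruent :: real^'n \<Rightarrow> real^'n \<Rightarrow> bool)"
proof (rule equivpI)
  show "reflp (int_congruent :: real^'n \<Rightarrow> real^'n \<Rightarrow> bool)"
    by (auto simp: reflp_def int_congruent_def)
  show "symp (int_congruent :: real^'n \<Rightarrow> real^'n \<Rightarrow> bool)"
    unfolding symp_def int_congruent_def by (metis Ints_minus minus_diff_eq)
  show "transp (int_congruent :: real^'n \<Rightarrow> real^'n \<Rightarrow> bool)"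
    unfolding transp_def int_congruent_def
    by (metis Ints_add diff_add_cancel add_diff_eq)
qed

quotient_type (overloaded) 'n torus = "real^'n::finite" / int_congruent
  by (rule equivp_int_congruent)

lift_definition to_torus :: "real^'n \<Rightarrow> 'n torus" is "\<lambda>x. x" .

lemma to_torus_eq_iff: "to_torus x = to_torus y \<longleftrightarrow> int_congruent x y"
  by transfer simp

lemma surj_to_torus: "\<exists>x. to_torus x = z"
  by transfer (use equivp_reflp[OF equivp_int_congruent] in blast)

instantiation torus :: (finite) ab_group_add
begin

lift_definition zero_torus :: "'a torus" is "0 :: real^'a" .

lift_definition plus_torus :: "'a torus \<Rightarrow> 'a torus \<Rightarrow> 'a torus"
  is "(+) :: real^'a \<Rightarrow> real^'a \<Rightarrow> real^'a"
  unfolding int_congruent_def by (metis Ints_add add_diff_add vector_add_component)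

lift_definition uminus_torus :: "'a torus \<Rightarrow> 'a torus"
  is "uminus :: real^'a \<Rightarrow> real^'a"
  unfolding int_congruent_def
  by (metis Ints_minus minus_diff_minus vector_uminus_component)

lift_definition minus_torus :: "'a torus \<Rightarrow> 'a torus \<Rightarrow> 'a torus"
  is "(-) :: real^'a \<Rightarrow> real^'a \<Rightarrow> real^'a"
proof -
  fix x y u v :: "real^'a"
  assume *: "int_congruent x y" "int_congruent u v"
  have "(x - u) $ i - (y - v) $ i = (x $ i - y $ i) - (u $ i - v $ i)" for i
    by simp
  with * show "int_congruent (x - u) (y - v)"
    unfolding int_congruent_def by (metis Ints_diff)
qed

instance
  by standard (transfer; simp add: int_congruent_def)+

end

lemma to_torus_add: "to_torus (x + y) = to_torus x + to_torus y"
  by transfer (simp add: int_congruent_def)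

lemma to_torus_minus: "to_torus (- x) = - to_torus x"
  by transfer (simp add: int_congruent_def)

lemma to_torus_0: "to_torus 0 = 0"
  by transfer (simp add: int_congruent_def)

instantiation torus :: (finite) topological_space
begin

definition open_torus :: "'a torus set \<Rightarrow> bool" where
  "open_torus U \<longleftrightarrow> open (to_torus -` U)"

instance
  by standard (auto simp: open_torus_def vimage_Union)

end

lemma continuous_on_to_torus: "continuous_on UNIV (to_torus :: real^'n \<Rightarrow> _)"
  unfolding continuous_on_open_vimage[OF open_UNIV] by (simp add: open_torus_def)

lemma measurable_to_torus [measurable]: "(to_torus :: real^'n \<Rightarrow> _) \<in> borel_measurable borel"
  by (rule borel_measurable_continuous_onI[OF continuous_on_to_torus])

lemma continuous_on_torus_translation: "continuous_on UNIV ((+) (a :: 'n::finite torus))"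
proof -
  obtain x where x: "to_torus x = a"
    using surj_to_torus by blast
  have "open ((+) a -` U)" if "open U" for U :: "'n torus set"
  proof -
    have "to_torus -` ((+) a -` U) = (+) x -` (to_torus -` U)"
      by (auto simp: to_torus_add x)
    also have "open \<dots>"
      using that unfolding open_torus_def
      by (rule open_vimage) (intro continuous_intros)
    finally show ?thesis
      by (simp add: open_torus_def)
  qed
  then show ?thesis
    by (simp add: continuous_on_open_vimage)
qed

definition closed_subgroup :: "'a::{ab_group_add, topological_space} set \<Rightarrow> bool" where
  "closed_subgroup H \<longleftrightarrow>
     closed H \<and> 0 \<in> H \<and> (\<forall>x\<in>H. \<forall>y\<in>H. x + y \<in> H) \<and> (\<forall>x\<in>H. - x \<in> H)"

definition unit_cell :: "(real^'n) set" where
  "unit_cell = {x. \<forall>i. 0 \<le> x $ i \<and> x $ i < 1}"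

text \<open>Haar measure is constructed as the image of Lebesgue measure on a fundamental domain;
  the lemmas below confirm that it is a translation invariant Borel probability measure.\<close>

definition torus_haar :: "'n::finite torus measure" where
  "torus_haar = distr (restrict_space lborel unit_cell) borel to_torus"

lemma unit_cell_borel [measurable]: "(unit_cell :: (real^'n) set) \<in> sets borel"
  unfolding unit_cell_def by measurable

lemma emeasure_unit_cell: "emeasure lborel (unit_cell :: (real^'n) set) = 1"
proof -
  have 1: "box 0 1 \<subseteq> (unit_cell :: (real^'n) set)" and 2: "unit_cell \<subseteq> (cbox 0 1 :: (real^'n) set)"
    by (auto simp: unit_cell_def mem_box_cart less_imp_le)
  have le: "(0::real^'n) \<bullet> b \<le> 1 \<bullet> b" if "b \<in> Basis" for b
    using that by (auto simp: Basis_vec_def inner_axis)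
  have p: "(\<Prod>b\<in>Basis. ((1::real^'n) - 0) \<bullet> b) = 1"
    by (rule prod.neutral) (auto simp: Basis_vec_def inner_axis)
  have "emeasure lborel (box 0 (1::real^'n)) = 1" "emeasure lborel (cbox 0 (1::real^'n)) = 1"
    using le p by (simp_all add: emeasure_lborel_box emeasure_lborel_cbox)
  with emeasure_mono[OF 1, of lborel] emeasure_mono[OF 2, of lborel] show ?thesis
    by (auto intro: antisym)
qed

lemma sets_torus_haar [simp]: "sets torus_haar = sets borel"
  by (simp add: torus_haar_def)

lemma measurable_to_torus_cell:
  "to_torus \<in> measurable (restrict_space lborel unit_cell) borel"
  by (intro measurable_restrict_space1) simp

lemma emeasure_torus_haar:
  assumes "B \<in> sets borel"
  shows "emeasure torus_haar B = emeasure lborel (unit_cell \<inter> to_torus -` B)"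
proof -
  have "emeasure torus_haar B =
      emeasure (restrict_space lborel unit_cell) (to_torus -` B \<inter> unit_cell)"
    unfolding torus_haar_def
    by (subst emeasure_distr[OF measurable_to_torus_cell assms]) (simp add: space_restrict_space)
  also have "\<dots> = emeasure lborel (unit_cell \<inter> to_torus -` B)"
    by (subst emeasure_restrict_space) (auto simp: Int_commute)
  finally show ?thesis .
qed

lemma prob_space_torus_haar: "prob_space (torus_haar :: 'n::finite torus measure)"
proof
  show "emeasure torus_haar (space (torus_haar :: 'n torus measure)) = 1"
    using emeasure_torus_haar[of "UNIV :: 'n torus set"]
    by (simp add: sets_eq_imp_space_eq[OF sets_torus_haar] emeasure_unit_cell)
qed

lemma emeasure_lborel_translate:
  fixes A :: "'a::euclidean_space set"
  assumes "A \<in> sets borel"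
  shows "emeasure lborel ((\<lambda>x. c + x) -` A) = emeasure lborel A"
proof -
  have "emeasure lborel A = emeasure (distr lborel borel ((+) c)) A"
    by (simp add: lborel_distr_plus)
  also have "\<dots> = emeasure lborel ((+) c -` A)"
    using assms by (subst emeasure_distr) auto
  finally show ?thesis ..
qed

lemma unit_cell_decomposition:
  fixes A C :: "(real^'n) set"
  assumes A: "A \<in> sets borel"
  defines "L \<equiv> {n :: real^'n. \<forall>i. n $ i \<in> \<int>}"
  shows "emeasure lborel A = (\<integral>\<^sup>+n. emeasure lborel (A \<inter> (\<lambda>x. - n + x) -` unit_cell) \<partial>count_space L)"
    and "countable L"
proof -
  have "L \<subseteq> range (\<lambda>f :: int^'n. \<chi> i. of_int (f $ i))"
  proof
    fix n assume "n \<in> L"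
    then have "n = (\<chi> i. of_int ((\<chi> i. \<lfloor>n $ i\<rfloor>) $ i))"
      by (auto simp: L_def vec_eq_iff elim!: Ints_cases)
    then show "n \<in> range (\<lambda>f :: int^'n. \<chi> i. of_int (f $ i))"
      by blast
  qed
  moreover have "countable (UNIV :: (int^'n) set)"
  proof -
    have "inj (vec_nth :: int^'n \<Rightarrow> _)"
      by (simp add: inj_def vec_nth_inject)
    moreover have "countable (UNIV :: ('n \<Rightarrow> int) set)"
      by simp
    ultimately show ?thesis
      by (metis countable_image_inj_on countable_subset top_greatest)
  qed
  ultimately show L: "countable L"
    by (meson countable_image countable_subset)
  have cover: "(\<Union>n\<in>L. A \<inter> (\<lambda>x. - n + x) -` unit_cell) = A"
  proof (intro equalityI subsetI)
    fix x assume x: "x \<in> A"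
    have "(\<chi> i. of_int \<lfloor>x $ i\<rfloor>) \<in> L"
      by (simp add: L_def)
    moreover have "- (\<chi> i. of_int \<lfloor>x $ i\<rfloor>) + x \<in> unit_cell"
      by (auto simp: unit_cell_def) linarith
    ultimately show "x \<in> (\<Union>n\<in>L. A \<inter> (\<lambda>x. - n + x) -` unit_cell)"
      using x by blast
  qed auto
  have disj: "disjoint_family_on (\<lambda>n. A \<inter> (\<lambda>x. - n + x) -` unit_cell) L"
  proof (unfold disjoint_family_on_def, intro ballI impI equals0I)
    fix m n x assume *: "m \<in> L" "n \<in> L" "m \<noteq> n"
      "x \<in> A \<inter> (\<lambda>x. - m + x) -` unit_cell \<inter> (A \<inter> (\<lambda>x. - n + x) -` unit_cell)"
    have "m $ i = n $ i" for i
    proof -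
      from * obtain a b where ab: "m $ i = of_int a" "n $ i = of_int b"
        unfolding L_def mem_Collect_eq by (metis Ints_cases)
      have "0 \<le> x $ i - m $ i" "x $ i - m $ i < 1" "0 \<le> x $ i - n $ i" "x $ i - n $ i < 1"
        using * by (auto simp: unit_cell_def)
      with ab have "a = b" by linarith
      with ab show ?thesis by simp
    qed
    with * show False by (simp add: vec_eq_iff)
  qed
  have "A \<inter> (\<lambda>x. - n + x) -` unit_cell \<in> sets lborel" for n
    using A measurable_sets[of "\<lambda>x. - n + x" borel borel unit_cell] by auto
  then show "emeasure lborel A =
      (\<integral>\<^sup>+n. emeasure lborel (A \<inter> (\<lambda>x. - n + x) -` unit_cell) \<partial>count_space L)"
    using emeasure_UN_countable[OF _ L disj, of lborel] cover by simp
qed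

lemma torus_haar_translation_invariant:
  fixes a :: "'n::finite torus"
  shows "distr torus_haar borel ((+) a) = torus_haar"
proof (rule measure_eqI)
  fix B assume "B \<in> sets (distr torus_haar borel ((+) a))"
  then have B: "B \<in> sets borel" by simp
  define L where "L = {n :: real^'n. \<forall>i. n $ i \<in> \<int>}"
  obtain c where c: "to_torus c = a"
    using surj_to_torus by blast
  have meas: "(+) a \<in> borel_measurable borel"
    by (rule borel_measurable_continuous_onI[OF continuous_on_torus_translation])
  define A where "A = (to_torus -` B :: (real^'n) set)"
  have A [measurable]: "A \<in> sets borel"
    unfolding A_def using measurable_sets[OF measurable_to_torus B] by simp
  have periodic: "n + x \<in> A \<longleftrightarrow> x \<in> A" if "n \<in> L" for n x
  proof -
    have "to_torus (n + x) = to_torus x"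
      using that by (simp add: to_torus_eq_iff int_congruent_def L_def)
    then show ?thesis by (simp add: A_def)
  qed
  have cell [measurable]: "(\<lambda>x. v + x) -` (unit_cell :: (real^'n) set) \<in> sets borel" for v
    using measurable_sets[of "\<lambda>x. v + x" borel borel "unit_cell :: (real^'n) set"] by simp
  have trans: "(\<lambda>x. v + x) -` S \<in> sets borel" if "S \<in> sets borel" for v and S :: "(real^'n) set"
    using measurable_sets[of "\<lambda>x. v + x" borel borel S] that by simp
  let ?Qc = "(\<lambda>x. - c + x) -` (unit_cell :: (real^'n) set)"
  have "emeasure (distr torus_haar borel ((+) a)) B = emeasure torus_haar ((+) a -` B)"
    using B meas
    by (subst emeasure_distr)
       (auto simp: sets_eq_imp_space_eq[OF sets_torus_haar] cong: measurable_cong_sets)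
  also have "\<dots> = emeasure lborel (unit_cell \<inter> to_torus -` ((+) a -` B))"
    using measurable_sets[OF meas B] by (intro emeasure_torus_haar) simp
  also have "unit_cell \<inter> to_torus -` ((+) a -` B) = (\<lambda>x. c + x) -` (?Qc \<inter> A)"
    by (auto simp: A_def to_torus_add c)
  also have "emeasure lborel \<dots> = emeasure lborel (?Qc \<inter> A)"
    by (rule emeasure_lborel_translate) (use A cell in auto)
  also have "\<dots> = (\<integral>\<^sup>+n. emeasure lborel (?Qc \<inter> A \<inter> (\<lambda>x. - n + x) -` unit_cell) \<partial>count_space L)"
    unfolding L_def by (rule unit_cell_decomposition(1)) (use A cell in auto)
  also have "\<dots> = (\<integral>\<^sup>+n. emeasure lborel (unit_cell \<inter> A \<inter> (\<lambda>x. n + x) -` ?Qc) \<partial>count_space L)"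
  proof (rule nn_integral_cong)
    fix n assume "n \<in> space (count_space L)"
    then have n: "n \<in> L" by simp
    have "emeasure lborel (?Qc \<inter> A \<inter> (\<lambda>x. - n + x) -` unit_cell) =
        emeasure lborel ((\<lambda>x. n + x) -` (?Qc \<inter> A \<inter> (\<lambda>x. - n + x) -` unit_cell))"
      by (rule emeasure_lborel_translate[symmetric]) (use A cell in auto)
    also have "(\<lambda>x. n + x) -` (?Qc \<inter> A \<inter> (\<lambda>x. - n + x) -` unit_cell) =
        unit_cell \<inter> A \<inter> (\<lambda>x. n + x) -` ?Qc"
      using periodic[OF n] by auto
    finally show "emeasure lborel (?Qc \<inter> A \<inter> (\<lambda>x. - n + x) -` unit_cell) =
        emeasure lborel (unit_cell \<inter> A \<inter> (\<lambda>x. n + x) -` ?Qc)" .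
  qed
  also have "\<dots> = (\<integral>\<^sup>+n. emeasure lborel ((\<lambda>x. c + x) -` (unit_cell \<inter> A) \<inter> (\<lambda>x. n + x) -` unit_cell)
      \<partial>count_space L)"
  proof (rule nn_integral_cong)
    fix n
    have "emeasure lborel ((\<lambda>x. c + x) -` (unit_cell \<inter> A \<inter> (\<lambda>x. n + x) -` ?Qc)) =
        emeasure lborel (unit_cell \<inter> A \<inter> (\<lambda>x. n + x) -` ?Qc)"
      by (rule emeasure_lborel_translate) (use A cell trans in auto)
    also have "(\<lambda>x. c + x) -` (unit_cell \<inter> A \<inter> (\<lambda>x. n + x) -` ?Qc) =
        (\<lambda>x. c + x) -` (unit_cell \<inter> A) \<inter> (\<lambda>x. n + x) -` unit_cell"
      by (auto simp: algebra_simps)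
    finally show "emeasure lborel (unit_cell \<inter> A \<inter> (\<lambda>x. n + x) -` ?Qc) =
        emeasure lborel ((\<lambda>x. c + x) -` (unit_cell \<inter> A) \<inter> (\<lambda>x. n + x) -` unit_cell)" ..
  qed
  also have "\<dots> = (\<integral>\<^sup>+n. emeasure lborel ((\<lambda>x. c + x) -` (unit_cell \<inter> A) \<inter> (\<lambda>x. - n + x) -` unit_cell)
      \<partial>count_space L)"
  proof -
    have "bij_betw (uminus :: real^'n \<Rightarrow> _) L L"
      by (rule bij_betwI[where g = uminus]) (auto simp: L_def)
    from nn_integral_bij_count_space[OF this,
        of "\<lambda>n. emeasure lborel ((\<lambda>x. c + x) -` (unit_cell \<inter> A) \<inter> (\<lambda>x. - n + x) -` unit_cell)"]
    show ?thesis
      by (simp only: minus_minus)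
  qed
  also have "\<dots> = emeasure lborel ((\<lambda>x. c + x) -` (unit_cell \<inter> A))"
    unfolding L_def by (rule unit_cell_decomposition(1)[symmetric]) (use A trans in auto)
  also have "\<dots> = emeasure lborel (unit_cell \<inter> A)"
    by (rule emeasure_lborel_translate) (use A in auto)
  also have "\<dots> = emeasure torus_haar B"
    using B by (simp add: emeasure_torus_haar A_def)
  finally show "emeasure (distr torus_haar borel ((+) a)) B = emeasure torus_haar B" .
qed simp

definition equidistributed :: "(nat \<Rightarrow> 'a::topological_space) \<Rightarrow> 'a measure \<Rightarrow> bool" where
  "equidistributed y M \<longleftrightarrow>
     (\<forall>f :: 'a \<Rightarrow> real. continuous_on UNIV f \<longrightarrow>
        (\<lambda>N. (\<Sum>m=1..N. f (y m)) / real N) \<longlonglongrightarrow> integral\<^sup>L M f)"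

text \<open>For an iterated function system (maps contracting in a common norm) at most one set has
  this property, so the predicate determines the attractor.\<close>

definition is_attractor :: "'i set \<Rightarrow> ('i \<Rightarrow> 'a \<Rightarrow> 'a) \<Rightarrow> 'a::topological_space set \<Rightarrow> bool" where
  "is_attractor \<Lambda> f K \<longleftrightarrow> K \<noteq> {} \<and> compact K \<and> K = (\<Union>i\<in>\<Lambda>. f i ` K)"

text \<open>Symbol sequences are indexed from 0, so the \<open>n\<close>-th term below is
  \<open>(f (\<omega> 0) \<circ> \<dots> \<circ> f (\<omega> (n - 1))) 0\<close>.\<close>

definition coding_map :: "('i \<Rightarrow> 'a \<Rightarrow> 'a) \<Rightarrow> (nat \<Rightarrow> 'i) \<Rightarrow> 'a::{zero, t2_space}" where
  "coding_map f \<omega> = lim (\<lambda>n. foldr (\<lambda>j. f (\<omega> j)) [0..<n] 0)"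

text \<open>Since the space of \<open>P\<close> is \<open>\<Lambda>\<close>, the space of the infinite product is exactly the
  set of sequences in \<open>\<Lambda>\<close>.\<close>

definition bernoulli_measure ::
    "'i set \<Rightarrow> ('i \<Rightarrow> 'a \<Rightarrow> 'a) \<Rightarrow> 'a::{zero, t2_space} set \<Rightarrow> 'a measure \<Rightarrow> bool" where
  "bernoulli_measure \<Lambda> f K \<mu> \<longleftrightarrow>
     (\<exists>P. prob_space P \<and> sets P = Pow \<Lambda> \<and> (\<forall>i\<in>\<Lambda>. 0 < measure P {i}) \<and>
          \<mu> = distr (PiM (UNIV :: nat set) (\<lambda>_. P)) (restrict_space borel K) (coding_map f))"

end

theory Submission
  imports Defs "HOL-Analysis.Kronecker_Approximation_Theorem"
    "HOL-Computational_Algebra.Fundamental_Theorem_Algebra"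
begin

text \<open>
  By Weyl's criterion it suffices to show, for one non-zero integer vector \<open>m\<close> at a time, that
  \<open>exp (2 \<pi> i m \<bullet> D\<^sup>n x)\<close> averages to \<open>0\<close> for almost every \<open>x\<close>. Let \<open>x\<close> be coded by the random
  letters \<open>\<omega>\<^sub>0, \<omega>\<^sub>1, \<dots>\<close>, and put \<open>A\<^sub>i y = D\<^sup>r (y + t\<^sub>i)\<close> with \<open>r = r\<^sub>i\<close>. Undoing the first
  \<open>j\<close> maps gives \<open>D\<^sup>R x = S\<^sub>j + x\<^sub>j\<close> where \<open>R = r (\<omega>\<^sub>0) + \<dots> + r (\<omega>\<^sub>j\<^sub>-\<^sub>1)\<close>: here
  \<open>S\<^sub>j = A (\<omega>\<^sub>j\<^sub>-\<^sub>1) \<dots> A (\<omega>\<^sub>0) 0\<close> is a random walk that depends on the letters already seen, and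
  \<open>x\<^sub>j\<close> is the point coded by the letters still to come (\<open>expanded_point\<close>). Up to a small error
  \<open>x\<^sub>j\<close> depends on a bounded number of letters only, so the point is to control the characters
  \<open>\<phi>\<^sub>R (y) = exp (2 \<pi> i m \<bullet> D\<^sup>R y)\<close> along the walk, also on the set of times at which a given
  word comes next.

  The only probabilistic input is a strong law for bounded orthogonal variables
  (\<open>strong_law_orthogonal\<close>). It shows that almost surely the next letter is \<open>a\<close> with frequency
  \<open>p a\<close>, even when weighted by a bounded function of the past (\<open>AE_fresh_letter_averages\<close>).
  Everything after that is deterministic for a fixed typical sequence. Let \<open>a\<^sub>R (N)\<close> be the average
  of \<open>\<phi>\<^sub>R (S\<^sub>j)\<close> over \<open>j < N\<close>. Looking one letter ahead shows that \<open>a\<^sub>R\<close> is asymptotically a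
  combination of the \<open>a\<close> with index \<open>R + r\<^sub>i\<close>, with coefficients of modulus \<open>p i\<close>. Looking two
  letters ahead, the words \<open>ij\<close> and \<open>ji\<close> lead to the same index \<open>R + r\<^sub>i + r\<^sub>j\<close>, but their phases
  differ by \<open>\<phi>\<^sub>R (c\<^sub>i\<^sub>j)\<close>, where \<open>c\<^sub>i\<^sub>j = A\<^sub>j A\<^sub>i y - A\<^sub>i A\<^sub>j y\<close> does not depend on \<open>y\<close>. These
  commutators are exactly the elements of the set in the hypothesis. So
  \<open>B (R) = limsup \<bar>a\<^sub>R\<bar>\<close> is dominated by its averages over one step, and strictly so over two
  steps wherever \<open>m \<bullet> D\<^sup>R c\<^sub>i\<^sub>j\<close> stays away from the integers.

  That this happens often enough is where \<open>D\<close> being an expanding integer matrix enters: if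
  \<open>m \<bullet> D\<^sup>R c\<close> is uniformly close to integers along an arithmetic progression of exponents, then the
  errors satisfy exact linear relations, and expansion forces a bounded solution of these to vanish
  (\<open>near_integer_orbit\<close>). Then a non-zero integer vector is integral on all commutators, and these
  lie in a proper closed subgroup, contrary to the hypothesis
  (\<open>commutator_away_from_integers\<close>, \<open>nonresonance_of_dense_subgroup\<close>). A maximum
  principle for \<open>B\<close> (\<open>subaverage_vanishes\<close>) now gives \<open>B = 0\<close>, that is, all \<open>a\<^sub>R\<close> tend to \<open>0\<close>
  (\<open>average_tendsto_0\<close>).
\<close>

section \<open>Powers of an expanding matrix\<close>

lemma matpow_add: "matpow A (m + n) = matpow A m ** matpow A n"
  by (induction m) (simp_all add: matrix_mul_assoc)

lemma matpow_Suc2: "matpow A (Suc n) = matpow A n ** A"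
  using matpow_add[of A n 1] by simp

lemma matpow_mult: "matpow (matpow A m) n = matpow A (m * n)"
  by (induction n) (simp_all add: matpow_add)

lemma matpow_inverse:
  fixes A B :: "real^'n^'n"
  assumes "A ** B = mat 1"
  shows "matpow A n ** matpow B n = mat 1"
proof (induction n)
  case (Suc n)
  have "matpow A (Suc n) ** matpow B (Suc n) = matpow A n ** (A ** B) ** matpow B n"
    unfolding matpow_Suc2[of A] by (simp add: matrix_mul_assoc)
  with Suc show ?case by (simp add: assms)
qed simp

lemma transpose_matpow:
  fixes A :: "real^'n^'n"
  shows "transpose (matpow A n) = matpow (transpose A) n"
proof (induction n)
  case (Suc n)
  show ?case unfolding matpow_Suc2[of "transpose A"] by (simp add: matrix_transpose_mul Suc)
qed simp

text \<open>The action of \<open>p (A)\<close> on \<open>x\<close> by Horner's scheme, so that the recursion over \<open>pCons\<close> is available.\<close>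

definition poly_act :: "complex^'n^'n \<Rightarrow> complex poly \<Rightarrow> complex^'n \<Rightarrow> complex^'n" where
  "poly_act A p x = fold_coeffs (\<lambda>a y. a *s x + A *v y) p 0"

lemma poly_act_0 [simp]: "poly_act A 0 x = 0"
  by (simp add: poly_act_def)

lemma poly_act_pCons [simp]: "poly_act A (pCons a p) x = a *s x + A *v poly_act A p x"
  by (cases "p = 0 \<and> a = 0") (auto simp: poly_act_def)

lemma poly_act_add: "poly_act A (p + q) x = poly_act A p x + poly_act A q x"
  by (induction p q rule: poly_induct2) (simp_all add: vec.add algebra_simps)

lemma poly_act_smult: "poly_act A (smult c p) x = c *s poly_act A p x"
  by (induction p) (simp_all add: vec.scale vector_add_ldistrib)

lemma poly_act_mult: "poly_act A (p * q) x = poly_act A p (poly_act A q x)"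
  by (induction p) (simp_all add: poly_act_add poly_act_smult)

lemma poly_act_power: "poly_act A (monom c n) x = c *s ((*v) A ^^ n) x"
  by (induction n) (simp_all add: monom_0 monom_Suc vec.scale)

lemma poly_act_sum: "poly_act A (sum f S) x = (\<Sum>i\<in>S. poly_act A (f i) x)"
  by (induction S rule: infinite_finite_induct) (simp_all add: poly_act_add)

text \<open>Among \<open>CARD('n) + 1\<close> iterates of \<open>x\<close> two coincide or there is a linear dependence; either way the
coefficients form a polynomial.\<close>

lemma exists_annihilating_poly:
  fixes A :: "complex^'n^'n"
  shows "\<exists>p. p \<noteq> 0 \<and> poly_act A p x = 0"
proof -
  let ?v = "\<lambda>i. ((*v) A ^^ i) x" and ?I = "{..CARD('n)}"
  show ?thesis
  proof (cases "inj_on ?v ?I")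
    case False
    then obtain i j where ij: "i \<noteq> j" "?v i = ?v j"
      by (auto simp: inj_on_def)
    have "coeff (monom 1 i - monom (1::complex) j) i = 1" using ij by simp
    then have "monom 1 i + monom (-1::complex) j \<noteq> 0"
      by (metis coeff_0 diff_conv_add_uminus minus_monom zero_neq_one)
    moreover have "poly_act A (monom 1 i + monom (-1::complex) j) x = 0"
      using ij by (simp add: poly_act_add poly_act_power)
    ultimately show ?thesis by blast
  next
    case True
    have "vec.dependent (?v ` ?I)"
      using vec.independent_bound_general[of "?v ` ?I"] dim_subset_UNIV_cart_gen[of "?v ` ?I"] True
      by (auto simp: card_image)
    then obtain u where u: "\<exists>y\<in>?v ` ?I. u y \<noteq> 0" "(\<Sum>y\<in>?v ` ?I. u y *s y) = 0"
      using vec.dependent_finite[of "?v ` ?I"] by auto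
    define p where "p = (\<Sum>i\<in>?I. monom (u (?v i)) i)"
    obtain i where i: "i \<in> ?I" "u (?v i) \<noteq> 0" using u(1) by auto
    have "coeff p i = (\<Sum>j\<in>?I. if j = i then u (?v j) else 0)"
      unfolding p_def coeff_sum coeff_monom ..
    then have "coeff p i = u (?v i)" using i(1) by simp
    then have "p \<noteq> 0" using i(2) by auto
    moreover have "poly_act A p x = (\<Sum>y\<in>?v ` ?I. u y *s y)"
      unfolding p_def using True by (simp add: poly_act_sum poly_act_power sum.reindex)
    ultimately show ?thesis using u(2) by metis
  qed
qed

lemma perturbed_geometric_tendsto_0:
  fixes z e :: "nat \<Rightarrow> 'a::real_normed_vector"
  assumes step: "\<And>n. norm (z (Suc n)) \<le> q * norm (z n) + norm (e n)"
    and q: "0 \<le> q" "q < 1" and e: "e \<longlonglongrightarrow> 0"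
  shows "z \<longlonglongrightarrow> 0"
proof (rule LIMSEQ_I)
  fix \<epsilon> :: real assume \<epsilon>: "\<epsilon> > 0"
  define d where "d = \<epsilon> / 2"
  have d: "d > 0" "(1-q) * d > 0" using \<epsilon> q by (auto simp: d_def)
  from LIMSEQ_D[OF e d(2)] obtain N where N: "\<And>n. n \<ge> N \<Longrightarrow> norm (e n) < (1-q) * d" by auto
  have bound: "norm (z (N + k)) \<le> q ^ k * norm (z N) + d" for k
  proof (induction k)
    case (Suc k)
    have "norm (z (N + Suc k)) \<le> q * norm (z (N+k)) + norm (e (N+k))"
      using step[of "N+k"] by simp
    also have "\<dots> \<le> q * (q ^ k * norm (z N) + d) + (1-q) * d"
      using Suc q(1) N[of "N+k"] by (intro add_mono mult_left_mono) auto
    finally show ?case by (simp add: algebra_simps)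
  qed (use d in simp)
  have "(\<lambda>k. q ^ k * norm (z N)) \<longlonglongrightarrow> 0"
    using LIMSEQ_power_zero[of q] q by (intro tendsto_mult_left_zero) auto
  from LIMSEQ_D[OF this d(1)] obtain k0 where k0: "\<And>k. k \<ge> k0 \<Longrightarrow> q ^ k * norm (z N) < d" 
    by fastforce
  show "\<exists>n0. \<forall>n\<ge>n0. norm (z n - 0) < \<epsilon>"
  proof (intro exI[of _ "N + k0"] allI impI)
    fix n assume "n \<ge> N + k0"
    then have "norm (z n) \<le> q ^ (n - N) * norm (z N) + d" "q ^ (n - N) * norm (z N) < d"
      using bound[of "n - N"] k0[of "n - N"] by auto
    then have "norm (z n) < d + d" by linarith
    then show "norm (z n - 0) < \<epsilon>" by (simp add: d_def)
  qed
qed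

lemma norm_vector_smult_complex:
  fixes x :: "complex^'n"
  shows "norm (c *s x) = cmod c * norm x"
  unfolding norm_vec_def by (simp add: norm_mult L2_set_right_distrib)

text \<open>Split off a root, \<open>p = (X - c) q\<close>. If \<open>c\<close> is not an eigenvalue, \<open>A - c\<close> is injective and \<open>q\<close> already
annihilates \<open>x\<close>. Otherwise \<open>y = A x - c x\<close> is annihilated by \<open>q\<close>, so its iterates tend to \<open>0\<close> by
induction, and \<open>A\<^sup>n\<^sup>+\<^sup>1 x = c A\<^sup>n x + A\<^sup>n y\<close> with \<open>\<bar>c\<bar> < 1\<close> carries this over to \<open>x\<close>.\<close>

lemma iterates_tendsto_0_if_annihilated:
  fixes A :: "complex^'n^'n"
  assumes eig: "\<And>c v. v \<noteq> 0 \<Longrightarrow> A *v v = c *s v \<Longrightarrow> cmod c < 1"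
    and p: "p \<noteq> 0" "poly_act A p x = 0"
  shows "(\<lambda>n. ((*v) A ^^ n) x) \<longlonglongrightarrow> 0"
  using p
proof (induction "degree p" arbitrary: p x)
  case 0
  then obtain c where "p = [:c:]" "c \<noteq> 0" by (metis degree_eq_zeroE pCons_0_0)
  with 0 have "x = 0" by (simp add: vec.scale_eq_0_iff)
  moreover have "((*v) A ^^ n) 0 = 0" for n by (induction n) simp_all
  ultimately show ?case by simp
next
  case (Suc d)
  have "\<not> constant (poly p)" using Suc.hyps(2) by (simp add: constant_degree)
  then obtain c where "poly p c = 0" using fundamental_theorem_of_algebra by blast
  then obtain q where q: "p = [:-c, 1:] * q" by (metis dvdE poly_eq_0_iff_dvd)
  have q0: "q \<noteq> 0" using q Suc.prems by auto
  have dq: "degree q = d"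
    using Suc.hyps(2) q q0 by (subst (asm) q, subst (asm) degree_mult_eq) auto
  have lin: "poly_act A [:-c,1:] y = A *v y - c *s y" for y
    by (simp add: vec.scale_minus_left)
  show ?case
  proof (cases "\<exists>v. v \<noteq> 0 \<and> A *v v = c *s v")
    case False
    have "A *v poly_act A q x - c *s poly_act A q x = 0"
      using Suc.prems(2) unfolding q poly_act_mult lin .
    then have "poly_act A q x = 0" using False by auto
    then show ?thesis using Suc.hyps(1)[OF dq[symmetric] q0] by blast
  next
    case True
    then have c: "cmod c < 1" using eig by blast
    define y where "y = A *v x - c *s x"
    have "poly_act A q y = poly_act A (q * [:-c,1:]) x"
      unfolding poly_act_mult lin y_def ..
    also have "\<dots> = 0" using Suc.prems(2) q by (simp add: mult.commute)
    finally have lim: "(\<lambda>n. ((*v) A ^^ n) y) \<longlonglongrightarrow> 0"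
      using Suc.hyps(1)[OF dq[symmetric] q0] by blast
    have rec: "((*v) A ^^ Suc n) x = c *s ((*v) A ^^ n) x + ((*v) A ^^ n) y" for n
    proof (induction n)
      case (Suc n)
      have "((*v) A ^^ Suc (Suc n)) x = A *v (c *s ((*v) A ^^ n) x + ((*v) A ^^ n) y)"
        using Suc by simp
      then show ?case by (simp add: vec.add vec.scale)
    qed (simp add: y_def)
    show ?thesis
    proof (rule perturbed_geometric_tendsto_0[OF _ _ c lim])
      show "norm (((*v) A ^^ Suc n) x) \<le> cmod c * norm (((*v) A ^^ n) x) + norm (((*v) A ^^ n) y)" for n
        unfolding rec norm_vector_smult_complex[symmetric] by (rule norm_triangle_ineq)
    qed simp
  qed
qed

lemma complexified_matrix_vector:
  fixes A :: "real^'n^'n" and x :: "real^'n"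
  shows "map_matrix complex_of_real A *v (\<chi> i. complex_of_real (x $ i))
    = (\<chi> i. complex_of_real ((A *v x) $ i))"
  by (simp add: vec_eq_iff matrix_vector_mult_def map_matrix_def)

lemma matpow_vector: "matpow A n *v x = ((*v) A ^^ n) x"
  by (induction n) (simp_all flip: matrix_vector_mul_assoc)

lemma matpow_tendsto_0:
  fixes A :: "real^'n^'n"
  assumes "\<And>c. complex_eigenvalue A c \<Longrightarrow> cmod c < 1"
  shows "(\<lambda>n. matpow A n *v x) \<longlonglongrightarrow> 0"
proof -
  let ?A = "map_matrix complex_of_real A" and ?x = "\<chi> i. complex_of_real (x $ i)"
  obtain p where "p \<noteq> 0" "poly_act ?A p ?x = 0"
    using exists_annihilating_poly by blast
  then have lim: "(\<lambda>n. ((*v) ?A ^^ n) ?x) \<longlonglongrightarrow> 0"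
    using assms by (intro iterates_tendsto_0_if_annihilated) (auto simp: complex_eigenvalue_def)
  have iter: "((*v) ?A ^^ n) ?x = (\<chi> i. complex_of_real ((matpow A n *v x) $ i))" for n
    unfolding matpow_vector by (induction n) (simp_all add: complexified_matrix_vector)
  have "(\<lambda>n. (matpow A n *v x) $ i) \<longlonglongrightarrow> 0" for i
    using tendsto_Re[OF tendsto_vec_nth[OF lim, of i]] by (simp add: iter)
  then show ?thesis by (intro vec_tendstoI) simp
qed

text \<open>The eigenvalues of the inverse are the reciprocals of those of \<open>D\<close>, hence less than \<open>1\<close> in modulus.\<close>

lemma expanding_inverse:
  fixes D :: "real^'n^'n"
  assumes "expanding D"
  shows "matrix_inv D ** D = mat 1" "D ** matrix_inv D = mat 1"
    and "(\<lambda>n. matpow (matrix_inv D) n *v x) \<longlonglongrightarrow> 0"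
proof -
  have "x = 0" if "D *v x = 0" for x
  proof (rule ccontr)
    assume "x \<noteq> 0"
    then have "(\<chi> i. complex_of_real (x $ i)) \<noteq> 0" by (auto simp: vec_eq_iff)
    then have "complex_eigenvalue D 0"
      unfolding complex_eigenvalue_def using complexified_matrix_vector[of D x] that
      by (intro exI[of _ "\<chi> i. complex_of_real (x $ i)"]) (simp add: vec_eq_iff)
    then show False using assms by (auto simp: expanding_def)
  qed
  then have "invertible D"
    using matrix_left_invertible_ker[of D] by (simp add: invertible_left_inverse)
  then have inv: "D ** matrix_inv D = mat 1 \<and> matrix_inv D ** D = mat 1"
    unfolding invertible_def matrix_inv_def by (rule someI_ex)
  then show *: "matrix_inv D ** D = mat 1" "D ** matrix_inv D = mat 1" by auto
  show "(\<lambda>n. matpow (matrix_inv D) n *v x) \<longlonglongrightarrow> 0"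
  proof (rule matpow_tendsto_0)
    fix c assume "complex_eigenvalue (matrix_inv D) c"
    then obtain v where v: "v \<noteq> 0" "map_matrix complex_of_real (matrix_inv D) *v v = c *s v"
      by (auto simp: complex_eigenvalue_def)
    have "map_matrix complex_of_real D ** map_matrix complex_of_real (matrix_inv D)
        = map_matrix complex_of_real (D ** matrix_inv D)"
      by (simp add: vec_eq_iff map_matrix_def matrix_matrix_mult_def)
    also have "\<dots> = mat 1" by (simp add: * vec_eq_iff map_matrix_def mat_def)
    finally have "v = map_matrix complex_of_real D *v (c *s v)"
      by (metis matrix_vector_mul_assoc matrix_vector_mul_lid v(2))
    then have vc: "v = c *s (map_matrix complex_of_real D *v v)" by (simp add: vec.scale)
    then have c: "c \<noteq> 0" using v(1) by auto
    have "map_matrix complex_of_real D *v v = inverse c *s v"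
      by (subst (2) vc) (simp add: c)
    then have "1 < cmod (inverse c)"
      using assms v(1) by (auto simp: expanding_def complex_eigenvalue_def)
    then show "cmod c < 1" using c by (simp add: norm_inverse one_less_inverse_iff)
  qed
qed

text \<open>A matrix norm that is visibly invariant under transposition: the inverse of \<open>D\<close> contracts in the coding
map, and its transpose contracts on the span of integer vectors.\<close>

definition entry_sum :: "real^'n^'m \<Rightarrow> real" where
  "entry_sum A = (\<Sum>i\<in>UNIV. \<Sum>j\<in>UNIV. \<bar>A $ i $ j\<bar>)"

lemma entry_sum_nonneg: "0 \<le> entry_sum A"
  by (simp add: entry_sum_def sum_nonneg)

lemma norm_matrix_vector_le: "norm (A *v x) \<le> entry_sum A * norm x"
  for A :: "real^'n^'m"
proof -
  have "norm (A *v x) \<le> onorm ((*v) A) * norm x"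
    by (rule onorm) (simp add: matrix_vector_mul_bounded_linear)
  also have "\<dots> \<le> entry_sum A * norm x"
    unfolding entry_sum_def by (intro mult_right_mono onorm_le_matrix_component_sum) simp
  finally show ?thesis .
qed

lemma entry_sum_transpose: "entry_sum (transpose A) = entry_sum A"
  unfolding entry_sum_def transpose_def by (subst sum.swap) simp

lemma entry_sum_tendsto_0:
  fixes A :: "nat \<Rightarrow> real^'n^'m"
  assumes "\<And>x. (\<lambda>n. A n *v x) \<longlonglongrightarrow> 0"
  shows "(\<lambda>n. entry_sum (A n)) \<longlonglongrightarrow> 0"
proof -
  have "(\<lambda>n. A n $ i $ j) \<longlonglongrightarrow> 0" for i j
    using tendsto_vec_nth[OF assms[of "axis j 1"], of i]
    by (simp add: matrix_vector_mul_component inner_axis)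
  then show ?thesis unfolding entry_sum_def
    by (intro tendsto_null_sum tendsto_rabs_zero)
qed

section \<open>Integer vectors whose orbit is nearly integral on a vector\<close>

definition integer_vector :: "real^'n \<Rightarrow> bool" where
  "integer_vector v \<longleftrightarrow> (\<forall>i. v $ i \<in> \<int>)"

lemma integer_vector_matrix_vector:
  assumes "integer_matrix A" "integer_vector v"
  shows "integer_vector (A *v v)"
  using assms unfolding integer_vector_def integer_matrix_def matrix_vector_mult_def
  by (auto intro!: Ints_sum Ints_mult)

lemma integer_matrix_transpose: "integer_matrix A \<Longrightarrow> integer_matrix (transpose A)"
  by (simp add: integer_matrix_def transpose_def)

lemma integer_matrix_matpow:
  fixes A :: "real^'n^'n"
  assumes "integer_matrix A" shows "integer_matrix (matpow A n)"
proof (induction n)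
  case 0
  show ?case by (simp add: integer_matrix_def mat_def)
next
  case (Suc n)
  then show ?case using assms unfolding integer_matrix_def matpow.simps matrix_matrix_mult_def
    by (auto intro!: Ints_sum Ints_mult)
qed

text \<open>By simultaneous Dirichlet approximation a multiple \<open>q\<close> brings all coefficients of \<open>v\<close> so close to
integers that replacing them by these integers changes \<open>q v\<close> by a vector with entries below \<open>1\<close>. This
vector is integral, hence \<open>0\<close>.\<close>

lemma integer_relation:
  fixes B :: "(real^'n) set"
  assumes B: "finite B" "\<And>b. b \<in> B \<Longrightarrow> integer_vector b"
    and v: "integer_vector v" "v \<in> span B"
  obtains N :: int and n :: "real^'n \<Rightarrow> int"
  where "N > 0" "of_int N *\<^sub>R v = (\<Sum>b\<in>B. of_int (n b) *\<^sub>R b)"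
proof -
  obtain u where u: "v = (\<Sum>b\<in>B. u b *\<^sub>R b)"
    using v(2) span_finite[OF B(1)] by auto
  obtain h where h: "bij_betw h {0..<card B} B"
    using ex_bij_betw_nat_finite[OF B(1)] by blast
  define g where "g = inv_into {0..<card B} h"
  have g: "g b < card B" "h (g b) = b" if "b \<in> B" for b
    using that h inv_into_into[of b h "{0..<card B}"] unfolding g_def
    by (auto simp: bij_betw_def f_inv_into_f)
  \<comment> \<open>With precision \<open>1 / N\<close> in each coefficient the error vector has entries at most \<open>C / N < 1\<close>.\<close>
  define C where "C = (\<Sum>b\<in>B. norm b)"
  define N where "N = nat \<lceil>C\<rceil> + 1"
  have N: "C < real N" "N > 0" unfolding N_def by linarith+
  obtain q p where q: "0 < q" "\<And>i. i < card B \<Longrightarrow> \<bar>of_int q * u (h i) - of_int (p i)\<bar> < 1 / real N"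
    using Dirichlet_approx_simult[OF N(2), where n = "card B" and \<theta> = "\<lambda>i. u (h i)"] by metis
  define z where "z = of_int q *\<^sub>R v - (\<Sum>b\<in>B. of_int (p (g b)) *\<^sub>R b)"
  have "z $ i = 0" for i
  proof -
    have "z $ i = (\<Sum>b\<in>B. (of_int q * u b - of_int (p (g b))) * b $ i)"
      unfolding z_def u by (simp add: sum_component scaleR_sum_right sum_subtractf algebra_simps)
    then have "\<bar>z $ i\<bar> \<le> (\<Sum>b\<in>B. \<bar>(of_int q * u b - of_int (p (g b))) * b $ i\<bar>)"
      by simp
    also have "\<dots> \<le> (\<Sum>b\<in>B. 1 / real N * norm b)"
    proof (rule sum_mono)
      fix b assume b: "b \<in> B"
      show "\<bar>(of_int q * u b - of_int (p (g b))) * b $ i\<bar> \<le> 1 / real N * norm b"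
        unfolding abs_mult using q(2)[OF g(1)[OF b]] g(2)[OF b]
        by (intro mult_mono component_le_norm_cart) auto
    qed
    also have "\<dots> = C / real N" by (simp add: C_def sum_divide_distrib)
    also have "\<dots> < 1" using N by simp
    finally have small: "\<bar>z $ i\<bar> < 1" .
    have "z $ i \<in> \<int>" unfolding z_def
      using B(2) v(1) by (auto simp: sum_component integer_vector_def intro!: Ints_diff Ints_mult Ints_sum)
    then show ?thesis using small by (auto elim!: Ints_cases)
  qed
  then have "z = 0" by (simp add: vec_eq_iff)
  then show ?thesis using that[OF q(1), of "\<lambda>b. p (g b)"] by (simp add: z_def)
qed

text \<open>Suppose that all \<open>(U\<^sup>l m) \<bullet> c\<close> are within \<open>\<epsilon>\<close> of integers. Choose a basis \<open>B\<close> of the span of the orbit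
of \<open>m\<close> inside the orbit, and for each \<open>b\<close> in \<open>B\<close> an integer relation between \<open>U b\<close> and \<open>B\<close>. The
errors satisfy these relations modulo \<open>1\<close>, and exactly if \<open>\<epsilon>\<close> is small in terms of the coefficients.
So the functionals \<open>\<psi>\<^sub>l\<close> that take the errors at time \<open>l\<close> as values on \<open>B\<close> satisfy
\<open>\<psi>\<^sub>l (U x) = \<psi>\<^sub>l\<^sub>+\<^sub>1 (x)\<close>. They are bounded uniformly in \<open>l\<close>, and \<open>U\<close> is expanding, hence
\<open>\<psi>\<^sub>0 (x) = \<psi>\<^sub>l (U\<^sup>-\<^sup>l x)\<close> tends to \<open>0\<close>: there is no error on \<open>B\<close>. The point is that \<open>\<epsilon>\<close>
and \<open>J\<close> do not depend on \<open>c\<close>.\<close>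

lemma near_integer_orbit:
  fixes U :: "real^'n^'n" and m :: "real^'n"
  assumes U: "integer_matrix U" "invertible U"
    and contr: "\<And>x. (\<lambda>n. matpow (matrix_inv U) n *v x) \<longlonglongrightarrow> 0"
    and m: "integer_vector m" "m \<noteq> 0"
  obtains \<epsilon> J where "\<epsilon> > 0"
    "\<And>c. (\<And>l. \<exists>z\<in>\<int>. \<bar>(matpow U l *v m) \<bullet> c - z\<bar> < \<epsilon>) \<Longrightarrow> (matpow U J *v m) \<bullet> c \<in> \<int>"
proof -
  define V where "V = range (\<lambda>l. matpow U l *v m)"
  have V_int: "integer_vector x" if "x \<in> V" for x
    using that integer_vector_matrix_vector[OF integer_matrix_matpow[OF U(1)] m(1)] by (auto simp: V_def)
  have V_inv: "matpow U l *v x \<in> V" if "x \<in> V" for x l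
    using that by (force simp: V_def matrix_vector_mul_assoc simp flip: matpow_add)
  obtain B where B: "B \<subseteq> V" "independent B" "V \<subseteq> span B"
    using maximal_independent_subset[of V] by blast
  have fin: "finite B" using B(2) independent_bound by blast
  have "matpow U 0 *v m \<in> V" unfolding V_def by blast
  then have "m \<in> span B" using B(3) by auto
  then have "B \<noteq> {}" using m(2) by auto
  then obtain b0 where b0: "b0 \<in> B" by blast
  then obtain J where J: "b0 = matpow U J *v m" using B(1) by (auto simp: V_def)
  have UV: "U *v x \<in> V" if "x \<in> V" for x using V_inv[OF that, of 1] by simp
  have "\<exists>N n. 0 < (N::int) \<and> of_int N *\<^sub>R (U *v b) = (\<Sum>b'\<in>B. of_int (n b') *\<^sub>R b')" if "b \<in> B" for b
    
  proof -
    have bV: "b \<in> V" "\<And>b. b \<in> B \<Longrightarrow> integer_vector b" using that B(1) V_int by auto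
    have "U *v b \<in> span B" using UV[OF bV(1)] B(3) by auto
    from integer_relation[OF fin bV(2) V_int[OF UV[OF bV(1)]] this]
    obtain N n where "0 < (N::int)" "of_int N *\<^sub>R (U *v b) = (\<Sum>b'\<in>B. of_int (n b') *\<^sub>R b')" .
    then show ?thesis by blast
  qed
  then have "\<forall>b\<in>B. \<exists>Nn. 0 < (fst Nn::int) \<and> of_int (fst Nn) *\<^sub>R (U *v b) = (\<Sum>b'\<in>B. of_int (snd Nn b') *\<^sub>R b')"
    by fastforce
  then obtain Nn where Nn: "\<forall>b\<in>B. 0 < (fst (Nn b)::int) \<and> of_int (fst (Nn b)) *\<^sub>R (U *v b) = (\<Sum>b'\<in>B. of_int (snd (Nn b) b') *\<^sub>R b')"
    by (rule bchoice[THEN exE])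
  define N n where "N b = fst (Nn b)" and "n b = snd (Nn b)" for b
  have N: "\<And>b. b \<in> B \<Longrightarrow> 0 < (N b::int)"
    and rel: "\<And>b. b \<in> B \<Longrightarrow> of_int (N b) *\<^sub>R (U *v b) = (\<Sum>b'\<in>B. of_int (n b b') *\<^sub>R b')"
    using Nn by (auto simp: N_def n_def)
  \<comment> \<open>\<open>W b\<close> bounds the total weight of the relation for \<open>b\<close>, so errors below \<open>\<epsilon>\<close> can only violate the
  relation by less than \<open>1\<close>.\<close>
  define W where "W b = real_of_int (N b) + (\<Sum>b'\<in>B. \<bar>real_of_int (n b b')\<bar>)" for b
  define \<epsilon> where "\<epsilon> = 1 / (1 + (\<Sum>b\<in>B. W b))"
  have W0: "0 \<le> W b" if "b \<in> B" for b
    unfolding W_def using N[OF that] by (intro add_nonneg_nonneg sum_nonneg) auto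
  have \<epsilon>0: "\<epsilon> > 0" unfolding \<epsilon>_def using W0 by (simp add: add_pos_nonneg sum_nonneg)
  have W\<epsilon>: "W b * \<epsilon> < 1" if "b \<in> B" for b
  proof -
    have "W b < 1 + (\<Sum>b\<in>B. W b)" using member_le_sum[OF that, of W] W0 fin by simp
    then show ?thesis unfolding \<epsilon>_def using W0[OF that] by (simp add: divide_simps)
  qed
  have "b0 \<bullet> c \<in> \<int>" if c: "\<And>l. \<exists>z\<in>\<int>. \<bar>(matpow U l *v m) \<bullet> c - z\<bar> < \<epsilon>" for c
  proof -
    have "\<forall>x\<in>V. \<exists>z. z \<in> \<int> \<and> \<bar>x \<bullet> c - z\<bar> < \<epsilon>" using c by (auto simp: V_def)
    then obtain z where z: "\<And>x. x \<in> V \<Longrightarrow> z x \<in> \<int>" "\<And>x. x \<in> V \<Longrightarrow> \<bar>x \<bullet> c - z x\<bar> < \<epsilon>"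
      by metis
    define e where "e x = x \<bullet> c - z x" for x
    have "\<forall>b. \<exists>g. linear g \<and> (\<forall>x\<in>B. g x = (if x = b then 1 else (0::real)))"
      by (intro allI linear_independent_extend B(2))
    then have "\<exists>g. \<forall>b. linear (g b) \<and> (\<forall>x\<in>B. g b x = (if x = b then 1 else (0::real)))"
      by (rule choice)
    then obtain g where g: "\<And>b. linear (g b)" "\<And>b x. x \<in> B \<Longrightarrow> g b x = (if x = b then 1 else (0::real))"
      by blast
    define \<psi> where "\<psi> l x = (\<Sum>b\<in>B. e (matpow U l *v b) * g b x)" for l x
    have lin: "linear (\<psi> l)" for l
      unfolding \<psi>_def 
      by (intro linear_compose_sum ballI linear_compose_scale_right[OF g(1), unfolded real_scaleR_def])
    have \<psi>B: "\<psi> l b = e (matpow U l *v b)" if "b \<in> B" for l b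
    proof -
      have "\<psi> l b = (\<Sum>b'\<in>B. if b = b' then e (matpow U l *v b') else 0)"
        unfolding \<psi>_def using that by (intro sum.cong) (auto simp: g(2))
      then show ?thesis using fin that by simp
    qed
    have linU: "linear (\<lambda>x. \<psi> l (U *v x))" for l
      using linear_compose[OF matrix_vector_mul_linear[of U] lin[of l]] by (simp add: o_def)
    have stepB: "\<psi> l (U *v b) = \<psi> (Suc l) b" if b: "b \<in> B" for l b
    proof -
      have inV: "matpow U l *v b' \<in> V" if "b' \<in> B" for l b' using that B(1) V_inv by blast
      have "of_int (N b) *\<^sub>R (matpow U (Suc l) *v b) = matpow U l *v (of_int (N b) *\<^sub>R (U *v b))"
        by (simp add: matpow_Suc2 matrix_vector_mul_assoc matrix_vector_mult_scaleR del: matpow.simps)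
      also have "\<dots> = (\<Sum>b'\<in>B. of_int (n b b') *\<^sub>R (matpow U l *v b'))"
        unfolding rel[OF b] by (simp add: linear_sum[OF matrix_vector_mul_linear] matrix_vector_mult_scaleR)
      finally have vrel: "of_int (N b) *\<^sub>R (matpow U (Suc l) *v b) = (\<Sum>b'\<in>B. of_int (n b b') *\<^sub>R (matpow U l *v b'))" .
      define \<Delta> where "\<Delta> = of_int (N b) * e (matpow U (Suc l) *v b) - (\<Sum>b'\<in>B. of_int (n b b') * e (matpow U l *v b'))"
      have "\<Delta> = (of_int (N b) *\<^sub>R (matpow U (Suc l) *v b)) \<bullet> c - (\<Sum>b'\<in>B. of_int (n b b') *\<^sub>R (matpow U l *v b')) \<bullet> c
          - of_int (N b) * z (matpow U (Suc l) *v b) + (\<Sum>b'\<in>B. of_int (n b b') * z (matpow U l *v b'))"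
        unfolding \<Delta>_def e_def by (simp add: inner_sum_left algebra_simps sum_subtractf sum.distrib del: matpow.simps)
      also have "\<dots> = (\<Sum>b'\<in>B. of_int (n b b') * z (matpow U l *v b')) - of_int (N b) * z (matpow U (Suc l) *v b)"
        unfolding vrel by simp
      also have "\<dots> \<in> \<int>"
        by (intro Ints_diff Ints_sum Ints_mult Ints_of_int z(1) inV b)
      finally have "\<Delta> \<in> \<int>" .
      moreover have "\<bar>\<Delta>\<bar> < 1"
      proof -
        have eb: "\<bar>e (matpow U l *v b')\<bar> \<le> \<epsilon>" if "b' \<in> B" for b' l
          using z(2)[OF inV[OF that, of l]] by (simp add: e_def)
        have "\<bar>\<Delta>\<bar> \<le> \<bar>of_int (N b) * e (matpow U (Suc l) *v b)\<bar> + \<bar>\<Sum>b'\<in>B. of_int (n b b') * e (matpow U l *v b')\<bar>"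
          unfolding \<Delta>_def by (rule abs_triangle_ineq4)
        also have "\<dots> \<le> of_int (N b) * \<epsilon> + (\<Sum>b'\<in>B. \<bar>of_int (n b b')\<bar> * \<epsilon>)"
        proof (rule add_mono)
          show "\<bar>of_int (N b) * e (matpow U (Suc l) *v b)\<bar> \<le> of_int (N b) * \<epsilon>"
            unfolding abs_mult using N[OF b] eb[OF b, of "Suc l"] by (auto intro!: mult_mono simp del: matpow.simps)
          show "\<bar>\<Sum>b'\<in>B. of_int (n b b') * e (matpow U l *v b')\<bar> \<le> (\<Sum>b'\<in>B. \<bar>of_int (n b b')\<bar> * \<epsilon>)"
            by (rule order_trans[OF sum_abs]) (auto simp: abs_mult intro!: sum_mono mult_left_mono eb)
        qed
        also have "\<dots> = W b * \<epsilon>" by (simp add: W_def distrib_right sum_distrib_right)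
        finally show ?thesis using W\<epsilon>[OF b] by simp
      qed
      ultimately have "\<Delta> = 0" by (auto elim!: Ints_cases)
      then have "of_int (N b) * \<psi> (Suc l) b = (\<Sum>b'\<in>B. of_int (n b b') * \<psi> l b')"
        by (simp add: \<Delta>_def \<psi>B b del: matpow.simps)
      also have "\<dots> = \<psi> l (\<Sum>b'\<in>B. of_int (n b b') *\<^sub>R b')"
        by (simp add: linear_sum[OF lin] linear_scale[OF lin])
      also have "\<dots> = of_int (N b) * \<psi> l (U *v b)"
        unfolding rel[OF b, symmetric] by (simp add: linear_scale[OF lin])
      finally show ?thesis using N[OF b] by simp
    qed
    have step: "\<psi> l (U *v x) = \<psi> (Suc l) x" if "x \<in> span B" for l x
      by (rule linear_eq_on_span[OF linU lin stepB that])
    have inj: "inj ((*v) U)"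
      using U(2) by (metis invertible_left_inverse matrix_left_invertible_injective)
    have "(*v) U ` span B \<subseteq> span B"
    proof -
      have "(*v) U ` B \<subseteq> span B" using B UV by blast
      then show ?thesis
        by (metis linear_span_image matrix_vector_mul_linear span_minimal subspace_span)
    qed
    moreover have "dim ((*v) U ` span B) = dim (span B)"
      by (rule dim_image_eq[OF matrix_vector_mul_linear]) (use inj in \<open>auto intro: inj_on_subset\<close>)
    ultimately have surj: "(*v) U ` span B = span B"
      by (metis subspace_dim_equal linear_subspace_image matrix_vector_mul_linear subspace_span order_refl)
    have Uinv: "matrix_inv U ** U = mat 1"
      using U(2) unfolding invertible_def matrix_inv_def by (metis (mono_tags, lifting) someI_ex)
    have pull: "matrix_inv U *v x \<in> span B \<and> U *v (matrix_inv U *v x) = x" if "x \<in> span B" for x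
    proof -
      have "x \<in> (*v) U ` span B" by (subst surj) (rule that)
      then obtain y where y: "x = U *v y" "y \<in> span B" by (rule imageE)
      have "matrix_inv U *v (U *v y) = y"
        by (subst matrix_vector_mul_assoc) (simp add: Uinv)
      then show ?thesis using y by simp
    qed
    have pulled: "matpow (matrix_inv U) l *v x \<in> span B \<and> \<psi> 0 x = \<psi> l (matpow (matrix_inv U) l *v x)"
      if "x \<in> span B" for l x
    proof (induction l)
      case (Suc l)
      let ?y = "matpow (matrix_inv U) l *v x"
      have y: "matpow (matrix_inv U) (Suc l) *v x = matrix_inv U *v ?y"
        by (simp add: matrix_vector_mul_assoc)
      show ?case unfolding y using Suc pull[of ?y] step[of "matrix_inv U *v ?y" l] by simp
    qed (use that in simp)
    have "(\<lambda>l. \<psi> l (matpow (matrix_inv U) l *v b0)) \<longlonglongrightarrow> 0"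
      unfolding \<psi>_def
    proof (rule tendsto_null_sum)
      fix b assume b: "b \<in> B"
      have cont: "continuous_on UNIV (g b)" by (rule linear_continuous_on) (simp add: g(1) linear_linear)
      have "(\<lambda>l. g b (matpow (matrix_inv U) l *v b0)) \<longlonglongrightarrow> g b 0"
        using continuous_on_tendsto_compose[OF cont contr[of b0]] by simp
      then have lim: "(\<lambda>l. g b (matpow (matrix_inv U) l *v b0)) \<longlonglongrightarrow> 0"
        using linear_0[OF g(1)[of b]] by simp
      have "\<bar>e (matpow U l *v b)\<bar> \<le> \<epsilon>" for l
        using z(2)[of "matpow U l *v b"] b B(1) V_inv by (auto simp: e_def less_imp_le)
      then show "(\<lambda>l. e (matpow U l *v b) * g b (matpow (matrix_inv U) l *v b0)) \<longlonglongrightarrow> 0"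
        by (intro Lim_null_comparison[OF _ tendsto_mult_right_zero[OF tendsto_rabs_zero[OF lim], of \<epsilon>]])
           (auto simp: abs_mult intro!: mult_right_mono always_eventually)
    qed
    then have "(\<lambda>l::nat. \<psi> 0 b0) \<longlonglongrightarrow> 0"
      using pulled[OF span_base[OF b0]] by simp
    then have "\<psi> 0 b0 = 0" by (simp add: LIMSEQ_const_iff)
    then have "e b0 = 0" using \<psi>B[OF b0, of 0] by simp
    then show ?thesis using z(1)[of b0] b0 B(1) by (auto simp: e_def)
  qed
  then show ?thesis using that[OF \<epsilon>0, of J] by (simp add: J)
qed

section \<open>A maximum principle for subaverages\<close>

text \<open>A random sum of steps \<open>r i\<close> begins with the word \<open>u\<close> with positive probability, so a fixed proportion
of any deficit from the upper bound \<open>M\<close> at the end of \<open>u\<close> is felt at its start.\<close>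

lemma subaverage_hit:
  fixes p :: "'i \<Rightarrow> real" and B :: "nat \<Rightarrow> real" and r :: "'i \<Rightarrow> nat"
  assumes I: "finite I" "\<And>i. i \<in> I \<Longrightarrow> 0 < p i" "sum p I = 1"
    and M: "\<And>R. B R \<le> M"
    and sub: "\<And>R. B R \<le> (\<Sum>i\<in>I. p i * B (R + r i))"
    and u: "set u \<subseteq> I"
  shows "\<exists>\<kappa>>0. \<kappa> \<le> 1 \<and> (\<forall>\<delta> R. B (R + sum_list (map r u)) \<le> M - \<delta> \<longrightarrow> B R \<le> M - \<kappa> * \<delta>)"
  using u
proof (induction u)
  case Nil
  show ?case by (intro exI[of _ 1]) auto
next
  case (Cons i u)
  then obtain \<kappa> where \<kappa>: "\<kappa> > 0" "\<kappa> \<le> 1"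
    "\<And>\<delta> R. B (R + sum_list (map r u)) \<le> M - \<delta> \<Longrightarrow> B R \<le> M - \<kappa> * \<delta>"
    by auto
  have i: "i \<in> I" using Cons.prems by simp
  have pi: "p i \<le> 1"
    using member_le_sum[of i I p] I i by (auto simp: less_imp_le)
  show ?case
  proof (intro exI[of _ "p i * \<kappa>"] conjI allI impI)
    show "0 < p i * \<kappa>" using I(2)[OF i] \<kappa> by simp
    show "p i * \<kappa> \<le> 1" using pi \<kappa> I(2)[OF i] by (simp add: mult_le_one)
  next
    fix \<delta> R assume "B (R + sum_list (map r (i # u))) \<le> M - \<delta>"
    then have 1: "B (R + r i) \<le> M - \<kappa> * \<delta>"
      by (intro \<kappa>(3)) (simp add: add.assoc)
    have "B R \<le> (\<Sum>j\<in>I. p j * B (R + r j))" by (rule sub)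
    also have "\<dots> = p i * B (R + r i) + (\<Sum>j\<in>I-{i}. p j * B (R + r j))"
      using I(1) i by (rule sum.remove)
    also have "\<dots> \<le> p i * (M - \<kappa> * \<delta>) + (\<Sum>j\<in>I-{i}. p j * M)"
      using 1 M I(2) i by (intro add_mono mult_left_mono sum_mono) (auto simp: less_imp_le)
    also have "(\<Sum>j\<in>I-{i}. p j * M) = (\<Sum>j\<in>I. p j * M) - p i * M"
      using sum.remove[OF I(1) i, of "\<lambda>j. p j * M"] by simp
    also have "(\<Sum>j\<in>I. p j * M) = M"
      using I(3) by (simp flip: sum_distrib_right)
    finally show "B R \<le> M - p i * \<kappa> * \<delta>" by (simp add: algebra_simps)
  qed
qed

text \<open>Each \<open>n\<close> in \<open>F\<close> is a difference of elements of the semigroup; the sum of the subtrahends works for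
all of them at once.\<close>

lemma uniform_shift_into_semigroup:
  fixes S :: "nat set"
  assumes S: "0 \<in> S" "\<And>a b. a \<in> S \<Longrightarrow> b \<in> S \<Longrightarrow> a + b \<in> S"
    and F: "finite F" "\<And>n. n \<in> F \<Longrightarrow> \<exists>s\<in>S. n + s \<in> S"
  shows "\<exists>b\<in>S. \<forall>n\<in>F. n + b \<in> S"
  using F
proof (induction F rule: finite_induct)
  case empty
  then show ?case using S by auto
next
  case (insert x F)
  then obtain b where b: "b \<in> S" "\<forall>n\<in>F. n + b \<in> S" by auto
  obtain s where s: "s \<in> S" "x + s \<in> S" using insert.prems by auto
  have "x + (s + b) \<in> S"
    using S(2)[OF s(2) b(1)] by (simp add: add.assoc)
  moreover have "n + (s + b) \<in> S" if "n \<in> F" for n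
    using S(2)[OF s(1), of "n + b"] b(2) that by (simp add: add.left_commute)
  ultimately show ?case
    by (intro bexI[of _ "s + b"] S(2)[OF s(1) b(1)]) auto
qed

text \<open>A maximum principle. Let \<open>M\<close> be the supremum of \<open>B\<close>. At an exponent where some \<open>w i j\<close> is at most
\<open>1 - \<theta>\<close>, the second inequality keeps \<open>B\<close> below \<open>M\<close> by a fixed proportion of \<open>M\<close>. Starting from any
\<open>R\<close>, there is such an exponent at distance \<open>b + r i0 * l\<close>. This distance is reached by a sum of random
steps with a probability bounded below independently of \<open>l\<close>: the sum does so for a suitable choice
of a bounded number of steps, made once the remaining distance is small. Hence \<open>B R\<close> is itself
below \<open>M\<close> by a fixed proportion of \<open>M\<close>, for all \<open>R\<close>, and \<open>M = 0\<close>. The fixed margin \<open>b\<close> is there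
because not every small remaining distance is a sum of steps.\<close>

lemma subaverage_vanishes:
  fixes p :: "'i \<Rightarrow> real" and B :: "nat \<Rightarrow> real" and r :: "'i \<Rightarrow> nat"
    and w :: "'i \<Rightarrow> 'i \<Rightarrow> nat \<Rightarrow> real"
  assumes I: "finite I" "\<And>i. i \<in> I \<Longrightarrow> 0 < p i" "sum p I = 1"
    and r: "\<And>i. i \<in> I \<Longrightarrow> 1 \<le> r i"
    and B: "\<And>R. 0 \<le> B R" "\<And>R. B R \<le> C"
    and sub: "\<And>R. B R \<le> (\<Sum>i\<in>I. p i * B (R + r i))"
    and sub2: "\<And>R. B R \<le> (\<Sum>i\<in>I. \<Sum>j\<in>I. p i * p j * w i j R * B (R + r i + r j))"
    and w: "\<And>i j R. i \<in> I \<Longrightarrow> j \<in> I \<Longrightarrow> 0 \<le> w i j R" "\<And>i j R. i \<in> I \<Longrightarrow> j \<in> I \<Longrightarrow> w i j R \<le> 1"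
    and \<theta>: "\<theta> > 0" and i0: "i0 \<in> I"
    and escape: "\<And>R. \<exists>l. \<exists>i\<in>I. \<exists>j\<in>I. w i j (R + r i0 * l) \<le> 1 - \<theta>"
  shows "B R = 0"
proof -
  define M where "M = (SUP R. B R)"
  have bdd: "bdd_above (range B)" using B(2) by (intro bdd_aboveI[of _ C]) auto
  have M: "B R \<le> M" for R unfolding M_def using bdd by (rule cSUP_upper[OF UNIV_I])
  have M0: "0 \<le> M" using B(1) M order_trans by blast
  define S where "S = {sum_list (map r u) | u. set u \<subseteq> I}"
  have S0: "0 \<in> S" unfolding S_def by (auto intro!: exI[of _ "[]"])
  have Sadd: "a + b \<in> S" if ab: "a \<in> S" "b \<in> S" for a b
  proof -
    obtain u v where "a = sum_list (map r u)" "set u \<subseteq> I" "b = sum_list (map r v)" "set v \<subseteq> I"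
      using ab by (auto simp: S_def)
    then have "a + b = sum_list (map r (u @ v))" "set (u @ v) \<subseteq> I" by auto
    then show ?thesis unfolding S_def by blast
  qed
  have Sr: "r i \<in> S" if "i \<in> I" for i
    unfolding S_def using that by (auto intro!: exI[of _ "[i]"])
  \<comment> \<open>Remaining distances that occur on the way. They are closed under subtracting a step as long as the
  result is non-negative, but need not be sums of steps themselves.\<close>
  define G where "G = {n. \<exists>s\<in>S. n + s \<in> S}"
  define q where "q = Max (r ` I)"
  have q: "r i \<le> q" if "i \<in> I" for i unfolding q_def using that I(1) by simp
  have "\<exists>b\<in>S. \<forall>n\<in>G \<inter> {..q}. n + b \<in> S"
    by (rule uniform_shift_into_semigroup[OF S0 Sadd]) (auto simp: G_def)
  \<comment> \<open>The margin \<open>b\<close> turns all small remaining distances into sums of steps.\<close>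
  then obtain b where b: "b \<in> S" "\<forall>n\<in>G \<inter> {..q}. n + b \<in> S"
    by blast
  have "\<exists>\<kappa>>0. \<forall>n\<in>F. \<forall>\<delta>\<ge>0. \<forall>R. B (R + n + b) \<le> M - \<delta> \<longrightarrow> B R \<le> M - \<kappa> * \<delta>"
    if "finite F" "F \<subseteq> G \<inter> {..q}" for F
    using that
  proof (induction F rule: finite_induct)
    case empty
    then show ?case by (auto intro: exI[of _ 1])
  next
    case (insert n F)
    then obtain \<kappa> where \<kappa>: "\<kappa> > 0" "\<And>n' \<delta> R. n'\<in>F \<Longrightarrow> \<delta>\<ge>0 \<Longrightarrow> B (R + n' + b) \<le> M - \<delta> \<Longrightarrow> B R \<le> M - \<kappa> * \<delta>"
      by auto
    obtain u where u: "n + b = sum_list (map r u)" "set u \<subseteq> I"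
      using bspec[OF b(2), of n] insert.prems by (auto simp: S_def)
    from subaverage_hit[OF I M sub u(2)] u(1) obtain \<kappa>' where \<kappa>': "\<kappa>' > 0"
      "\<And>\<delta> R. B (R + (n + b)) \<le> M - \<delta> \<Longrightarrow> B R \<le> M - \<kappa>' * \<delta>" by auto
    show ?case
    proof (intro exI[of _ "min \<kappa> \<kappa>'"] conjI ballI allI impI)
      show "0 < min \<kappa> \<kappa>'" using \<kappa>(1) \<kappa>'(1) by simp
    next
      fix n' \<delta> R assume *: "n' \<in> insert n F" "(0::real) \<le> \<delta>" "B (R + n' + b) \<le> M - \<delta>"
      have "B R \<le> M - \<kappa> * \<delta> \<or> B R \<le> M - \<kappa>' * \<delta>"
        using * \<kappa>(2) \<kappa>'(2)[of R \<delta>] by (auto simp: add.assoc)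
      moreover have "min \<kappa> \<kappa>' * \<delta> \<le> \<kappa> * \<delta>" "min \<kappa> \<kappa>' * \<delta> \<le> \<kappa>' * \<delta>"
        using *(2) by (auto intro!: mult_right_mono)
      ultimately show "B R \<le> M - min \<kappa> \<kappa>' * \<delta>" by linarith
    qed
  qed
  from this[of "G \<inter> {..q}"] obtain \<kappa> where \<kappa>: "\<kappa> > 0"
    "\<And>n \<delta> R. n \<in> G \<Longrightarrow> n \<le> q \<Longrightarrow> \<delta> \<ge> 0 \<Longrightarrow> B (R + n + b) \<le> M - \<delta> \<Longrightarrow> B R \<le> M - \<kappa> * \<delta>"
    by auto
  \<comment> \<open>Far from the target all steps are allowed, so the bound passes through the one-step average; close
  to it the target is hit with probability at least \<open>\<kappa>\<close>.\<close>
  have reach: "B R \<le> M - \<kappa> * \<delta>" if "n \<in> G" "\<delta> \<ge> 0" "B (R + n + b) \<le> M - \<delta>" for n \<delta> R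
    using that
  proof (induction n arbitrary: R rule: less_induct)
    case (less n)
    show ?case
    proof (cases "n \<le> q")
      case True
      then show ?thesis using \<kappa>(2) less.prems by blast
    next
      case False
      have "B (R + r i) \<le> M - \<kappa> * \<delta>" if i: "i \<in> I" for i
      proof (rule less.IH[of "n - r i"])
        have le: "r i \<le> n" using q[OF i] False by simp
        then show "n - r i < n" using r[OF i] by simp
        obtain s where s: "s \<in> S" "n + s \<in> S" using less.prems(1) by (auto simp: G_def)
        have "s + r i \<in> S" "(n - r i) + (s + r i) \<in> S"
          using s le Sadd[OF s(1) Sr[OF i]] by (auto simp: ac_simps)
        then show "n - r i \<in> G" by (auto simp: G_def)
        show "B (R + r i + (n - r i) + b) \<le> M - \<delta>" using less.prems(3) le by simp
      qed (rule less.prems(2))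
      then have "(\<Sum>i\<in>I. p i * B (R + r i)) \<le> (\<Sum>i\<in>I. p i * (M - \<kappa> * \<delta>))"
        using I(2) by (intro sum_mono mult_left_mono) (auto simp: less_imp_le)
      also have "\<dots> = M - \<kappa> * \<delta>" using I(3) by (simp flip: sum_distrib_right)
      finally show ?thesis using sub order_trans by blast
    qed
  qed
  define \<rho> where "\<rho> = Min (p ` I)"
  have ne: "I \<noteq> {}" using i0 by auto
  have \<rho>: "0 < \<rho>" "\<And>i. i \<in> I \<Longrightarrow> \<rho> \<le> p i"
    unfolding \<rho>_def using I ne by auto
  have drop: "B R \<le> M - \<rho> * \<rho> * \<theta> * M" if ij: "i \<in> I" "j \<in> I" "w i j R \<le> 1 - \<theta>" for R i j
  proof -
    have "B R \<le> (\<Sum>i\<in>I. \<Sum>j\<in>I. p i * p j * w i j R * B (R + r i + r j))" by (rule sub2)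
    also have "\<dots> \<le> (\<Sum>i\<in>I. \<Sum>j\<in>I. p i * p j * w i j R * M)"
      using I(2) w M by (intro sum_mono mult_left_mono mult_nonneg_nonneg) (auto simp: less_imp_le)
    also have "\<dots> = (\<Sum>x\<in>I\<times>I. p (fst x) * p (snd x) * w (fst x) (snd x) R * M)"
      by (simp add: sum.cartesian_product split_def)
    also have "\<dots> \<le> (\<Sum>x\<in>I\<times>I. p (fst x) * p (snd x) * M - (if x = (i,j) then \<rho> * \<rho> * \<theta> * M else 0))"
    proof (rule sum_mono)
      fix x assume x: "x \<in> I \<times> I"
      show "p (fst x) * p (snd x) * w (fst x) (snd x) R * M
          \<le> p (fst x) * p (snd x) * M - (if x = (i,j) then \<rho> * \<rho> * \<theta> * M else 0)"
      proof (cases "x = (i,j)")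
        case True
        have "\<rho> * \<rho> * \<theta> * M \<le> p i * p j * \<theta> * M"
          using \<rho> ij \<theta> M0 I(2)[OF ij(1)] by (intro mult_right_mono mult_mono) auto
        moreover have "p i * p j * w i j R * M \<le> p i * p j * (1 - \<theta>) * M"
          using ij I(2) M0 by (intro mult_right_mono mult_left_mono) (auto simp: less_imp_le)
        ultimately show ?thesis using True by (simp add: algebra_simps)
      next
        case False
        have "p (fst x) * p (snd x) * w (fst x) (snd x) R * M \<le> p (fst x) * p (snd x) * 1 * M"
          using x I(2) M0 w by (intro mult_right_mono mult_left_mono) (auto simp: less_imp_le)
        then show ?thesis using False by simp
      qed
    qed
    also have "\<dots> = (\<Sum>x\<in>I\<times>I. p (fst x) * p (snd x)) * M - \<rho> * \<rho> * \<theta> * M"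
      using I(1) ij by (simp add: sum_subtractf sum_distrib_right)
    also have "(\<Sum>x\<in>I\<times>I. p (fst x) * p (snd x)) = sum p I * sum p I"
      by (simp add: sum_product sum.cartesian_product split_def)
    finally show ?thesis using I(3) by simp
  qed
  have gap: "B R \<le> M - \<kappa> * (\<rho> * \<rho> * \<theta> * M)" for R
  proof -
    obtain l i j where lij: "i \<in> I" "j \<in> I" "w i j (R + b + r i0 * l) \<le> 1 - \<theta>"
      using escape[of "R + b"] by blast
    have "r i0 * l \<in> S"
      by (induction l) (use S0 Sadd Sr i0 in auto)
    then have "r i0 * l \<in> G" unfolding G_def using S0 by force
    moreover have "B (R + r i0 * l + b) \<le> M - \<rho> * \<rho> * \<theta> * M"
      using drop[OF lij] by (simp add: ac_simps)
    ultimately show ?thesis using \<rho>(1) \<theta> M0 by (intro reach) auto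
  qed
  have "M \<le> M - \<kappa> * (\<rho> * \<rho> * \<theta> * M)"
    unfolding M_def by (rule cSUP_least) (use gap in \<open>auto simp: M_def\<close>)
  then have "M \<le> 0" using \<kappa>(1) \<rho>(1) \<theta>
    by (simp add: mult_le_0_iff)
  with B(1)[of R] M[of R] show ?thesis by simp
qed

section \<open>A strong law for bounded orthogonal variables\<close>

text \<open>Between \<open>n\<^sup>2\<close> and \<open>(n + 1)\<^sup>2\<close> there are at most \<open>2 n\<close> further terms, which is negligible against
\<open>n\<^sup>2\<close>.\<close>

lemma averages_along_squares:
  fixes X :: "nat \<Rightarrow> real"
  assumes bd: "\<And>j. \<bar>X j\<bar> \<le> C"
    and sq: "(\<lambda>n. (\<Sum>j<n\<^sup>2. X j) / real (n\<^sup>2)) \<longlonglongrightarrow> 0"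
  shows "(\<lambda>N. (\<Sum>j<N. X j) / real N) \<longlonglongrightarrow> 0"
proof -
  have C0: "0 \<le> C" using bd[of 0] by linarith
  define s where "s N = nat \<lfloor>sqrt (real N)\<rfloor>" for N
  have sN: "real (s N) \<le> sqrt (real N)" "sqrt (real N) < real (s N) + 1" for N
    unfolding s_def by (auto simp: of_nat_nat)
  have s1: "(s N)\<^sup>2 \<le> N" for N
  proof -
    have "(real (s N))\<^sup>2 \<le> real N" using sN(1)[of N] real_le_rsqrt
      by (metis of_nat_0_le_iff power_mono real_sqrt_pow2)
    then show ?thesis by (metis of_nat_le_iff of_nat_power)
  qed
  have s2: "N \<le> (s N)\<^sup>2 + 2 * s N" for N
  proof -
    have "real N < (real (s N) + 1)\<^sup>2" using sN(2)[of N]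
      by (metis of_nat_0_le_iff power_strict_mono real_sqrt_ge_zero real_sqrt_pow2 zero_less_numeral)
    also have "\<dots> = real ((s N)\<^sup>2 + 2 * s N + 1)" by (simp add: power2_eq_square algebra_simps)
    finally show ?thesis by linarith
  qed
  have s_top: "filterlim s at_top at_top"
  proof -
    have "filterlim (\<lambda>N. sqrt (real N)) at_top at_top"
      by (rule filterlim_compose[OF sqrt_at_top filterlim_real_sequentially])
    then show ?thesis unfolding s_def
      by (rule filterlim_compose[OF filterlim_compose[OF filterlim_nat_sequentially filterlim_floor_sequentially]])
  qed
  define b where "b n = \<bar>(\<Sum>j<n\<^sup>2. X j) / real (n\<^sup>2)\<bar> + 2 * C / real n" for n
  have "(\<lambda>n. 2 * C / real n) \<longlonglongrightarrow> 0"
    by (rule tendsto_divide_0[OF tendsto_const]) (rule filterlim_at_top_imp_at_infinity[OF filterlim_real_sequentially])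
  then have "b \<longlonglongrightarrow> 0" unfolding b_def
    using tendsto_add[OF tendsto_rabs_zero[OF sq]] by simp
  then have lim: "(\<lambda>N. b (s N)) \<longlonglongrightarrow> 0" by (rule filterlim_compose[OF _ s_top])
  show ?thesis
  proof (rule Lim_null_comparison[OF _ lim])
    show "\<forall>\<^sub>F N in sequentially. norm ((\<Sum>j<N. X j) / real N) \<le> b (s N)"
      using filterlim_at_top[THEN iffD1, OF s_top, rule_format, of 1]
    proof eventually_elim
      case (elim N)
      let ?n = "s N"
      have n0: "real (?n\<^sup>2) > 0" using elim by simp
      have nN: "real (?n\<^sup>2) \<le> real N" using s1[of N] of_nat_le_iff by blast
      have "{..<N} = {..<?n\<^sup>2} \<union> {?n\<^sup>2..<N}" using s1[of N] by auto
      then have "(\<Sum>j<N. X j) = (\<Sum>j<?n\<^sup>2. X j) + (\<Sum>j\<in>{?n\<^sup>2..<N}. X j)"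
        by (simp add: sum.union_disjoint ivl_disj_int)
      moreover have "\<bar>\<Sum>j\<in>{?n\<^sup>2..<N}. X j\<bar> \<le> 2 * real ?n * C"
      proof -
        have "\<bar>\<Sum>j\<in>{?n\<^sup>2..<N}. X j\<bar> \<le> (\<Sum>j\<in>{?n\<^sup>2..<N}. C)"
          by (rule order_trans[OF sum_abs]) (intro sum_mono bd)
        also have "\<dots> = real (N - ?n\<^sup>2) * C" by simp
        also have "\<dots> \<le> real (2 * ?n) * C"
        proof (rule mult_right_mono[OF _ C0])
          have "N - ?n\<^sup>2 \<le> 2 * ?n" using s2[of N] by linarith
          then show "real (N - ?n\<^sup>2) \<le> real (2 * ?n)" by (simp only: of_nat_le_iff)
        qed
        finally show ?thesis by simp
      qed
      ultimately have "\<bar>\<Sum>j<N. X j\<bar> \<le> \<bar>\<Sum>j<?n\<^sup>2. X j\<bar> + 2 * real ?n * C" by linarith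
      then have "\<bar>\<Sum>j<N. X j\<bar> / real N \<le> (\<bar>\<Sum>j<?n\<^sup>2. X j\<bar> + 2 * real ?n * C) / real (?n\<^sup>2)"
        using n0 nN C0 by (intro frac_le) auto
      also have "\<dots> = b ?n" unfolding b_def using n0 
        by (simp add: add_divide_distrib power2_eq_square)
      finally show ?case by simp
    qed
  qed
qed

lemma (in prob_space) AE_tendsto_0_if_summable:
  fixes Y :: "nat \<Rightarrow> 'a \<Rightarrow> real"
  assumes Y: "\<And>n. integrable M (Y n)" "\<And>n \<omega>. 0 \<le> Y n \<omega>" "\<And>n. expectation (Y n) \<le> c n" and c: "summable c"
  shows "AE \<omega> in M. (\<lambda>n. Y n \<omega>) \<longlonglongrightarrow> 0"
proof -
  have [measurable]: "Y n \<in> borel_measurable M" for n using Y(1) by auto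
  have cn: "0 \<le> c n" for n using Y(3)[of n] Bochner_Integration.integral_nonneg[of M "Y n", OF Y(2)] by linarith
  have "(\<integral>\<^sup>+\<omega>. (\<Sum>n. ennreal (Y n \<omega>)) \<partial>M) = (\<Sum>n. \<integral>\<^sup>+\<omega>. ennreal (Y n \<omega>) \<partial>M)"
    by (rule nn_integral_suminf) simp
  also have "\<dots> \<le> (\<Sum>n. ennreal (c n))"
    using Y by (intro suminf_le) (auto simp: nn_integral_eq_integral intro: ennreal_leI)
  also have "\<dots> = ennreal (\<Sum>n. c n)" using cn c by (rule suminf_ennreal2)
  finally have "(\<integral>\<^sup>+\<omega>. (\<Sum>n. ennreal (Y n \<omega>)) \<partial>M) < \<infinity>"
    by (simp add: le_less_trans)
  then have "AE \<omega> in M. (\<Sum>n. ennreal (Y n \<omega>)) \<noteq> \<infinity>"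
    by (intro nn_integral_PInf_AE) auto
  then show ?thesis
  proof eventually_elim
    case (elim \<omega>)
    then have "summable (\<lambda>n. Y n \<omega>)"
      using Y(2) by (intro summable_suminf_not_top) auto
    then show ?case by (rule summable_LIMSEQ_zero)
  qed
qed

text \<open>The second moment of the average of \<open>N\<close> terms is at most \<open>C\<^sup>2 / N\<close>, which is summable along the
squares. Boundedness fills the gaps between them.\<close>

lemma (in prob_space) strong_law_orthogonal:
  fixes X :: "nat \<Rightarrow> 'a \<Rightarrow> real"
  assumes meas [measurable]: "\<And>j. X j \<in> borel_measurable M"
    and bd: "\<And>j \<omega>. \<omega> \<in> space M \<Longrightarrow> \<bar>X j \<omega>\<bar> \<le> C"
    and orth: "\<And>i j. i < j \<Longrightarrow> expectation (\<lambda>\<omega>. X i \<omega> * X j \<omega>) = 0"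
  shows "AE \<omega> in M. (\<lambda>N. (\<Sum>j<N. X j \<omega>) / real N) \<longlonglongrightarrow> 0"
proof -
  have orth': "expectation (\<lambda>\<omega>. X i \<omega> * X j \<omega>) = 0" if "i \<noteq> j" for i j
    using that orth[of i j] orth[of j i] by (cases i j rule: linorder_cases) (simp_all add: mult.commute)
  have int: "integrable M (\<lambda>\<omega>. X i \<omega> * X j \<omega>)" for i j
  proof (rule integrable_const_bound[of _ "C * C"])
    show "AE \<omega> in M. norm (X i \<omega> * X j \<omega>) \<le> C * C"
      using bd by (intro AE_I2) (auto simp: abs_mult intro!: mult_mono order_trans[OF abs_ge_zero])
  qed simp
  have sq: "(\<Sum>j<N. X j \<omega>)\<^sup>2 = (\<Sum>i<N. \<Sum>j<N. X i \<omega> * X j \<omega>)" for N \<omega>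
    by (simp add: power2_eq_square sum_product)
  have int2: "integrable M (\<lambda>\<omega>. (\<Sum>j<N. X j \<omega>)\<^sup>2)" for N
    unfolding sq by (intro Bochner_Integration.integrable_sum int)
  have var: "expectation (\<lambda>\<omega>. (\<Sum>j<N. X j \<omega>)\<^sup>2) \<le> real N * C\<^sup>2" for N
  proof -
    have "expectation (\<lambda>\<omega>. (\<Sum>j<N. X j \<omega>)\<^sup>2) = (\<Sum>i<N. \<Sum>j<N. expectation (\<lambda>\<omega>. X i \<omega> * X j \<omega>))"
      unfolding sq by (simp add: int)
    also have "\<dots> = (\<Sum>i<N. \<Sum>j<N. if j = i then expectation (\<lambda>\<omega>. X i \<omega> * X i \<omega>) else 0)"
      using orth' by (intro sum.cong) auto
    also have "\<dots> = (\<Sum>i<N. expectation (\<lambda>\<omega>. X i \<omega> * X i \<omega>))" by (simp add: sum.delta')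
    also have "\<dots> \<le> (\<Sum>i<N. C\<^sup>2)"
    proof (rule sum_mono)
      fix i
      have "expectation (\<lambda>\<omega>. X i \<omega> * X i \<omega>) \<le> expectation (\<lambda>\<omega>. C\<^sup>2)"
      proof (rule integral_mono[OF int])
        fix \<omega> assume "\<omega> \<in> space M"
        from bd[OF this, of i] have "\<bar>X i \<omega>\<bar>\<^sup>2 \<le> C\<^sup>2" by (intro power_mono) auto
        then show "X i \<omega> * X i \<omega> \<le> C\<^sup>2" by (simp add: power2_eq_square)
      qed simp
      then show "expectation (\<lambda>\<omega>. X i \<omega> * X i \<omega>) \<le> C\<^sup>2" by (simp add: prob_space)
    qed
    finally show ?thesis by simp
  qed
  have "AE \<omega> in M. (\<lambda>n. ((\<Sum>j<n\<^sup>2. X j \<omega>) / real (n\<^sup>2))\<^sup>2) \<longlonglongrightarrow> 0"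
  proof (rule AE_tendsto_0_if_summable)
    show "integrable M (\<lambda>\<omega>. ((\<Sum>j<n\<^sup>2. X j \<omega>) / real (n\<^sup>2))\<^sup>2)" for n
      unfolding power_divide by (intro integrable_divide int2)
    show "expectation (\<lambda>\<omega>. ((\<Sum>j<n\<^sup>2. X j \<omega>) / real (n\<^sup>2))\<^sup>2) \<le> C\<^sup>2 * (1 / real n ^ 2)" for n
    proof -
      have "expectation (\<lambda>\<omega>. ((\<Sum>j<n\<^sup>2. X j \<omega>) / real (n\<^sup>2))\<^sup>2)
          = expectation (\<lambda>\<omega>. (\<Sum>j<n\<^sup>2. X j \<omega>)\<^sup>2) / (real (n\<^sup>2))\<^sup>2"
        unfolding power_divide by simp
      also have "\<dots> \<le> (real (n\<^sup>2) * C\<^sup>2) / (real (n\<^sup>2))\<^sup>2"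
        by (intro divide_right_mono var) simp
      also have "\<dots> = C\<^sup>2 * (1 / real n ^ 2)" by (cases "n = 0") (simp_all add: power2_eq_square)
      finally show ?thesis .
    qed
    show "summable (\<lambda>n. C\<^sup>2 * (1 / real n ^ 2))"
      by (intro summable_mult inverse_power_summable[of 2, unfolded inverse_eq_divide]) simp
  qed simp
  then show ?thesis
    using AE_space
  proof eventually_elim
    case (elim \<omega>)
    have "(\<lambda>n. (\<Sum>j<n\<^sup>2. X j \<omega>) / real (n\<^sup>2)) \<longlonglongrightarrow> 0"
      by (rule tendsto_rabs_zero_cancel) (use tendsto_real_sqrt[OF elim(1)] in \<open>simp only: real_sqrt_abs real_sqrt_zero\<close>)
    then show ?case by (rule averages_along_squares[rotated]) (use bd elim in auto)
  qed
qed

section \<open>Sequences with vanishing averages\<close>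

definition cesaro_null :: "(nat \<Rightarrow> complex) \<Rightarrow> bool" where
  "cesaro_null a \<longleftrightarrow> (\<lambda>N. (\<Sum>j<N. a j) / of_nat N) \<longlonglongrightarrow> 0"

lemma cesaro_null_add: "cesaro_null a \<Longrightarrow> cesaro_null b \<Longrightarrow> cesaro_null (\<lambda>j. a j + b j)"
  unfolding cesaro_null_def
  by (drule (1) tendsto_add) (simp add: sum.distrib add_divide_distrib)

lemma cesaro_null_cmult: "cesaro_null a \<Longrightarrow> cesaro_null (\<lambda>j. c * a j)"
  unfolding cesaro_null_def
  by (drule tendsto_mult_right_zero[of _ _ c]) (simp flip: sum_distrib_left)

lemma cesaro_null_sum:
  assumes "\<And>x. x \<in> X \<Longrightarrow> cesaro_null (a x)"
  shows "cesaro_null (\<lambda>j. \<Sum>x\<in>X. a x j)"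
  using assms
proof (induction X rule: infinite_finite_induct)
  case (insert x X)
  then show ?case by (simp add: cesaro_null_add)
qed (simp_all add: cesaro_null_def)

lemma cesaro_null_shift:
  assumes bd: "\<And>j. norm (a j) \<le> C"
  shows "cesaro_null (\<lambda>j. a (Suc j) - a j)"
proof -
  have "(\<lambda>N. (2 * C) / real N) \<longlonglongrightarrow> 0"
    by (rule tendsto_divide_0[OF tendsto_const])
       (rule filterlim_at_top_imp_at_infinity[OF filterlim_real_sequentially])
  then show ?thesis unfolding cesaro_null_def
  proof (rule Lim_null_comparison[OF always_eventually, rotated], intro allI)
    fix N
    have "(\<Sum>j<N. a (Suc j) - a j) = a N - a 0" by (rule sum_lessThan_telescope)
    moreover have "norm (a N - a 0) \<le> 2 * C"
      using norm_triangle_ineq4[of "a N" "a 0"] bd[of N] bd[of 0] by linarith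
    ultimately show "norm ((\<Sum>j<N. a (Suc j) - a j) / of_nat N) \<le> 2 * C / real N"
      by (simp add: norm_divide divide_right_mono)
  qed
qed

lemma cesaro_null_approx:
  assumes "\<And>\<delta>. \<delta> > 0 \<Longrightarrow> \<exists>b. cesaro_null b \<and> (\<forall>j. norm (a j - b j) \<le> \<delta>)"
  shows "cesaro_null a"
  unfolding cesaro_null_def
proof (rule LIMSEQ_I)
  fix \<epsilon> :: real assume \<epsilon>: "\<epsilon> > 0"
  then obtain b where b: "cesaro_null b" "\<And>j. norm (a j - b j) \<le> \<epsilon> / 2"
    using assms[of "\<epsilon> / 2"] by auto
  obtain N0 where N0: "\<And>N. N \<ge> N0 \<Longrightarrow> norm ((\<Sum>j<N. b j) / of_nat N) < \<epsilon> / 2"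
    using LIMSEQ_D[OF b(1)[unfolded cesaro_null_def], of "\<epsilon> / 2"] \<epsilon> by auto
  show "\<exists>N0. \<forall>N\<ge>N0. norm ((\<Sum>j<N. a j) / of_nat N - 0) < \<epsilon>"
  proof (intro exI allI impI)
    fix N assume N: "N \<ge> N0"
    have "norm ((\<Sum>j<N. a j - b j) / of_nat N) \<le> \<epsilon> / 2"
    proof (cases "N = 0")
      case False
      have "norm (\<Sum>j<N. a j - b j) \<le> real N * (\<epsilon> / 2)"
        using sum_norm_le[of "{..<N}" "\<lambda>j. a j - b j" "\<lambda>_. \<epsilon> / 2"] b(2) by simp
      then show ?thesis using False by (simp add: norm_divide field_simps)
    qed (use \<epsilon> in simp)
    moreover have "(\<Sum>j<N. a j) / of_nat N = (\<Sum>j<N. a j - b j) / of_nat N + (\<Sum>j<N. b j) / of_nat N"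
      by (simp add: sum_subtractf diff_divide_distrib)
    ultimately show "norm ((\<Sum>j<N. a j) / of_nat N - 0) < \<epsilon>"
      using N0[OF N] norm_triangle_ineq[of "(\<Sum>j<N. a j - b j) / of_nat N" "(\<Sum>j<N. b j) / of_nat N"]
      by simp
  qed
qed

text \<open>Averages over boundedly long blocks, counted per block, control the averages per term: each block has
at least one term, so \<open>N\<close> terms contain at most \<open>N\<close> blocks, and the last incomplete block has at most
\<open>q\<close> terms.\<close>

lemma cesaro_null_from_blocks:
  fixes x :: "nat \<Rightarrow> complex" and \<tau> :: "nat \<Rightarrow> nat"
  assumes bd: "\<And>n. norm (x n) \<le> 1"
    and \<tau>: "\<tau> 0 = 0" "\<And>j. \<tau> j < \<tau> (Suc j)" "\<And>j. \<tau> (Suc j) \<le> \<tau> j + q"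
    and blocks: "(\<lambda>J. (\<Sum>n<\<tau> J. x n) / of_nat J) \<longlonglongrightarrow> 0"
  shows "cesaro_null x"
proof -
  have mono: "strict_mono \<tau>" using \<tau>(2) by (simp add: strict_mono_Suc_iff)
  have ge: "J \<le> \<tau> J" for J using mono by (rule strict_mono_imp_increasing)
  define g where "g N = (GREATEST J. \<tau> J \<le> N)" for N
  have g: "\<tau> (g N) \<le> N" "\<And>J. \<tau> J \<le> N \<Longrightarrow> J \<le> g N" for N
  proof -
    have b: "\<And>J. \<tau> J \<le> N \<Longrightarrow> J \<le> N" using ge order_trans by blast
    show "\<tau> (g N) \<le> N" unfolding g_def
      by (rule GreatestI_nat[where k = 0 and b = N]) (use b \<tau>(1) in auto)
    show "J \<le> g N" if "\<tau> J \<le> N" for J unfolding g_def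
      by (rule Greatest_le_nat[where b = N]) (use b that in auto)
  qed
  have gN: "g N \<le> N" for N using ge[of "g N"] g(1)[of N] by linarith
  have gq: "N \<le> \<tau> (g N) + q" for N
    using g(2)[of "Suc (g N)" N] \<tau>(3)[of "g N"] by linarith
  have top: "filterlim g at_top at_top"
    unfolding filterlim_at_top eventually_at_top_linorder using g(2) order_trans by blast
  have "(\<lambda>N. norm ((\<Sum>n<\<tau> (g N). x n) / of_nat (g N)) + real q / real N) \<longlonglongrightarrow> 0 + 0"
  proof (rule tendsto_add)
    show "(\<lambda>N. norm ((\<Sum>n<\<tau> (g N). x n) / of_nat (g N))) \<longlonglongrightarrow> 0"
      using filterlim_compose[OF tendsto_norm_zero[OF blocks] top] .
    show "(\<lambda>N. real q / real N) \<longlonglongrightarrow> 0"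
      by (rule tendsto_divide_0[OF tendsto_const])
         (rule filterlim_at_top_imp_at_infinity[OF filterlim_real_sequentially])
  qed
  then have "(\<lambda>N. norm ((\<Sum>n<\<tau> (g N). x n) / of_nat (g N)) + real q / real N) \<longlonglongrightarrow> 0" by simp
  then show ?thesis unfolding cesaro_null_def
  proof (rule Lim_null_comparison[rotated])
    show "\<forall>\<^sub>F N in sequentially. norm ((\<Sum>j<N. x j) / of_nat N)
        \<le> norm ((\<Sum>n<\<tau> (g N). x n) / of_nat (g N)) + real q / real N"
      using filterlim_at_top[THEN iffD1, OF top, rule_format, of 1]
    proof eventually_elim
      case (elim N)
      have "{..<N} = {..<\<tau> (g N)} \<union> {\<tau> (g N)..<N}" using g(1)[of N] by auto
      then have "(\<Sum>j<N. x j) = (\<Sum>j<\<tau> (g N). x j) + (\<Sum>j\<in>{\<tau> (g N)..<N}. x j)"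
        by (simp add: sum.union_disjoint ivl_disj_int)
      moreover have "norm (\<Sum>j\<in>{\<tau> (g N)..<N}. x j) \<le> real q"
      proof -
        have "norm (\<Sum>j\<in>{\<tau> (g N)..<N}. x j) \<le> (\<Sum>j\<in>{\<tau> (g N)..<N}. 1)"
          by (rule sum_norm_le) (rule bd)
        also have "\<dots> \<le> real q" using gq[of N] by simp
        finally show ?thesis .
      qed
      ultimately have "norm (\<Sum>j<N. x j) \<le> norm (\<Sum>n<\<tau> (g N). x n) + real q"
        using norm_triangle_ineq[of "\<Sum>j<\<tau> (g N). x j" "\<Sum>j\<in>{\<tau> (g N)..<N}. x j"] by simp
      then have "norm (\<Sum>j<N. x j) / real N \<le> norm (\<Sum>n<\<tau> (g N). x n) / real N + real q / real N"
        by (simp add: divide_right_mono flip: add_divide_distrib)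
      also have "norm (\<Sum>n<\<tau> (g N). x n) / real N \<le> norm (\<Sum>n<\<tau> (g N). x n) / real (g N)"
        using elim gN[of N] by (intro divide_left_mono) auto
      finally show ?case by (simp add: norm_divide)
    qed
  qed
qed

text \<open>The limit superior of the norms as a real number; it is meaningful for bounded sequences.\<close>

definition limsup_norm :: "(nat \<Rightarrow> complex) \<Rightarrow> real" where
  "limsup_norm f = Inf {b. 0 \<le> b \<and> (\<forall>\<^sub>F N in sequentially. norm (f N) \<le> b)}"

lemma limsup_norm_le:
  assumes "0 \<le> b" "\<forall>\<^sub>F N in sequentially. norm (f N) \<le> b"
  shows "limsup_norm f \<le> b"
  unfolding limsup_norm_def using assms by (intro cInf_lower) (auto intro: bdd_belowI[of _ 0])

lemma
  assumes bd: "\<And>N. norm (f N) \<le> C"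
  shows limsup_norm_nonneg: "0 \<le> limsup_norm f"
    and eventually_le_limsup_norm: "\<delta> > 0 \<Longrightarrow> \<forall>\<^sub>F N in sequentially. norm (f N) \<le> limsup_norm f + \<delta>"
proof -
  let ?S = "{b. 0 \<le> b \<and> (\<forall>\<^sub>F N in sequentially. norm (f N) \<le> b)}"
  have "0 \<le> C" using order_trans[OF norm_ge_zero bd[of 0]] .
  then have "C \<in> ?S" using bd by simp
  then have ne: "?S \<noteq> {}" by blast
  show "0 \<le> limsup_norm f" unfolding limsup_norm_def using ne by (intro cInf_greatest) auto
  assume "\<delta> > 0"
  then have "Inf ?S < limsup_norm f + \<delta>" by (simp add: limsup_norm_def)
  then obtain b where "b \<in> ?S" "b < limsup_norm f + \<delta>"
    using cInf_lessD[OF ne] by blast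
  then show "\<forall>\<^sub>F N in sequentially. norm (f N) \<le> limsup_norm f + \<delta>"
    by (auto elim!: eventually_mono)
qed

lemma tendsto_0_if_limsup_norm_0:
  assumes "\<And>N. norm (f N) \<le> C" "limsup_norm f = 0"
  shows "f \<longlonglongrightarrow> 0"
proof (rule tendstoI)
  fix e :: real assume "e > 0"
  then show "\<forall>\<^sub>F N in sequentially. dist (f N) 0 < e"
    using eventually_le_limsup_norm[of f C "e / 2"] assms
    by (auto elim!: eventually_mono)
qed

lemma limsup_norm_le_sum:
  assumes X: "finite X" and bd: "\<And>x N. x \<in> X \<Longrightarrow> norm (g x N) \<le> C"
    and lim: "(\<lambda>N. f N - (\<Sum>x\<in>X. c x * g x N)) \<longlonglongrightarrow> 0"
  shows "limsup_norm f \<le> (\<Sum>x\<in>X. norm (c x) * limsup_norm (g x))"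
proof (rule field_le_epsilon)
  fix e :: real assume e: "e > 0"
  define W where "W = 1 + (\<Sum>x\<in>X. norm (c x))"
  have W: "W > 0" unfolding W_def by (simp add: add_pos_nonneg sum_nonneg)
  define \<delta> where "\<delta> = e / W"
  have \<delta>: "\<delta> > 0" using e W by (simp add: \<delta>_def)
  have "\<forall>\<^sub>F N in sequentially. \<forall>x\<in>X. norm (g x N) \<le> limsup_norm (g x) + \<delta>"
    using X eventually_le_limsup_norm[OF bd \<delta>] by (simp add: eventually_ball_finite_distrib)
  moreover have "\<forall>\<^sub>F N in sequentially. norm (f N - (\<Sum>x\<in>X. c x * g x N)) < \<delta>"
    using tendstoD[OF lim \<delta>] by simp
  ultimately have "\<forall>\<^sub>F N in sequentially. norm (f N) \<le> (\<Sum>x\<in>X. norm (c x) * limsup_norm (g x)) + e"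
  proof eventually_elim
    case (elim N)
    have "norm (\<Sum>x\<in>X. c x * g x N) \<le> (\<Sum>x\<in>X. norm (c x) * (limsup_norm (g x) + \<delta>))"
      using elim(1) by (intro sum_norm_le) (auto simp: norm_mult intro!: mult_left_mono)
    also have "\<dots> = (\<Sum>x\<in>X. norm (c x) * limsup_norm (g x)) + (W - 1) * \<delta>"
      by (simp add: W_def distrib_left sum.distrib sum_distrib_right)
    finally have "norm (f N) \<le> (\<Sum>x\<in>X. norm (c x) * limsup_norm (g x)) + (W - 1) * \<delta> + \<delta>"
      using elim(2) norm_triangle_sub[of "f N" "\<Sum>x\<in>X. c x * g x N"] by linarith
    also have "\<dots> = (\<Sum>x\<in>X. norm (c x) * limsup_norm (g x)) + e"
      using W by (simp add: \<delta>_def field_simps)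
    finally show ?case .
  qed
  then show "limsup_norm f \<le> (\<Sum>x\<in>X. norm (c x) * limsup_norm (g x)) + e"
    using e limsup_norm_nonneg[OF bd] by (intro limsup_norm_le add_nonneg_nonneg sum_nonneg) auto
qed

section \<open>Bernoulli sequences\<close>

locale bernoulli_shift =
  fixes P :: "'i measure" and I :: "'i set"
  assumes prob_P: "prob_space P" and sets_P: "sets P = Pow I" and fin: "finite I"
begin

abbreviation \<Omega> :: "(nat \<Rightarrow> 'i) measure" where "\<Omega> \<equiv> PiM UNIV (\<lambda>_. P)"

definition p :: "'i \<Rightarrow> real" where "p i = measure P {i}"

sublocale prob_space \<Omega>
  by (intro prob_space_PiM prob_P)

lemma space_P: "space P = I"
  using sets_P by (metis Pow_top Pow_mono Sup_upper Union_Pow_eq sets.space_closed sets.top subset_antisym)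

lemma space_\<Omega>: "\<omega> \<in> space \<Omega> \<longleftrightarrow> (\<forall>j. \<omega> j \<in> I)"
  by (auto simp: space_PiM space_P)

lemma coordinate_measurable [measurable]: "(\<lambda>\<omega>. \<omega> j) \<in> measurable \<Omega> (count_space I)"
proof -
  have "measurable \<Omega> P = measurable \<Omega> (count_space I)"
    by (rule measurable_cong_sets) (simp_all add: sets_P)
  moreover have "(\<lambda>\<omega>. \<omega> j) \<in> measurable \<Omega> P" by simp
  ultimately show ?thesis by blast
qed

lemma prob_cylinder:
  assumes "finite J" "\<And>j. j \<in> J \<Longrightarrow> v j \<in> I"
  shows "prob {\<omega> \<in> space \<Omega>. \<forall>j\<in>J. \<omega> j = v j} = (\<Prod>j\<in>J. p (v j))"
proof -
  have events: "{v j} \<in> sets P" if "j \<in> J" for j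
    unfolding sets_P using assms(2)[OF that] by simp
  interpret product_prob_space "\<lambda>_::nat. P" UNIV
    by (intro product_prob_spaceI prob_P)
  have "emeasure \<Omega> {\<omega> \<in> space \<Omega>. \<forall>j\<in>J. \<omega> j \<in> {v j}} = (\<Prod>j\<in>J. emeasure P {v j})"
    by (rule emeasure_PiM_Collect) (use assms(1) events in simp_all)
  also have "\<dots> = (\<Prod>j\<in>J. ennreal (p (v j)))"
    unfolding p_def using prob_space.finite_measure[OF prob_P] by (simp add: finite_measure.emeasure_eq_measure)
  also have "\<dots> = ennreal (\<Prod>j\<in>J. p (v j))" by (rule prod_ennreal) (simp add: p_def)
  finally show ?thesis
    by (simp add: measure_def[of \<Omega>] prod_nonneg p_def)
qed

lemma sum_p: "sum p I = 1"
proof -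
  interpret P: prob_space P by (rule prob_P)
  have "measure P (\<Union>i\<in>I. {i}) = (\<Sum>i\<in>I. measure P {i})"
    by (rule P.finite_measure_finite_Union) (use fin sets_P in \<open>auto simp: disjoint_family_on_def\<close>)
  then show ?thesis using P.prob_space by (simp add: p_def space_P)
qed

text \<open>A function of the first \<open>n\<close> letters is a finite combination of indicators of cylinders, and the next
letter is independent of each of these.\<close>

lemma fresh_letter_uncorrelated:
  fixes H :: "(nat \<Rightarrow> 'i) \<Rightarrow> real"
  assumes dep: "\<And>\<omega> \<omega>'. \<omega> \<in> space \<Omega> \<Longrightarrow> \<omega>' \<in> space \<Omega> \<Longrightarrow> (\<And>j. j < n \<Longrightarrow> \<omega> j = \<omega>' j) \<Longrightarrow> H \<omega> = H \<omega>'"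
    and a: "a \<in> I"
  shows "expectation (\<lambda>\<omega>. (of_bool (\<omega> n = a) - p a) * H \<omega>) = 0"
proof -
  define V where "V = PiE {..<n} (\<lambda>_. I)"
  have finV: "finite V" unfolding V_def using fin by (intro finite_PiE) auto
  \<comment> \<open>Extending the prefix by the letter \<open>a\<close> makes the cylinder of length \<open>n + 1\<close> the event that the prefix
  is followed by \<open>a\<close>.\<close>
  define E where "E v = (\<lambda>j. if j < n then v j else a)" for v :: "nat \<Rightarrow> 'i"
  define C where "C v = {\<omega> \<in> space \<Omega>. \<forall>j\<in>{..<n}. \<omega> j = E v j}" for v
  define C' where "C' v = {\<omega> \<in> space \<Omega>. \<forall>j\<in>{..<Suc n}. \<omega> j = E v j}" for v
  have E: "E v j \<in> I" if "v \<in> V" for v j using that a by (auto simp: E_def V_def PiE_def)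
  have C_sets: "C v \<in> sets \<Omega>" "C' v \<in> sets \<Omega>" if "v \<in> V" for v
  proof -
    have "{\<omega> \<in> space \<Omega>. \<forall>j\<in>J. \<omega> j = E v j} \<in> sets \<Omega>" if "finite J" for J
      using that by measurable
    from this[of "{..<n}"] this[of "{..<Suc n}"] show "C v \<in> sets \<Omega>" "C' v \<in> sets \<Omega>"
      by (auto simp: C_def C'_def)
  qed
  have split: "(of_bool (\<omega> n = a) - p a) * H \<omega>
      = (\<Sum>v\<in>V. H (E v) * (indicator (C' v) \<omega> - p a * indicator (C v) \<omega>))" if \<omega>: "\<omega> \<in> space \<Omega>" for \<omega>
  proof -
    define v where "v = restrict \<omega> {..<n}"
    have vV: "v \<in> V" using \<omega> by (auto simp: v_def V_def space_\<Omega>)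
    have inC: "\<omega> \<in> C v' \<longleftrightarrow> v' = v" if "v' \<in> V" for v'
    proof
      assume "\<omega> \<in> C v'"
      then have "\<And>j. j < n \<Longrightarrow> v' j = \<omega> j" by (simp add: C_def E_def)
      then show "v' = v" using that by (intro ext) (auto simp: v_def V_def PiE_def extensional_def)
    qed (use \<omega> in \<open>simp add: C_def v_def E_def\<close>)
    have inC': "\<omega> \<in> C' v' \<longleftrightarrow> v' = v \<and> \<omega> n = a" if "v' \<in> V" for v'
      using inC[OF that] \<omega> by (auto simp: C_def C'_def E_def less_Suc_eq)
    have "H \<omega> = H (E v)"
      by (rule dep) (use \<omega> E[OF vV] in \<open>auto simp: space_\<Omega> E_def v_def\<close>)
    moreover have "(\<Sum>v'\<in>V. H (E v') * (indicator (C' v') \<omega> - p a * indicator (C v') \<omega>))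
        = (\<Sum>v'\<in>V. if v' = v then H (E v) * (of_bool (\<omega> n = a) - p a) else 0)"
      by (rule sum.cong) (auto simp: indicator_def inC inC')
    ultimately show ?thesis using finV vV by simp
  qed
  have "expectation (\<lambda>\<omega>. (of_bool (\<omega> n = a) - p a) * H \<omega>)
      = expectation (\<lambda>\<omega>. \<Sum>v\<in>V. H (E v) * (indicator (C' v) \<omega> - p a * indicator (C v) \<omega>))"
    by (rule Bochner_Integration.integral_cong[OF refl split])
  also have "\<dots> = (\<Sum>v\<in>V. H (E v) * (prob (C' v) - p a * prob (C v)))"
    using C_sets by (simp add: Bochner_Integration.integral_sum integrable_real_indicator emeasure_eq_measure)
  also have "\<dots> = 0"
  proof (rule sum.neutral, rule ballI)
    fix v assume v: "v \<in> V"
    have "prob (C' v) = prob (C v) * p (E v n)"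
      using prob_cylinder[of "{..<n}" "E v"] prob_cylinder[of "{..<Suc n}" "E v"] E[OF v]
      by (simp add: C_def C'_def)
    then show "H (E v) * (prob (C' v) - p a * prob (C v)) = 0" by (simp add: E_def)
  qed
  finally show ?thesis .
qed

text \<open>Of two terms, the later one contains a centred letter that is independent of all other factors, so the
terms are orthogonal.\<close>

lemma AE_fresh_letter_averages_real:
  fixes G :: "nat \<Rightarrow> (nat \<Rightarrow> 'i) \<Rightarrow> real"
  assumes meas [measurable]: "\<And>j. G j \<in> borel_measurable \<Omega>"
    and bd: "\<And>j \<omega>. \<bar>G j \<omega>\<bar> \<le> 1"
    and dep: "\<And>j \<omega> \<omega>'. (\<And>l. l < j + L \<Longrightarrow> \<omega> l = \<omega>' l) \<Longrightarrow> G j \<omega> = G j \<omega>'"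
    and a: "a \<in> I"
  shows "AE \<omega> in \<Omega>. (\<lambda>N. (\<Sum>j<N. (of_bool (\<omega> (j + L) = a) - p a) * G j \<omega>) / real N) \<longlonglongrightarrow> 0"
proof (rule strong_law_orthogonal[where C = 1])
  interpret P: prob_space P by (rule prob_P)
  have p01: "0 \<le> p a" "p a \<le> 1" by (auto simp: p_def)
  have le1: "\<bar>of_bool b - p a\<bar> \<le> 1" for b using p01 by (cases b) auto
  show "(\<lambda>\<omega>. (of_bool (\<omega> (j + L) = a) - p a) * G j \<omega>) \<in> borel_measurable \<Omega>" for j
    by measurable
  show "\<bar>(of_bool (\<omega> (j + L) = a) - p a) * G j \<omega>\<bar> \<le> 1" for j \<omega>
    unfolding abs_mult using le1 bd by (intro mult_le_one) auto
  show "expectation (\<lambda>\<omega>. ((of_bool (\<omega> (i + L) = a) - p a) * G i \<omega>) * ((of_bool (\<omega> (j + L) = a) - p a) * G j \<omega>)) = 0"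
    if ij: "i < j" for i j
  proof -
    let ?H = "\<lambda>\<omega>. (of_bool (\<omega> (i + L) = a) - p a) * G i \<omega> * G j \<omega>"
    have "expectation (\<lambda>\<omega>. (of_bool (\<omega> (j + L) = a) - p a) * ?H \<omega>) = 0"
    proof (rule fresh_letter_uncorrelated[OF _ a])
      fix \<omega> \<omega>' :: "nat \<Rightarrow> 'i" assume eq: "\<And>l. l < j + L \<Longrightarrow> \<omega> l = \<omega>' l"
      have "G i \<omega> = G i \<omega>'" "G j \<omega> = G j \<omega>'" "\<omega> (i + L) = \<omega>' (i + L)"
        using eq ij by (auto intro!: dep)
      then show "?H \<omega> = ?H \<omega>'" by simp
    qed
    then show ?thesis by (simp add: mult_ac)
  qed
qed

lemma AE_fresh_letter_averages:
  fixes G :: "nat \<Rightarrow> (nat \<Rightarrow> 'i) \<Rightarrow> complex"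
  assumes meas [measurable]: "\<And>j. G j \<in> borel_measurable \<Omega>"
    and bd: "\<And>j \<omega>. norm (G j \<omega>) \<le> 1"
    and dep: "\<And>j \<omega> \<omega>'. (\<And>l. l < j + L \<Longrightarrow> \<omega> l = \<omega>' l) \<Longrightarrow> G j \<omega> = G j \<omega>'"
    and a: "a \<in> I"
  shows "AE \<omega> in \<Omega>. cesaro_null (\<lambda>j. (of_bool (\<omega> (j + L) = a) - of_real (p a)) * G j \<omega>)"
proof -
  have "AE \<omega> in \<Omega>. (\<lambda>N. (\<Sum>j<N. (of_bool (\<omega> (j + L) = a) - p a) * Re (G j \<omega>)) / real N) \<longlonglongrightarrow> 0"
  proof (rule AE_fresh_letter_averages_real[OF _ _ _ a])
    show "\<bar>Re (G j \<omega>)\<bar> \<le> 1" for j \<omega>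
      by (rule order_trans[OF abs_Re_le_cmod bd])
    show "Re (G j \<omega>) = Re (G j \<omega>')" if "\<And>l. l < j + L \<Longrightarrow> \<omega> l = \<omega>' l" for j \<omega> \<omega>'
      using dep[OF that] by simp
  qed simp
  moreover have "AE \<omega> in \<Omega>. (\<lambda>N. (\<Sum>j<N. (of_bool (\<omega> (j + L) = a) - p a) * Im (G j \<omega>)) / real N) \<longlonglongrightarrow> 0"
  proof (rule AE_fresh_letter_averages_real[OF _ _ _ a])
    show "\<bar>Im (G j \<omega>)\<bar> \<le> 1" for j \<omega>
      by (rule order_trans[OF abs_Im_le_cmod bd])
    show "Im (G j \<omega>) = Im (G j \<omega>')" if "\<And>l. l < j + L \<Longrightarrow> \<omega> l = \<omega>' l" for j \<omega> \<omega>'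
      using dep[OF that] by simp
  qed simp
  ultimately show ?thesis
  proof eventually_elim
    case (elim \<omega>)
    have "Re (of_bool b) = of_bool b" "Im (of_bool b) = 0" for b
      by (cases b; simp)+
    then have "(\<Sum>j<N. (of_bool (\<omega> (j + L) = a) - of_real (p a)) * G j \<omega>) / of_nat N
       = Complex ((\<Sum>j<N. (of_bool (\<omega> (j + L) = a) - p a) * Re (G j \<omega>)) / real N)
                 ((\<Sum>j<N. (of_bool (\<omega> (j + L) = a) - p a) * Im (G j \<omega>)) / real N)" for N
      by (simp add: complex_eq_iff)
    then show ?case unfolding cesaro_null_def
      using tendsto_Complex[OF elim] by (simp add: zero_complex.code)
  qed
qed

end

section \<open>The affine random walk\<close>

definition wave :: "real^'d \<Rightarrow> real^'d \<Rightarrow> complex" where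
  "wave q x = cis (2 * pi * (q \<bullet> x))"

lemma norm_wave [simp]: "norm (wave q x) = 1"
  by (simp add: wave_def)

lemma wave_add: "wave q (x + y) = wave q x * wave q y"
  by (simp add: wave_def cis_mult inner_add_right distrib_left)

lemma continuous_wave: "continuous_on A (wave q)"
  unfolding wave_def by (intro continuous_intros)

lemma inner_transpose_matrix_vector: "(transpose A *v x) \<bullet> y = x \<bullet> (A *v y)"
  for A :: "real^'n^'m"
  by (simp add: dot_lmul_matrix)

lemma matrix_inv_unique:
  fixes A B :: "real^'n^'n"
  assumes "A ** B = mat 1"
  shows "invertible A" "matrix_inv A = B"
proof -
  have BA: "B ** A = mat 1" using assms matrix_left_right_inverse by blast
  then show inv: "invertible A" using assms unfolding invertible_def by blast
  have "A ** matrix_inv A = mat 1 \<and> matrix_inv A ** A = mat 1"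
    using inv unfolding invertible_def matrix_inv_def by (rule someI_ex)
  then show "matrix_inv A = B"
    by (metis BA matrix_mul_assoc matrix_mul_lid matrix_mul_rid)
qed

locale expanding_system =
  fixes D :: "real^'d^'d" and I :: "'i set" and r :: "'i \<Rightarrow> nat" and t :: "'i \<Rightarrow> real^'d"
  assumes D_int: "integer_matrix D" and D_exp: "expanding D"
    and r_ge1: "\<And>i. i \<in> I \<Longrightarrow> 1 \<le> r i"
begin

abbreviation A :: "real^'d^'d" where "A \<equiv> matrix_inv D"

lemma pow_inverse: "matpow D n ** matpow A n = mat 1" "matpow A n ** matpow D n = mat 1"
  using matpow_inverse expanding_inverse[OF D_exp] by auto

lemma pow_cancel [simp]:
  "matpow D n *v (matpow A n *v x) = x" "matpow A n *v (matpow D n *v x) = x"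
  by (simp_all add: matrix_vector_mul_assoc pow_inverse)

lemma contraction_tendsto_0: "(\<lambda>n. entry_sum (matpow A n)) \<longlonglongrightarrow> 0"
  by (rule entry_sum_tendsto_0[OF expanding_inverse(3)[OF D_exp]])

text \<open>This is \<open>A\<^sub>j (A\<^sub>i y) - A\<^sub>i (A\<^sub>j y)\<close> for the affine maps \<open>A\<^sub>i y = D\<^sup>r (y + t\<^sub>i)\<close> with \<open>r = r i\<close>; the
difference does not depend on \<open>y\<close> because the linear parts commute.\<close>

definition commutator :: "'i \<Rightarrow> 'i \<Rightarrow> real^'d" where
  "commutator i j = ((mat 1 - matpow D (r i)) ** matpow D (r j)) *v t j
                  - ((mat 1 - matpow D (r j)) ** matpow D (r i)) *v t i"

text \<open>Apply \<open>near_integer_orbit\<close> to the transpose of \<open>D\<^sup>r\<close> with \<open>r = r i0\<close>. Its conclusion for all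
commutators would provide a non-zero integer vector that is integral on all of them. The bound does
not depend on \<open>R\<close> since \<open>R\<close> only enters through the vector \<open>c\<close> there.\<close>

lemma commutator_away_from_integers:
  assumes dense: "\<And>q. integer_vector q \<Longrightarrow> q \<noteq> 0 \<Longrightarrow> \<exists>i\<in>I. \<exists>j\<in>I. q \<bullet> commutator i j \<notin> \<int>"
    and m: "integer_vector m" "m \<noteq> 0" and i0: "i0 \<in> I"
  obtains \<epsilon> where "\<epsilon> > 0"
    "\<And>R. \<exists>l. \<exists>i\<in>I. \<exists>j\<in>I. \<forall>z\<in>\<int>. \<epsilon> \<le> \<bar>m \<bullet> (matpow D (R + r i0 * l) *v commutator i j) - z\<bar>"
proof -
  define U where "U = transpose (matpow D (r i0))"
  have powU: "matpow U l = transpose (matpow D (r i0 * l))" for l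
    unfolding U_def by (simp add: matpow_mult flip: transpose_matpow)
  have "U ** transpose (matpow A (r i0)) = transpose (matpow A (r i0) ** matpow D (r i0))"
    unfolding U_def by (simp add: matrix_transpose_mul)
  also have "\<dots> = mat 1" by (simp add: pow_inverse)
  finally have U: "invertible U" "matrix_inv U = transpose (matpow A (r i0))"
    using matrix_inv_unique by blast+
  have contr: "(\<lambda>n. matpow (matrix_inv U) n *v x) \<longlonglongrightarrow> 0" for x
  proof -
    have pow: "matpow (matrix_inv U) n = transpose (matpow A (r i0 * n))" for n
      unfolding U by (simp add: matpow_mult flip: transpose_matpow)
    have "filterlim (\<lambda>n. r i0 * n) at_top sequentially"
      using r_ge1[OF i0] by (intro filterlim_subseq) (auto simp: strict_mono_def)
    then have "(\<lambda>n. entry_sum (matpow A (r i0 * n)) * norm x) \<longlonglongrightarrow> 0"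
      by (intro tendsto_mult_left_zero filterlim_compose[OF contraction_tendsto_0])
    moreover have "\<forall>n. norm (matpow (matrix_inv U) n *v x) \<le> entry_sum (matpow A (r i0 * n)) * norm x"
      unfolding pow using norm_matrix_vector_le[of "transpose (matpow A (r i0 * _))" x, unfolded entry_sum_transpose]
      by blast
    ultimately show ?thesis
      by (rule Lim_null_comparison[OF always_eventually, rotated])
  qed
  have U_int: "integer_matrix U"
    unfolding U_def by (intro integer_matrix_transpose integer_matrix_matpow D_int)
  obtain \<epsilon> J where \<epsilon>: "\<epsilon> > 0"
    "\<And>c. (\<And>l. \<exists>z\<in>\<int>. \<bar>(matpow U l *v m) \<bullet> c - z\<bar> < \<epsilon>) \<Longrightarrow> (matpow U J *v m) \<bullet> c \<in> \<int>"
  proof (rule near_integer_orbit[OF U_int U(1) contr m])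
    fix \<epsilon> J
    assume "0 < \<epsilon>" "\<And>c. (\<And>l. \<exists>z\<in>\<int>. \<bar>(matpow U l *v m) \<bullet> c - z\<bar> < \<epsilon>) \<Longrightarrow> (matpow U J *v m) \<bullet> c \<in> \<int>"
    then show thesis by (rule that)
  qed
  have inner: "(matpow U l *v m) \<bullet> (matpow D R *v c) = m \<bullet> (matpow D (R + r i0 * l) *v c)" for l R c
    unfolding powU inner_transpose_matrix_vector
    by (simp add: matrix_vector_mul_assoc add.commute flip: matpow_add)
  have "\<exists>l. \<exists>i\<in>I. \<exists>j\<in>I. \<forall>z\<in>\<int>. \<epsilon> \<le> \<bar>m \<bullet> (matpow D (R + r i0 * l) *v commutator i j) - z\<bar>" for R
  proof (rule ccontr)
    assume "\<not> ?thesis"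
    then have near: "\<exists>z\<in>\<int>. \<bar>m \<bullet> (matpow D (R + r i0 * l) *v commutator i j) - z\<bar> < \<epsilon>"
      if "i \<in> I" "j \<in> I" for l i j using that by (simp add: not_le) 
    define q where "q = transpose (matpow D (R + r i0 * J)) *v m"
    have "q \<bullet> commutator i j \<in> \<int>" if "i \<in> I" "j \<in> I" for i j
    proof -
      have "(matpow U J *v m) \<bullet> (matpow D R *v commutator i j) \<in> \<int>"
        by (rule \<epsilon>(2)) (use near[OF that] in \<open>simp only: inner\<close>)
      then show ?thesis by (simp only: inner q_def inner_transpose_matrix_vector)
    qed
    moreover have "integer_vector q" unfolding q_def
      by (intro integer_vector_matrix_vector integer_matrix_transpose integer_matrix_matpow D_int m)
    moreover have "q \<noteq> 0"
    proof
      assume "q = 0"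
      then have "m \<bullet> (matpow D (R + r i0 * J) *v y) = 0" for y
        by (simp add: q_def flip: inner_transpose_matrix_vector)
      from this[of "matpow A (R + r i0 * J) *v m"] show False using m(2) by simp
    qed
    ultimately show False using dense by blast
  qed
  then show ?thesis using that \<epsilon>(1) by blast
qed

primrec walk :: "(nat \<Rightarrow> 'i) \<Rightarrow> nat \<Rightarrow> real^'d" where
  "walk \<omega> 0 = 0"
| "walk \<omega> (Suc j) = matpow D (r (\<omega> j)) *v (walk \<omega> j + t (\<omega> j))"

lemma walk_cong: "(\<And>l. l < j \<Longrightarrow> \<omega> l = \<omega>' l) \<Longrightarrow> walk \<omega> j = walk \<omega>' j"
  by (induction j) simp_all

end

text \<open>If \<open>s\<close> is at distance at least \<open>\<epsilon>\<close> from the integers, then \<open>cos (2 \<pi> s) \<le> cos (2 \<pi> \<epsilon>) < 1\<close>.\<close>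

lemma norm_1_plus_cis_le:
  assumes \<epsilon>: "0 < \<epsilon>"
  obtains \<theta> where "\<theta> > 0" "\<And>s. (\<And>z. z \<in> \<int> \<Longrightarrow> \<epsilon> \<le> \<bar>s - z\<bar>) \<Longrightarrow> norm (1 + cis (2 * pi * s)) / 2 \<le> 1 - \<theta>"
proof -
  \<comment> \<open>The minimum keeps the angle in \<open>[0, \<pi>]\<close>, where the cosine is decreasing.\<close>
  define \<epsilon>' where "\<epsilon>' = min \<epsilon> (1/2)"
  define \<kappa> where "\<kappa> = (1 + cos (2 * pi * \<epsilon>')) / 2"
  have e: "0 < \<epsilon>'" "\<epsilon>' \<le> 1/2" "\<epsilon>' \<le> \<epsilon>" using \<epsilon> by (auto simp: \<epsilon>'_def)
  have "cos (2 * pi * \<epsilon>') < cos 0"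
    using e by (intro cos_monotone_0_pi) (auto simp: field_simps)
  then have \<kappa>: "\<kappa> < 1" by (simp add: \<kappa>_def)
  show ?thesis
  proof (rule that[of "1 - sqrt \<kappa>"])
    show "1 - sqrt \<kappa> > 0" using \<kappa> by simp
    fix s :: real assume s: "\<And>z. z \<in> \<int> \<Longrightarrow> \<epsilon> \<le> \<bar>s - z\<bar>"
    define y where "y = \<bar>s - of_int (round s)\<bar>"
    have y: "\<epsilon>' \<le> y" "y \<le> 1/2"
      using s[of "of_int (round s)"] e of_int_round_abs_le[of s] by (auto simp: y_def abs_minus_commute)
    have "cos (2 * pi * s) = cos (2 * pi * (s - of_int (round s)))"
      using cos_int_2pin[of "round s"] sin_int_2pin[of "round s"]
      by (simp add: right_diff_distrib cos_diff mult_ac)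
    also have "\<dots> = cos (2 * pi * y)"
      using cos_abs_real[of "2 * pi * (s - of_int (round s))"] by (simp add: y_def abs_mult)
    also have "\<dots> \<le> cos (2 * pi * \<epsilon>')"
      using y e by (intro cos_monotone_0_pi_le) (auto simp: field_simps)
    finally have c: "cos (2 * pi * s) \<le> cos (2 * pi * \<epsilon>')" .
    have "(norm (1 + cis (2 * pi * s)) / 2)\<^sup>2 = (1 + cos (2 * pi * s)) / 2"
    proof -
      have "(norm (1 + cis (2 * pi * s)))\<^sup>2 = (1 + cos (2 * pi * s))\<^sup>2 + (sin (2 * pi * s))\<^sup>2"
        by (simp add: cmod_power2)
      also have "\<dots> = 2 + 2 * cos (2 * pi * s)"
        using sin_cos_squared_add[of "2 * pi * s"] by (simp add: power2_eq_square algebra_simps)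
      finally show ?thesis by (simp add: power_divide)
    qed
    also have "\<dots> \<le> \<kappa>" using c by (simp add: \<kappa>_def)
    finally have "norm (1 + cis (2 * pi * s)) / 2 \<le> sqrt \<kappa>" by (rule real_le_rsqrt)
    then show "norm (1 + cis (2 * pi * s)) / 2 \<le> 1 - (1 - sqrt \<kappa>)" by simp
  qed
qed

definition occurs_at :: "(nat \<Rightarrow> 'i) \<Rightarrow> nat \<Rightarrow> 'i list \<Rightarrow> bool" where
  "occurs_at \<omega> j u \<longleftrightarrow> (\<forall>l<length u. \<omega> (j + l) = u ! l)"

lemma occurs_at_Nil [simp]: "occurs_at \<omega> j []"
  by (simp add: occurs_at_def)

lemma occurs_at_snoc: "occurs_at \<omega> j (u @ [a]) \<longleftrightarrow> occurs_at \<omega> j u \<and> \<omega> (j + length u) = a"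
  by (auto simp: occurs_at_def nth_append less_Suc_eq)

locale random_walk = expanding_system D I r t + bernoulli_shift P I
  for D :: "real^'d^'d" and I :: "'i::countable set" and r :: "'i \<Rightarrow> nat" and t :: "'i \<Rightarrow> real^'d"
    and P :: "'i measure" +
  fixes m :: "real^'d"
begin

definition \<phi> :: "nat \<Rightarrow> real^'d \<Rightarrow> complex" where
  "\<phi> R x = wave m (matpow D R *v x)"

lemma norm_\<phi> [simp]: "norm (\<phi> R x) = 1" by (simp add: \<phi>_def)

lemma \<phi>_add: "\<phi> R (x + y) = \<phi> R x * \<phi> R y"
  by (simp add: \<phi>_def matrix_vector_right_distrib wave_add)

lemma \<phi>_pow: "\<phi> R (matpow D n *v x) = \<phi> (R + n) x"
  by (simp add: \<phi>_def matpow_add matrix_vector_mul_assoc)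

lemma \<phi>_measurable [measurable]: "\<phi> R \<in> borel_measurable borel"
  unfolding \<phi>_def wave_def
  by (intro borel_measurable_continuous_onI continuous_intros linear_continuous_on matrix_vector_mul_bounded_linear)

lemma walk_measurable [measurable]: "(\<lambda>\<omega>. walk \<omega> j) \<in> borel_measurable \<Omega>"
proof (induction j)
  case (Suc j)
  have "(\<lambda>\<omega>. matpow D (r (\<omega> j)) *v (walk \<omega> j + t (\<omega> j))) \<in> borel_measurable \<Omega>"
  proof (rule measurable_compose_countable'[where f = "\<lambda>i \<omega>. matpow D (r i) *v (walk \<omega> j + t i)" and I = I and g = "\<lambda>\<omega>. \<omega> j"])
    show "countable I" using fin by (rule countable_finite)
    have "(\<lambda>x. matpow D (r i) *v (x + t i)) \<in> borel_measurable borel" for i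
      unfolding matrix_vector_right_distrib
      by (intro borel_measurable_continuous_onI continuous_intros linear_continuous_on matrix_vector_mul_bounded_linear)
    then show "(\<lambda>\<omega>. matpow D (r i) *v (walk \<omega> j + t i)) \<in> borel_measurable \<Omega>" for i
      using measurable_compose[OF Suc] by blast
  qed simp
  then show ?case by simp
qed simp

text \<open>All that is needed of a typical sequence: whenever a word \<open>u\<close> has just been read, the following letter
has the right frequency, also when weighted by a character of the walk at the start of \<open>u\<close>.\<close>

definition letters_average_out :: "(nat \<Rightarrow> 'i) \<Rightarrow> bool" where
  "letters_average_out \<omega> \<longleftrightarrow> (\<forall>u\<in>lists I. \<forall>a\<in>I. \<forall>R.
     cesaro_null (\<lambda>j. (of_bool (\<omega> (j + length u) = a) - of_real (p a)) * (of_bool (occurs_at \<omega> j u) * \<phi> R (walk \<omega> j))))"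

lemma AE_letters_average_out: "AE \<omega> in \<Omega>. letters_average_out \<omega>"
proof -
  have "AE \<omega> in \<Omega>. cesaro_null (\<lambda>j. (of_bool (\<omega> (j + length u) = a) - of_real (p a)) * (of_bool (occurs_at \<omega> j u) * \<phi> R (walk \<omega> j)))"
    if a: "a \<in> I" for u a R
  proof (rule AE_fresh_letter_averages[OF _ _ _ a])
    have "Measurable.pred \<Omega> (\<lambda>\<omega>. occurs_at \<omega> j u)" for j
      unfolding occurs_at_def by measurable
    then show "(\<lambda>\<omega>. of_bool (occurs_at \<omega> j u) * \<phi> R (walk \<omega> j)) \<in> borel_measurable \<Omega>" for j
      by measurable
    show "norm (of_bool (occurs_at \<omega> j u) * \<phi> R (walk \<omega> j)) \<le> 1" for j \<omega>
      by (simp add: norm_mult)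
    show "of_bool (occurs_at \<omega> j u) * \<phi> R (walk \<omega> j) = of_bool (occurs_at \<omega>' j u) * \<phi> R (walk \<omega>' j)"
      if "\<And>l. l < j + length u \<Longrightarrow> \<omega> l = \<omega>' l" for j \<omega> \<omega>'
    proof -
      have "walk \<omega> j = walk \<omega>' j" by (rule walk_cong) (simp add: that)
      moreover have "occurs_at \<omega> j u \<longleftrightarrow> occurs_at \<omega>' j u" by (simp add: occurs_at_def that)
      ultimately show ?thesis by simp
    qed
  qed
  then show ?thesis unfolding letters_average_out_def
    using fin by (simp add: AE_ball_countable AE_all_countable countable_lists countable_finite)
qed

definition average :: "(nat \<Rightarrow> 'i) \<Rightarrow> nat \<Rightarrow> nat \<Rightarrow> complex" where
  "average \<omega> R N = (\<Sum>j<N. \<phi> R (walk \<omega> j)) / of_nat N"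

lemma norm_average_le: "norm (average \<omega> R N) \<le> 1"
proof -
  have "norm (\<Sum>j<N. \<phi> R (walk \<omega> j)) \<le> (\<Sum>j<N. 1)" by (rule sum_norm_le) simp
  then show ?thesis unfolding average_def by (cases "N = 0") (simp_all add: norm_divide)
qed

text \<open>Up to a vanishing error the averages at times \<open>j\<close> and \<open>j + 1\<close> agree, and at time \<open>j + 1\<close> the letter
\<open>\<omega> j\<close> may be replaced by its distribution. Since \<open>\<phi> R\<close> is a character, applying the affine map of the
letter \<open>i\<close> only changes \<open>R\<close> to \<open>R + r i\<close> and contributes a phase.\<close>

lemma average_step:
  assumes good: "letters_average_out \<omega>" and \<omega>: "\<And>j. \<omega> j \<in> I"
  shows "(\<lambda>N. average \<omega> R N - (\<Sum>i\<in>I. (of_real (p i) * \<phi> R (matpow D (r i) *v t i)) * average \<omega> (R + r i) N)) \<longlonglongrightarrow> 0"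
proof -
  let ?\<zeta> = "\<lambda>i. \<phi> R (matpow D (r i) *v t i)"
  have next_eq: "\<phi> R (walk \<omega> (Suc j)) = (\<Sum>i\<in>I. of_bool (\<omega> j = i) * (?\<zeta> i * \<phi> (R + r i) (walk \<omega> j)))" for j
  proof -
    have "\<phi> R (walk \<omega> (Suc j)) = ?\<zeta> (\<omega> j) * \<phi> (R + r (\<omega> j)) (walk \<omega> j)"
      by (simp add: matrix_vector_right_distrib \<phi>_add \<phi>_pow mult.commute)
    also have "\<dots> = (\<Sum>i\<in>I. if \<omega> j = i then ?\<zeta> i * \<phi> (R + r i) (walk \<omega> j) else 0)"
      using fin \<omega> by simp
    also have "\<dots> = (\<Sum>i\<in>I. of_bool (\<omega> j = i) * (?\<zeta> i * \<phi> (R + r i) (walk \<omega> j)))"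
      by (intro sum.cong) auto
    finally show ?thesis .
  qed
  have fresh: "cesaro_null (\<lambda>j. (of_bool (\<omega> j = i) - of_real (p i)) * \<phi> R' (walk \<omega> j))" if "i \<in> I" for i R'
    using good[unfolded letters_average_out_def, rule_format, of "[]" i R'] that by simp
  have "cesaro_null (\<lambda>j. \<Sum>i\<in>I. ?\<zeta> i * ((of_bool (\<omega> j = i) - of_real (p i)) * \<phi> (R + r i) (walk \<omega> j)))"
    by (intro cesaro_null_sum cesaro_null_cmult fresh)
  moreover have "cesaro_null (\<lambda>j. \<phi> R (walk \<omega> (Suc j)) - \<phi> R (walk \<omega> j))"
    by (rule cesaro_null_shift[of _ 1]) simp
  ultimately have "cesaro_null (\<lambda>j. (\<Sum>i\<in>I. ?\<zeta> i * ((of_bool (\<omega> j = i) - of_real (p i)) * \<phi> (R + r i) (walk \<omega> j)))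
      + (-1) * (\<phi> R (walk \<omega> (Suc j)) - \<phi> R (walk \<omega> j)))"
    by (intro cesaro_null_add cesaro_null_cmult)
  moreover have "(\<Sum>i\<in>I. ?\<zeta> i * ((of_bool (\<omega> j = i) - of_real (p i)) * \<phi> (R + r i) (walk \<omega> j)))
      + (-1) * (\<phi> R (walk \<omega> (Suc j)) - \<phi> R (walk \<omega> j))
      = \<phi> R (walk \<omega> j) - (\<Sum>i\<in>I. (of_real (p i) * ?\<zeta> i) * \<phi> (R + r i) (walk \<omega> j))" for j
    unfolding next_eq by (simp add: algebra_simps sum_subtractf)
  ultimately have "cesaro_null (\<lambda>j. \<phi> R (walk \<omega> j) - (\<Sum>i\<in>I. (of_real (p i) * ?\<zeta> i) * \<phi> (R + r i) (walk \<omega> j)))"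
    by (simp only:)
  moreover have "(\<Sum>j<N. \<phi> R (walk \<omega> j) - (\<Sum>i\<in>I. (of_real (p i) * ?\<zeta> i) * \<phi> (R + r i) (walk \<omega> j))) / of_nat N
      = average \<omega> R N - (\<Sum>i\<in>I. (of_real (p i) * ?\<zeta> i) * average \<omega> (R + r i) N)" for N
  proof -
    have "(\<Sum>j<N. \<Sum>i\<in>I. (of_real (p i) * ?\<zeta> i) * \<phi> (R + r i) (walk \<omega> j))
      = (\<Sum>i\<in>I. (of_real (p i) * ?\<zeta> i) * (\<Sum>j<N. \<phi> (R + r i) (walk \<omega> j)))"
      by (subst sum.swap) (simp add: sum_distrib_left)
    then show ?thesis unfolding average_def
      by (simp add: sum_subtractf diff_divide_distrib sum_divide_distrib[where A = I])
  qed
  ultimately show ?thesis unfolding cesaro_null_def by simp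
qed

definition pair_phase :: "'i \<Rightarrow> 'i \<Rightarrow> nat \<Rightarrow> complex" where
  "pair_phase i j R = \<phi> R (matpow D (r i) *v t i) * \<phi> (R + r i) (matpow D (r j) *v t j)"

text \<open>Two single steps, symmetrised in the two letters: the words \<open>ij\<close> and \<open>ji\<close> have the same probability and
lead to the same index.\<close>

lemma average_two_steps:
  assumes good: "letters_average_out \<omega>" and \<omega>: "\<And>j. \<omega> j \<in> I"
  shows "(\<lambda>N. average \<omega> R N - (\<Sum>x\<in>I\<times>I.
      (of_real (p (fst x) * p (snd x)) * ((pair_phase (fst x) (snd x) R + pair_phase (snd x) (fst x) R) / 2))
        * average \<omega> (R + r (fst x) + r (snd x)) N)) \<longlonglongrightarrow> 0"
proof -
  let ?\<zeta> = "\<lambda>R i. \<phi> R (matpow D (r i) *v t i)"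
  let ?a = "average \<omega>"
  let ?g = "\<lambda>i j N. of_real (p i * p j) * pair_phase i j R * ?a (R + r i + r j) N"
  have "(\<lambda>N. (?a R N - (\<Sum>i\<in>I. (of_real (p i) * ?\<zeta> R i) * ?a (R + r i) N))
     + (\<Sum>i\<in>I. (of_real (p i) * ?\<zeta> R i) *
         (?a (R + r i) N - (\<Sum>j\<in>I. (of_real (p j) * ?\<zeta> (R + r i) j) * ?a (R + r i + r j) N)))) \<longlonglongrightarrow> 0 + 0"
    by (intro tendsto_add average_step[OF good \<omega>] tendsto_null_sum tendsto_mult_right_zero)
  moreover have "(?a R N - (\<Sum>i\<in>I. (of_real (p i) * ?\<zeta> R i) * ?a (R + r i) N))
     + (\<Sum>i\<in>I. (of_real (p i) * ?\<zeta> R i) *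
         (?a (R + r i) N - (\<Sum>j\<in>I. (of_real (p j) * ?\<zeta> (R + r i) j) * ?a (R + r i + r j) N)))
     = ?a R N - (\<Sum>i\<in>I. \<Sum>j\<in>I. ?g i j N)" for N
    by (simp add: right_diff_distrib sum_subtractf sum_distrib_left pair_phase_def mult_ac)
  moreover have "(\<Sum>i\<in>I. \<Sum>j\<in>I. ?g i j N) = (\<Sum>x\<in>I\<times>I.
      (of_real (p (fst x) * p (snd x)) * ((pair_phase (fst x) (snd x) R + pair_phase (snd x) (fst x) R) / 2))
        * ?a (R + r (fst x) + r (snd x)) N)" for N
  proof -
    have swap: "(\<Sum>i\<in>I. \<Sum>j\<in>I. ?g i j N) = (\<Sum>i\<in>I. \<Sum>j\<in>I. ?g j i N)" by (rule sum.swap)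
    have half: "a = (a + b) / 2" if "a = b" for a b :: complex using that by simp
    have "(\<Sum>i\<in>I. \<Sum>j\<in>I. ?g i j N) = ((\<Sum>i\<in>I. \<Sum>j\<in>I. ?g i j N) + (\<Sum>i\<in>I. \<Sum>j\<in>I. ?g j i N)) / 2"
      by (rule half[OF swap])
    also have "\<dots> = (\<Sum>i\<in>I. \<Sum>j\<in>I. (?g i j N + ?g j i N) / 2)"
      by (simp add: sum.distrib sum_divide_distrib add_divide_distrib)
    also have "\<dots> = (\<Sum>i\<in>I. \<Sum>j\<in>I. (of_real (p i * p j) * ((pair_phase i j R + pair_phase j i R) / 2))
        * ?a (R + r i + r j) N)"
      by (intro sum.cong refl) (simp add: field_simps add_ac)
    finally show ?thesis by (simp add: sum.cartesian_product split_def)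
  qed
  ultimately show ?thesis by simp
qed

text \<open>The phases of \<open>ij\<close> and \<open>ji\<close> differ by the character of the commutator, which is where cancellation
comes from.\<close>

lemma norm_pair_phase_sum:
  "norm (pair_phase i j R + pair_phase j i R)
    = norm (1 + cis (2 * pi * (m \<bullet> (matpow D R *v commutator i j))))"
proof -
  have ph: "pair_phase i j R = \<phi> R (matpow D (r i) *v t i + matpow D (r i + r j) *v t j)" for i j
    by (simp add: pair_phase_def \<phi>_add matpow_add flip: matrix_vector_mul_assoc \<phi>_pow)
  have "matpow D (r j) *v t j + matpow D (r j + r i) *v t i
      = (matpow D (r i) *v t i + matpow D (r i + r j) *v t j) + commutator i j"
    unfolding commutator_def matpow_add
    by (simp add: matrix_vector_mult_diff_rdistrib flip: matrix_vector_mul_assoc)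
  then have "pair_phase i j R + pair_phase j i R = pair_phase i j R * (1 + \<phi> R (commutator i j))"
    unfolding ph by (simp add: \<phi>_add distrib_left)
  moreover have "norm (pair_phase i j R) = 1" by (simp add: pair_phase_def norm_mult)
  ultimately show ?thesis by (simp add: norm_mult \<phi>_def wave_def)
qed

lemma average_tendsto_0:
  assumes dense: "\<And>q. integer_vector q \<Longrightarrow> q \<noteq> 0 \<Longrightarrow> \<exists>i\<in>I. \<exists>j\<in>I. q \<bullet> commutator i j \<notin> \<int>"
    and m: "integer_vector m" "m \<noteq> 0" and p_pos: "\<And>i. i \<in> I \<Longrightarrow> 0 < p i"
    and good: "letters_average_out \<omega>" and \<omega>: "\<And>j. \<omega> j \<in> I"
  shows "average \<omega> R \<longlonglongrightarrow> 0"
proof -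
  define B where "B R = limsup_norm (average \<omega> R)" for R
  define w where "w i j R = norm (pair_phase i j R + pair_phase j i R) / 2" for i j R
  obtain \<epsilon> where \<epsilon>: "\<epsilon> > 0"
    "\<And>R. \<exists>l. \<exists>i\<in>I. \<exists>j\<in>I. \<forall>z\<in>\<int>. \<epsilon> \<le> \<bar>m \<bullet> (matpow D (R + r (\<omega> 0) * l) *v commutator i j) - z\<bar>"
    using commutator_away_from_integers[OF dense m \<omega>[of 0]] by blast
  obtain \<theta> where \<theta>: "\<theta> > 0"
    "\<And>s. (\<And>z. z \<in> \<int> \<Longrightarrow> \<epsilon> \<le> \<bar>s - z\<bar>) \<Longrightarrow> norm (1 + cis (2 * pi * s)) / 2 \<le> 1 - \<theta>"
    using norm_1_plus_cis_le[OF \<epsilon>(1)] by blast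
  have "B R = 0"
  proof (rule subaverage_vanishes[where I = I and p = p and r = r and w = w and C = 1 and \<theta> = \<theta> and ?i0.0 = "\<omega> 0"])
    show "0 \<le> B R" for R unfolding B_def by (rule limsup_norm_nonneg[OF norm_average_le])
    show "B R \<le> 1" for R unfolding B_def
      by (intro limsup_norm_le always_eventually allI norm_average_le) simp
    have pn: "0 \<le> p i" for i by (simp add: p_def)
    show "B R \<le> (\<Sum>i\<in>I. p i * B (R + r i))" for R
      using limsup_norm_le_sum[OF fin norm_average_le average_step[OF good \<omega>, of R]]
      by (simp add: B_def norm_mult pn)
    show "B R \<le> (\<Sum>i\<in>I. \<Sum>j\<in>I. p i * p j * w i j R * B (R + r i + r j))" for R
      using limsup_norm_le_sum[OF finite_cartesian_product[OF fin fin] norm_average_le average_two_steps[OF good \<omega>, of R]]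
      by (simp add: B_def w_def norm_mult norm_divide pn sum.cartesian_product split_def)
    show "w i j R \<le> 1" for i j R
      using norm_triangle_ineq[of "pair_phase i j R" "pair_phase j i R"]
      by (simp add: w_def pair_phase_def norm_mult)
    show "\<exists>l. \<exists>i\<in>I. \<exists>j\<in>I. w i j (R + r (\<omega> 0) * l) \<le> 1 - \<theta>" for R
    proof -
      obtain l i j where "i \<in> I" "j \<in> I"
        "\<And>z. z \<in> \<int> \<Longrightarrow> \<epsilon> \<le> \<bar>m \<bullet> (matpow D (R + r (\<omega> 0) * l) *v commutator i j) - z\<bar>"
        using \<epsilon>(2)[of R] by blast
      moreover from this(3) have "w i j (R + r (\<omega> 0) * l) \<le> 1 - \<theta>"
        unfolding w_def norm_pair_phase_sum by (rule \<theta>(2))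
      ultimately show ?thesis by blast
    qed
  qed (use fin p_pos sum_p r_ge1 \<theta>(1) \<omega> in \<open>auto simp: w_def\<close>)
  then show ?thesis unfolding B_def by (rule tendsto_0_if_limsup_norm_0[OF norm_average_le])
qed

text \<open>By the frequency of the letter that follows, the last letter of \<open>u\<close> can be traded for its
probability; for the empty word this is the hypothesis on the averages.\<close>

lemma occurrences_average_out:
  assumes good: "letters_average_out \<omega>" and avg: "\<And>R. average \<omega> R \<longlonglongrightarrow> 0"
    and u: "u \<in> lists I"
  shows "cesaro_null (\<lambda>j. of_bool (occurs_at \<omega> j u) * \<phi> R (walk \<omega> j))"
  using u
proof (induction u rule: rev_induct)
  case Nil
  show ?case using avg[of R] by (simp add: cesaro_null_def average_def[abs_def])
next
  case (snoc a u)
  then have ua: "u \<in> lists I" "a \<in> I" by auto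
  have "cesaro_null (\<lambda>j. (of_bool (\<omega> (j + length u) = a) - of_real (p a)) * (of_bool (occurs_at \<omega> j u) * \<phi> R (walk \<omega> j))
      + of_real (p a) * (of_bool (occurs_at \<omega> j u) * \<phi> R (walk \<omega> j)))"
    using good ua unfolding letters_average_out_def
    by (intro cesaro_null_add cesaro_null_cmult snoc.IH) auto
  moreover have "(of_bool (\<omega> (j + length u) = a) - of_real (p a)) * (of_bool (occurs_at \<omega> j u) * \<phi> R (walk \<omega> j))
      + of_real (p a) * (of_bool (occurs_at \<omega> j u) * \<phi> R (walk \<omega> j))
      = of_bool (occurs_at \<omega> j (u @ [a])) * \<phi> R (walk \<omega> j)" for j
    by (simp add: occurs_at_snoc algebra_simps)
  ultimately show ?case by simp
qed

text \<open>If \<open>g j\<close> is a function of the letters \<open>\<omega> j, \<dots>, \<omega> (j + L - 1)\<close>, the product is a finite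
combination of the sequences of \<open>occurrences_average_out\<close>. Uniform approximation suffices for
averages.\<close>

lemma future_factor_averages_out:
  assumes good: "letters_average_out \<omega>" and \<omega>: "\<And>j. \<omega> j \<in> I"
    and avg: "\<And>R. average \<omega> R \<longlonglongrightarrow> 0"
    and approx: "\<And>\<delta>. \<delta> > 0 \<Longrightarrow> \<exists>L c. \<forall>j. norm (g j - c (map (\<lambda>l. \<omega> (j + l)) [0..<L])) \<le> \<delta>"
  shows "cesaro_null (\<lambda>j. g j * \<phi> R (walk \<omega> j))"
proof (rule cesaro_null_approx)
  fix \<delta> :: real assume "\<delta> > 0"
  then obtain L c where c: "\<And>j. norm (g j - c (map (\<lambda>l. \<omega> (j + l)) [0..<L])) \<le> \<delta>"
    using approx by blast
  define W where "W = {u. set u \<subseteq> I \<and> length u = L}"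
  have finW: "finite W" unfolding W_def by (rule finite_lists_length_eq[OF fin])
  define b where "b j = (\<Sum>u\<in>W. c u * (of_bool (occurs_at \<omega> j u) * \<phi> R (walk \<omega> j)))" for j
  have b: "b j = c (map (\<lambda>l. \<omega> (j + l)) [0..<L]) * \<phi> R (walk \<omega> j)" for j
  proof -
    let ?u = "map (\<lambda>l. \<omega> (j + l)) [0..<L]"
    have "occurs_at \<omega> j u \<longleftrightarrow> u = ?u" if "u \<in> W" for u
      using that by (auto simp: occurs_at_def W_def list_eq_iff_nth_eq)
    then have "b j = (\<Sum>u\<in>W. if u = ?u then c ?u * \<phi> R (walk \<omega> j) else 0)"
      unfolding b_def by (intro sum.cong) auto
    moreover have "?u \<in> W" using \<omega> by (auto simp: W_def)
    ultimately show ?thesis using finW by simp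
  qed
  have "cesaro_null b" unfolding b_def
    by (intro cesaro_null_sum cesaro_null_cmult occurrences_average_out[OF good avg]) (auto simp: W_def)
  moreover have "norm (g j * \<phi> R (walk \<omega> j) - b j) \<le> \<delta>" for j
    unfolding b using c[of j] by (simp add: norm_mult flip: left_diff_distrib)
  ultimately show "\<exists>b. cesaro_null b \<and> (\<forall>j. norm (g j * \<phi> R (walk \<omega> j) - b j) \<le> \<delta>)" by blast
qed

end

section \<open>Coded points\<close>

lemma sum_lessThan_add: "(\<Sum>n<a + b. x n) = (\<Sum>n<a. x n) + (\<Sum>s<b. x (a + s))"
  for x :: "nat \<Rightarrow> 'a::comm_monoid_add"
  by (induction b) (simp_all add: add.assoc)

text \<open>The maps are taken in the order of the coding map: the first letter is applied last.\<close>

definition word_map :: "('i \<Rightarrow> 'a \<Rightarrow> 'a) \<Rightarrow> (nat \<Rightarrow> 'i) \<Rightarrow> nat \<Rightarrow> 'a \<Rightarrow> 'a" where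
  "word_map f \<omega> n = foldr (\<lambda>j. f (\<omega> j)) [0..<n]"

lemma word_map_0 [simp]: "word_map f \<omega> 0 x = x"
  by (simp add: word_map_def)

lemma word_map_Suc: "word_map f \<omega> (Suc n) x = f (\<omega> 0) (word_map f (\<lambda>j. \<omega> (Suc j)) n x)"
proof -
  have "[0..<Suc n] = 0 # map Suc [0..<n]" by (simp add: upt_conv_Cons map_Suc_upt del: upt_Suc)
  then show ?thesis unfolding word_map_def by (simp add: foldr_map o_def del: upt_Suc)
qed

lemma word_map_add: "word_map f \<omega> (n + k) x = word_map f \<omega> n (word_map f (\<lambda>j. \<omega> (n + j)) k x)"
  by (induction n arbitrary: \<omega>) (simp_all add: word_map_Suc)

lemma word_map_cong: "(\<And>l. l < n \<Longrightarrow> \<omega> l = \<omega>' l) \<Longrightarrow> word_map f \<omega> n x = word_map f \<omega>' n x"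
  unfolding word_map_def by (rule foldr_cong) auto

lemma coding_map_eq: "coding_map f \<omega> = lim (\<lambda>n. word_map f \<omega> n 0)"
  by (simp add: coding_map_def word_map_def)

locale coded_walk = random_walk D I r t P m
  for D :: "real^'d^'d" and I :: "'i::countable set" and r :: "'i \<Rightarrow> nat" and t :: "'i \<Rightarrow> real^'d"
    and P :: "'i measure" and m :: "real^'d" +
  fixes f :: "'i \<Rightarrow> real^'d \<Rightarrow> real^'d" and K :: "(real^'d) set"
  assumes f: "\<And>i x. i \<in> I \<Longrightarrow> f i x = matpow A (r i) *v x + t i"
    and K: "compact K" "K \<noteq> {}" "\<And>i x. i \<in> I \<Longrightarrow> x \<in> K \<Longrightarrow> f i x \<in> K"
begin

abbreviation shift :: "nat \<Rightarrow> (nat \<Rightarrow> 'i) \<Rightarrow> nat \<Rightarrow> 'i" where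
  "shift n \<omega> \<equiv> \<lambda>j. \<omega> (n + j)"

definition len :: "(nat \<Rightarrow> 'i) \<Rightarrow> nat \<Rightarrow> nat" where
  "len \<omega> n = (\<Sum>l<n. r (\<omega> l))"

lemma len_ge: "(\<And>j. \<omega> j \<in> I) \<Longrightarrow> n \<le> len \<omega> n"
  unfolding len_def using sum_mono[of "{..<n}" "\<lambda>_. 1" "\<lambda>l. r (\<omega> l)"] r_ge1 by simp

lemma word_map_in_K: "(\<And>j. \<omega> j \<in> I) \<Longrightarrow> x \<in> K \<Longrightarrow> word_map f \<omega> n x \<in> K"
  by (induction n arbitrary: \<omega>) (simp_all add: word_map_Suc K(3))

lemma word_map_diff:
  "(\<And>j. \<omega> j \<in> I) \<Longrightarrow> word_map f \<omega> n x - word_map f \<omega> n y = matpow A (len \<omega> n) *v (x - y)"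
proof (induction n arbitrary: \<omega>)
  case (Suc n)
  have "len \<omega> (Suc n) = r (\<omega> 0) + len (\<lambda>j. \<omega> (Suc j)) n"
    unfolding len_def by (rule sum.lessThan_Suc_shift)
  then show ?case
    using Suc.IH[of "\<lambda>j. \<omega> (Suc j)"] Suc.prems
    by (simp add: word_map_Suc f matpow_add flip: matrix_vector_mul_assoc matrix_vector_mult_diff_distrib)
qed (simp add: len_def)

lemma word_map_contracts:
  assumes \<omega>: "\<And>j. \<omega> j \<in> I"
  shows "(\<lambda>n. entry_sum (matpow A (len \<omega> n))) \<longlonglongrightarrow> 0"
proof (rule filterlim_compose[OF contraction_tendsto_0])
  show "filterlim (len \<omega>) at_top sequentially"
    by (rule filterlim_at_top_mono[OF filterlim_ident]) (simp add: len_ge[of \<omega>, OF \<omega>])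
qed

lemma K_bounded: obtains C where "C > 0" "\<And>x. x \<in> K \<Longrightarrow> norm x \<le> C"
  using compact_imp_bounded[OF K(1)] that unfolding bounded_pos by blast

text \<open>The points \<open>word_map f \<omega> n x0\<close> with \<open>x0\<close> in \<open>K\<close> stay in \<open>K\<close>, and later ones lie in
\<open>word_map f \<omega> n ` K\<close>, whose diameter tends to \<open>0\<close>. Starting at \<open>0\<close> instead of \<open>x0\<close> makes no
difference in the limit.\<close>

lemma word_map_converges:
  assumes \<omega>: "\<And>j. \<omega> j \<in> I"
  shows "\<exists>y\<in>K. (\<lambda>n. word_map f \<omega> n 0) \<longlonglongrightarrow> y"
proof -
  obtain x0 where x0: "x0 \<in> K" using K(2) by blast
  obtain C where C: "C > 0" "\<And>x. x \<in> K \<Longrightarrow> norm x \<le> C" using K_bounded by blast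
  define y where "y n = word_map f \<omega> n x0" for n
  have yK: "y n \<in> K" for n unfolding y_def by (rule word_map_in_K[OF \<omega> x0])
  have "Cauchy y"
    unfolding Cauchy_altdef2
  proof (intro allI impI)
    fix e :: real assume e: "e > 0"
    then have "e / (2 * C) > 0" using C(1) by simp
    then obtain N where N: "entry_sum (matpow A (len \<omega> N)) < e / (2 * C)"
      using order_tendstoD(2)[OF word_map_contracts[of \<omega>, OF \<omega>], of "e / (2 * C)"]
      unfolding eventually_sequentially by blast
    have "dist (y n) (y N) < e" if "n \<ge> N" for n
    proof -
      from le_Suc_ex[OF that] obtain k where n: "n = N + k" ..
      let ?z = "word_map f (shift N \<omega>) k x0"
      have z: "?z \<in> K" by (rule word_map_in_K[OF _ x0]) (rule \<omega>)
      have "y n - y N = matpow A (len \<omega> N) *v (?z - x0)"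
        unfolding y_def n word_map_add by (rule word_map_diff[of \<omega>, OF \<omega>])
      then have "norm (y n - y N) \<le> entry_sum (matpow A (len \<omega> N)) * norm (?z - x0)"
        using norm_matrix_vector_le by metis
      also have "\<dots> \<le> entry_sum (matpow A (len \<omega> N)) * (2 * C)"
        using norm_triangle_ineq4[of ?z x0] C(2)[OF z] C(2)[OF x0] entry_sum_nonneg
        by (intro mult_left_mono) auto
      also have "\<dots> < e" using N C(1) by (simp add: field_simps)
      finally show ?thesis by (simp add: dist_norm)
    qed
    then show "\<exists>N. \<forall>n\<ge>N. dist (y n) (y N) < e" by blast
  qed
  then obtain l where l: "y \<longlonglongrightarrow> l" by (auto simp: Cauchy_convergent_iff convergent_def)
  have "l \<in> K" using closed_sequentially[OF compact_imp_closed[OF K(1)] yK l] .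
  moreover have "(\<lambda>n. word_map f \<omega> n 0) \<longlonglongrightarrow> l"
  proof -
    have "(\<lambda>n. entry_sum (matpow A (len \<omega> n)) * norm (0 - x0)) \<longlonglongrightarrow> 0"
      by (rule tendsto_mult_left_zero[OF word_map_contracts[of \<omega>, OF \<omega>]])
    then have "(\<lambda>n. word_map f \<omega> n 0 - y n) \<longlonglongrightarrow> 0"
      by (rule Lim_null_comparison[OF always_eventually, rotated])
         (auto simp: y_def word_map_diff[of \<omega>, OF \<omega>] intro: norm_matrix_vector_le[of _ "0 - x0", simplified])
    from tendsto_add[OF this l] show ?thesis by simp
  qed
  ultimately show ?thesis by blast
qed

lemma
  assumes \<omega>: "\<And>j. \<omega> j \<in> I"
  shows coding_map_in_K: "coding_map f \<omega> \<in> K"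
    and coding_map_LIMSEQ: "(\<lambda>n. word_map f \<omega> n 0) \<longlonglongrightarrow> coding_map f \<omega>"
  using word_map_converges[of \<omega>, OF \<omega>] limI unfolding coding_map_eq by metis+

lemma coding_map_word:
  assumes \<omega>: "\<And>j. \<omega> j \<in> I"
  shows "coding_map f \<omega> = word_map f \<omega> n (coding_map f (shift n \<omega>))"
proof (rule LIMSEQ_unique)
  show "(\<lambda>k. word_map f \<omega> (n + k) 0) \<longlonglongrightarrow> coding_map f \<omega>"
    using LIMSEQ_ignore_initial_segment[OF coding_map_LIMSEQ[of \<omega>, OF \<omega>], of n] by (simp add: add.commute)
  have aff: "word_map f \<omega> n x = matpow A (len \<omega> n) *v x + word_map f \<omega> n 0" for x
    using word_map_diff[of \<omega> n x 0, OF \<omega>] by (simp add: algebra_simps)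
  have "(\<lambda>k. word_map f \<omega> n (word_map f (shift n \<omega>) k 0)) \<longlonglongrightarrow> word_map f \<omega> n (coding_map f (shift n \<omega>))"
    unfolding aff[of "word_map f (shift n \<omega>) _ 0"] aff[of "coding_map f (shift n \<omega>)"]
    by (intro tendsto_add tendsto_const bounded_linear.tendsto[OF matrix_vector_mul_bounded_linear] coding_map_LIMSEQ \<omega>)
  then show "(\<lambda>k. word_map f \<omega> (n + k) 0) \<longlonglongrightarrow> word_map f \<omega> n (coding_map f (shift n \<omega>))"
    by (simp add: word_map_add)
qed

text \<open>Expanding by the total exponent of the first \<open>j\<close> letters splits the coded point into a part that depends
on these letters and a part that depends on the remaining ones.\<close>

lemma expanded_point:
  assumes \<omega>: "\<And>j. \<omega> j \<in> I"
  shows "matpow D (len \<omega> j) *v coding_map f \<omega> = walk \<omega> j + coding_map f (shift j \<omega>)"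
proof (induction j)
  case (Suc j)
  have len: "len \<omega> (Suc j) = r (\<omega> j) + len \<omega> j" by (simp add: len_def)
  have "coding_map f (shift j \<omega>) = f (\<omega> j) (coding_map f (shift (Suc j) \<omega>))"
    using coding_map_word[of "shift j \<omega>" 1] \<omega> by (simp add: word_map_Suc)
  also have "\<dots> = matpow A (r (\<omega> j)) *v coding_map f (shift (Suc j) \<omega>) + t (\<omega> j)"
    by (rule f[OF \<omega>])
  finally have "matpow D (r (\<omega> j)) *v coding_map f (shift j \<omega>)
      = coding_map f (shift (Suc j) \<omega>) + matpow D (r (\<omega> j)) *v t (\<omega> j)"
    by (simp add: matrix_vector_right_distrib)
  then show ?case unfolding len matpow_add
    by (simp add: Suc matrix_vector_right_distrib flip: matrix_vector_mul_assoc)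
qed (simp add: len_def)

lemma \<phi>_0 [simp]: "\<phi> s 0 = 1" by (simp add: \<phi>_def wave_def)

text \<open>Points coded by sequences with a long common prefix are uniformly close, because \<open>K\<close> is bounded, and
\<open>\<phi> s\<close> is a continuous character. The prefix has at least one letter so that it also determines
\<open>r (\<omega> j)\<close>.\<close>

lemma future_approximable:
  assumes \<omega>: "\<And>j. \<omega> j \<in> I" and \<delta>: "\<delta> > 0"
  shows "\<exists>L c. \<forall>j. norm ((if s < r (\<omega> j) then \<phi> s (coding_map f (shift j \<omega>)) else 0)
           - c (map (\<lambda>l. \<omega> (j + l)) [0..<L])) \<le> \<delta>"
proof -
  obtain C where C: "C > 0" "\<And>x. x \<in> K \<Longrightarrow> norm x \<le> C" using K_bounded by blast
  have "continuous_on UNIV (\<phi> s)" unfolding \<phi>_def wave_def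
    by (intro continuous_intros linear_continuous_on matrix_vector_mul_bounded_linear)
  then have "\<phi> s \<midarrow>0\<rightarrow> \<phi> s 0" by (simp add: continuous_on_eq_continuous_at isCont_def del: \<phi>_0)
  from LIM_D[OF this \<delta>] obtain \<eta> where \<eta>: "\<eta> > 0" "\<And>d. norm d < \<eta> \<Longrightarrow> norm (\<phi> s d - 1) \<le> \<delta>"
    using \<delta> by (metis \<phi>_0 diff_0_right diff_self less_imp_le norm_zero)
  have "\<eta> / C > 0" using \<eta>(1) C(1) by simp
  from order_tendstoD(2)[OF contraction_tendsto_0 this] obtain N where
    N: "\<And>k. k \<ge> N \<Longrightarrow> entry_sum (matpow A k) < \<eta> / C"
    unfolding eventually_sequentially by blast
  define L where "L = Suc N"
  define c where "c u = (if s < r (hd u) then \<phi> s (word_map f ((!) u) L 0) else 0)" for u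
  have "norm ((if s < r (\<omega> j) then \<phi> s (coding_map f (shift j \<omega>)) else 0)
           - c (map (\<lambda>l. \<omega> (j + l)) [0..<L])) \<le> \<delta>" for j
  proof -
    let ?u = "map (\<lambda>l. \<omega> (j + l)) [0..<L]" and ?\<omega> = "shift j \<omega>"
    have hd: "hd ?u = \<omega> j" by (simp add: L_def upt_conv_Cons del: upt_Suc)
    have wm: "word_map f ((!) ?u) L 0 = word_map f ?\<omega> L 0"
      by (rule word_map_cong) (simp add: L_def del: upt_Suc)
    define d where "d = matpow A (len ?\<omega> L) *v coding_map f (shift L ?\<omega>)"
    have d: "coding_map f ?\<omega> = word_map f ?\<omega> L 0 + d"
      using word_map_diff[of ?\<omega> L "coding_map f (shift L ?\<omega>)" 0] coding_map_word[of ?\<omega> L] \<omega>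
      by (simp add: d_def algebra_simps)
    have "norm d \<le> entry_sum (matpow A (len ?\<omega> L)) * norm (coding_map f (shift L ?\<omega>))"
      unfolding d_def by (rule norm_matrix_vector_le)
    also have "\<dots> \<le> entry_sum (matpow A (len ?\<omega> L)) * C"
      using \<omega> entry_sum_nonneg by (intro mult_left_mono C(2) coding_map_in_K) auto
    also have "\<dots> < \<eta>"
    proof -
      have "N \<le> len ?\<omega> L" using len_ge[of ?\<omega> L] \<omega> by (simp add: L_def)
      from N[OF this] show ?thesis using C(1) by (simp add: field_simps)
    qed
    finally have "norm (\<phi> s d - 1) \<le> \<delta>" by (rule \<eta>(2))
    moreover have "\<phi> s (coding_map f ?\<omega>) - \<phi> s (word_map f ?\<omega> L 0) = \<phi> s (word_map f ?\<omega> L 0) * (\<phi> s d - 1)"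
      unfolding d \<phi>_add by (simp add: algebra_simps)
    ultimately have "norm (\<phi> s (coding_map f ?\<omega>) - \<phi> s (word_map f ?\<omega> L 0)) \<le> \<delta>"
      by (simp add: norm_mult)
    then show ?thesis using \<delta> unfolding c_def hd wm by simp
  qed
  then show ?thesis by blast
qed

text \<open>Cut the exponents into the blocks between \<open>len \<omega> j\<close> and \<open>len \<omega> (j + 1)\<close>. On the \<open>j\<close>-th block the
orbit consists of \<open>D\<^sup>s (walk \<omega> j + y)\<close> with \<open>y\<close> coded by the letters from \<open>j\<close> on, so
\<open>future_factor_averages_out\<close> applies for each \<open>s\<close>.\<close>

lemma wave_averages_out_at_coded_point:
  assumes good: "letters_average_out \<omega>" and \<omega>: "\<And>j. \<omega> j \<in> I"
    and avg: "\<And>R. average \<omega> R \<longlonglongrightarrow> 0"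
  shows "cesaro_null (\<lambda>n. wave m (matpow D n *v coding_map f \<omega>))"
proof -
  define x where "x n = wave m (matpow D n *v coding_map f \<omega>)" for n
  define q where "q = Max (r ` I)"
  have q: "r (\<omega> j) \<le> q" for j unfolding q_def using fin \<omega> by simp
  define g where "g s j = (if s < r (\<omega> j) then \<phi> s (coding_map f (shift j \<omega>)) else 0)" for s j
  have "x n = \<phi> n (coding_map f \<omega>)" for n by (simp add: x_def \<phi>_def)
  then have x_block: "x (len \<omega> j + s) = \<phi> s (coding_map f (shift j \<omega>)) * \<phi> s (walk \<omega> j)" for j s
    using \<phi>_pow[of s "len \<omega> j" "coding_map f \<omega>"] expanded_point[of \<omega> j, OF \<omega>]
    by (simp add: \<phi>_add add.commute mult.commute)
  have block: "(\<Sum>s<r (\<omega> j). x (len \<omega> j + s)) = (\<Sum>s<q. g s j * \<phi> s (walk \<omega> j))" for j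
    unfolding x_block
    by (rule sum.mono_neutral_cong_left) (use q[of j] in \<open>auto simp: g_def\<close>)
  have blocks: "(\<Sum>n<len \<omega> J. x n) = (\<Sum>j<J. \<Sum>s<q. g s j * \<phi> s (walk \<omega> j))" for J
  proof (induction J)
    case (Suc J)
    have "len \<omega> (Suc J) = len \<omega> J + r (\<omega> J)" by (simp add: len_def)
    then show ?case by (simp add: sum_lessThan_add Suc block)
  qed (simp add: len_def)
  have "cesaro_null (\<lambda>j. \<Sum>s<q. g s j * \<phi> s (walk \<omega> j))"
    unfolding g_def
    by (intro cesaro_null_sum future_factor_averages_out[OF good \<omega> avg] future_approximable \<omega>)
  then have "cesaro_null x"
  proof (intro cesaro_null_from_blocks[of x "len \<omega>" q])
    show "len \<omega> j < len \<omega> (Suc j)" for j using r_ge1[OF \<omega>[of j]] by (simp add: len_def)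
    show "len \<omega> (Suc j) \<le> len \<omega> j + q" for j using q[of j] by (simp add: len_def)
  qed (simp_all add: x_def[abs_def] len_def[of \<omega> 0] cesaro_null_def blocks[unfolded x_def])
  then show ?thesis by (simp add: x_def[abs_def])
qed

lemma coding_map_measurable: "coding_map f \<in> measurable \<Omega> (restrict_space borel K)"
proof (rule measurable_restrict_space2)
  show "coding_map f \<in> space \<Omega> \<rightarrow> K"
    using coding_map_in_K by (auto simp: space_\<Omega>)
  have stage: "(\<lambda>\<omega>. foldr (\<lambda>j. f (\<omega> j)) xs 0) \<in> borel_measurable \<Omega>" for xs
  proof (induction xs)
    case (Cons j xs)
    have "(\<lambda>\<omega>. f (\<omega> j) (foldr (\<lambda>j. f (\<omega> j)) xs 0)) \<in> borel_measurable \<Omega>"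
    proof (rule measurable_compose_countable'[where f = "\<lambda>i \<omega>. f i (foldr (\<lambda>j. f (\<omega> j)) xs 0)" and I = I and g = "\<lambda>\<omega>. \<omega> j"])
      show "countable I" using fin by (rule countable_finite)
      fix i assume i: "i \<in> I"
      have "(\<lambda>x. matpow A (r i) *v x + t i) \<in> borel_measurable borel"
        by (intro borel_measurable_continuous_onI continuous_intros linear_continuous_on matrix_vector_mul_bounded_linear)
      then show "(\<lambda>\<omega>. f i (foldr (\<lambda>j. f (\<omega> j)) xs 0)) \<in> borel_measurable \<Omega>"
        unfolding f[OF i] using measurable_compose[OF Cons] by blast
    qed simp
    then show ?case by simp
  qed simp
  have "(\<lambda>\<omega>. lim (\<lambda>n. foldr (\<lambda>j. f (\<omega> j)) [0..<n] 0)) \<in> borel_measurable \<Omega>"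
    by (intro borel_measurable_lim_metric stage)
  then show "coding_map f \<in> borel_measurable \<Omega>"
    unfolding coding_map_def[abs_def] .
qed

end

section \<open>Characters of the torus\<close>

lemma wave_eq_1_iff: "wave q x = 1 \<longleftrightarrow> q \<bullet> x \<in> \<int>"
proof -
  have "wave q x = 1 \<longleftrightarrow> cos (2 * pi * (q \<bullet> x)) = 1"
    by (auto simp: wave_def complex_eq_iff cos_one_sin_zero)
  also have "\<dots> \<longleftrightarrow> q \<bullet> x \<in> \<int>"
    by (auto simp: cos_one_2pi_int Ints_def)
  finally show ?thesis .
qed

lemma integer_vector_inner: "integer_vector q \<Longrightarrow> integer_vector v \<Longrightarrow> q \<bullet> v \<in> \<int>"
  unfolding integer_vector_def inner_vec_def by (auto intro!: Ints_sum Ints_mult)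

lemma wave_cong_torus:
  assumes "integer_vector q" "to_torus x = to_torus y"
  shows "wave q x = wave q y"
proof -
  have "integer_vector (x - y)"
    using assms(2) by (simp add: to_torus_eq_iff int_congruent_def integer_vector_def)
  then have "wave q (x - y) = 1" using integer_vector_inner[OF assms(1)] by (simp add: wave_eq_1_iff)
  then show ?thesis using wave_add[of q "x - y" y] by simp
qed

lemma wave_half: "q \<noteq> 0 \<Longrightarrow> wave q ((1 / (2 * (q \<bullet> q))) *\<^sub>R q) = -1"
  by (simp add: wave_def)

text \<open>For an integer vector \<open>q\<close> the choice of a representative is irrelevant, and this is the character of the
torus with frequency \<open>q\<close>.\<close>

definition torus_wave :: "real^'n \<Rightarrow> 'n::finite torus \<Rightarrow> complex" where
  "torus_wave q z = wave q (SOME x. to_torus x = z)"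

lemma torus_wave: "integer_vector q \<Longrightarrow> torus_wave q (to_torus x) = wave q x"
  unfolding torus_wave_def by (rule wave_cong_torus) (auto intro: someI)

lemma norm_torus_wave [simp]: "norm (torus_wave q z) = 1"
  by (simp add: torus_wave_def)

lemma continuous_on_torusI:
  fixes g :: "'n::finite torus \<Rightarrow> 'a::topological_space"
  assumes "continuous_on UNIV (\<lambda>x. g (to_torus x))"
  shows "continuous_on UNIV g"
  using assms unfolding continuous_on_open_vimage[OF open_UNIV] open_torus_def
  by (simp add: vimage_def)

lemma continuous_torus_wave: "integer_vector q \<Longrightarrow> continuous_on UNIV (torus_wave q)"
  by (rule continuous_on_torusI) (simp add: torus_wave continuous_wave)

lemma integer_vector_axis: "integer_vector (axis i 1)"
  by (simp add: integer_vector_def axis_def)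

lemma torus_wave_separates:
  fixes a b :: "'n::finite torus"
  assumes "a \<noteq> b"
  shows "\<exists>i. torus_wave (axis i 1) a \<noteq> torus_wave (axis i 1) b"
proof -
  obtain x y where xy: "to_torus x = a" "to_torus y = b" using surj_to_torus by blast
  then obtain i where i: "x $ i - y $ i \<notin> \<int>"
    using assms to_torus_eq_iff int_congruent_def by blast
  have "wave (axis i 1) (x - y) \<noteq> 1"
    using i by (simp add: wave_eq_1_iff inner_axis' )
  then have "wave (axis i 1) x \<noteq> wave (axis i 1) y"
    using wave_add[of "axis i 1" "x - y" y] norm_wave[of "axis i 1" y]
    by (metis diff_add_cancel mult_cancel_right1 norm_zero zero_neq_one)
  then show ?thesis using xy torus_wave[OF integer_vector_axis] by metis
qed

text \<open>Needed for the Stone--Weierstrass theorem; the coordinate characters separate points.\<close>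

instance torus :: (finite) t2_space
proof
  fix a b :: "'a torus" assume "a \<noteq> b"
  then obtain i where i: "torus_wave (axis i 1) a \<noteq> torus_wave (axis i 1) b"
    using torus_wave_separates by blast
  let ?g = "torus_wave (axis i 1) :: 'a torus \<Rightarrow> complex"
  obtain U V where UV: "open U" "open V" "?g a \<in> U" "?g b \<in> V" "U \<inter> V = {}"
    using hausdorff[OF i] by blast
  have "continuous_on UNIV ?g" by (rule continuous_torus_wave[OF integer_vector_axis])
  then have "open (?g -` W)" if "open W" for W
    using that by (simp add: continuous_on_open_vimage)
  then show "\<exists>U V. open U \<and> open V \<and> a \<in> U \<and> b \<in> V \<and> U \<inter> V = {}"
    using UV by (intro exI[of _ "?g -` U"] exI[of _ "?g -` V"]) auto
qed

lemma compact_torus: "compact (UNIV :: 'n::finite torus set)"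
proof -
  have "(UNIV :: 'n torus set) \<subseteq> to_torus ` cbox 0 1"
  proof
    fix z :: "'n torus"
    obtain x where x: "to_torus x = z" using surj_to_torus by blast
    define y where "y = (\<chi> i. frac (x $ i))"
    have "to_torus y = to_torus x"
      by (simp add: to_torus_eq_iff int_congruent_def y_def frac_def)
    moreover have "y \<in> cbox 0 1"
      by (auto simp: mem_box_cart y_def frac_ge_0 intro: less_imp_le[OF frac_lt_1])
    ultimately show "z \<in> to_torus ` cbox 0 1" using x by (metis image_eqI)
  qed
  then have "(UNIV :: 'n torus set) = to_torus ` cbox 0 1" by blast
  moreover have "compact (to_torus ` cbox 0 (1::real^'n))"
    by (intro compact_continuous_image continuous_on_subset[OF continuous_on_to_torus]) auto
  ultimately show ?thesis by simp
qed

text \<open>Trigonometric polynomials. Real-valued ones form a separating algebra, hence are uniformly dense.\<close>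

inductive_set trig :: "('n::finite torus \<Rightarrow> complex) set" where
  wave: "integer_vector q \<Longrightarrow> torus_wave q \<in> trig"
| add: "g \<in> trig \<Longrightarrow> h \<in> trig \<Longrightarrow> (\<lambda>z. g z + h z) \<in> trig"
| cmult: "g \<in> trig \<Longrightarrow> (\<lambda>z. c * g z) \<in> trig"

lemma torus_wave_mult:
  assumes "integer_vector q" "integer_vector q'"
  shows "torus_wave q z * torus_wave q' z = torus_wave (q + q') z"
proof -
  obtain x where "to_torus x = z" using surj_to_torus by blast
  moreover have "integer_vector (q + q')" using assms by (simp add: integer_vector_def)
  ultimately show ?thesis using assms
    by (auto simp: torus_wave wave_def cis_mult inner_add_left distrib_left)
qed

lemma cnj_torus_wave:
  assumes "integer_vector q"
  shows "cnj (torus_wave q z) = torus_wave (- q) z"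
proof -
  obtain x where "to_torus x = z" using surj_to_torus by blast
  moreover have "integer_vector (- q)" using assms by (simp add: integer_vector_def)
  ultimately show ?thesis using assms by (auto simp: torus_wave wave_def cis_cnj)
qed

lemma trig_mult_wave:
  assumes "g \<in> trig" "integer_vector q"
  shows "(\<lambda>z. g z * torus_wave q z) \<in> trig"
  using assms(1)
proof induction
  case (wave q')
  then show ?case using assms(2)
    by (simp add: torus_wave_mult) (intro trig.wave, simp add: integer_vector_def)
next
  case (add g h)
  from trig.add[OF add.IH] show ?case by (simp add: distrib_right)
next
  case (cmult g c)
  from trig.cmult[OF cmult.IH, of c] show ?case by (simp add: mult.assoc)
qed

lemma trig_mult:
  assumes "h \<in> trig" "g \<in> trig"
  shows "(\<lambda>z. g z * h z) \<in> trig"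
  using assms(1)
proof induction
  case (wave q)
  then show ?case by (rule trig_mult_wave[OF assms(2)])
next
  case (add h h')
  from trig.add[OF add.IH] show ?case by (simp add: distrib_left)
next
  case (cmult h c)
  from trig.cmult[OF cmult.IH, of c] show ?case by (simp add: mult.left_commute)
qed

lemma integer_vector_0: "integer_vector 0" by (simp add: integer_vector_def)

lemma torus_wave_0: "torus_wave 0 z = 1"
  by (simp add: torus_wave_def wave_def)

lemma trig_const: "(\<lambda>_. c) \<in> trig"
  using trig.cmult[OF trig.wave[OF integer_vector_0], of c] by (simp add: torus_wave_0)

lemma continuous_trig: "g \<in> trig \<Longrightarrow> continuous_on UNIV g"
  by (induction rule: trig.induct) (auto intro!: continuous_intros continuous_torus_wave)

lemma trig_dense:
  fixes f :: "'n::finite torus \<Rightarrow> real"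
  assumes f: "continuous_on UNIV f" and e: "e > 0"
  shows "\<exists>g. (\<lambda>z. complex_of_real (g z)) \<in> trig \<and> (\<forall>z. \<bar>f z - g z\<bar> < e)"
proof -
  interpret function_ring_on "{g :: 'n torus \<Rightarrow> real. (\<lambda>z. complex_of_real (g z)) \<in> trig}" UNIV
  proof
    show "compact (UNIV :: 'n torus set)" by (rule compact_torus)
  next
    fix g :: "'n torus \<Rightarrow> real" assume "g \<in> {g. (\<lambda>z. complex_of_real (g z)) \<in> trig}"
    then have "continuous_on UNIV (\<lambda>z. complex_of_real (g z))" using continuous_trig by blast
    from continuous_on_Re[OF this] show "continuous_on UNIV g" by simp
  next
    fix g h :: "'n torus \<Rightarrow> real"
    assume "g \<in> {g. (\<lambda>z. complex_of_real (g z)) \<in> trig}" "h \<in> {g. (\<lambda>z. complex_of_real (g z)) \<in> trig}"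
    then show "(\<lambda>z. g z + h z) \<in> {g. (\<lambda>z. complex_of_real (g z)) \<in> trig}"
        "(\<lambda>z. g z * h z) \<in> {g. (\<lambda>z. complex_of_real (g z)) \<in> trig}"
      by (auto intro: trig.add trig_mult)
  next
    show "(\<lambda>_. c) \<in> {g :: 'n torus \<Rightarrow> real. (\<lambda>z. complex_of_real (g z)) \<in> trig}" for c
      by (simp add: trig_const)
  next
    fix a b :: "'n torus" assume "a \<noteq> b"
    then obtain i where i: "torus_wave (axis i 1) a \<noteq> torus_wave (axis i 1) b"
      using torus_wave_separates by blast
    let ?w = "torus_wave (axis i 1) :: 'n torus \<Rightarrow> complex"
    have w: "?w \<in> trig" by (intro trig.wave integer_vector_axis)
    have "integer_vector (- axis i (1::real))"
      using integer_vector_axis by (simp add: integer_vector_def)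
    then have w': "(\<lambda>z. cnj (?w z)) \<in> trig"
      unfolding cnj_torus_wave[OF integer_vector_axis] by (rule trig.wave)
    have "(\<lambda>z. (1/2) * (?w z + cnj (?w z))) \<in> trig"
      by (intro trig.cmult trig.add w w')
    then have Re: "(\<lambda>z. complex_of_real (Re (?w z))) \<in> trig"
      by (simp add: complex_add_cnj)
    have "(\<lambda>z. (1/(2 * \<i>)) * (?w z + (-1) * cnj (?w z))) \<in> trig"
      by (intro trig.cmult trig.add w w')
    moreover have "(1/(2 * \<i>)) * (?w z + (-1) * cnj (?w z)) = complex_of_real (Im (?w z))" for z
      using complex_diff_cnj[of "?w z"] by (simp add: field_simps)
    ultimately have Im: "(\<lambda>z. complex_of_real (Im (?w z))) \<in> trig" by simp
    from i have "Re (?w a) \<noteq> Re (?w b) \<or> Im (?w a) \<noteq> Im (?w b)" by (auto simp: complex_eq_iff)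
    then show "\<exists>g\<in>{g :: 'n torus \<Rightarrow> real. (\<lambda>z. complex_of_real (g z)) \<in> trig}. g a \<noteq> g b"
      using Re Im by auto
  qed
  show ?thesis using Stone_Weierstrass_basic[OF f e] by auto
qed

text \<open>By translation invariance the integral equals its negative: translate by a point at which the character
has the value \<open>-1\<close>.\<close>

lemma integral_torus_wave:
  fixes q :: "real^'n"
  assumes q: "integer_vector q" "q \<noteq> 0"
  shows "integral\<^sup>L torus_haar (torus_wave q) = 0"
proof -
  define x where "x = (1 / (2 * (q \<bullet> q))) *\<^sub>R q"
  have x: "wave q x = -1" unfolding x_def by (rule wave_half[OF q(2)])
  have meas: "torus_wave q \<in> borel_measurable borel"
    by (rule borel_measurable_continuous_onI[OF continuous_torus_wave[OF q(1)]])
  have tr: "(+) (to_torus x) \<in> measurable torus_haar borel"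
    using borel_measurable_continuous_onI[OF continuous_on_torus_translation[of "to_torus x"]]
    by (simp cong: measurable_cong_sets)
  have "integral\<^sup>L torus_haar (torus_wave q) = integral\<^sup>L (distr torus_haar borel ((+) (to_torus x))) (torus_wave q)"
    by (simp add: torus_haar_translation_invariant)
  also have "\<dots> = (LINT z|torus_haar. torus_wave q (to_torus x + z))"
    by (rule integral_distr[OF tr meas])
  also have "\<dots> = (LINT z|torus_haar. - torus_wave q z)"
  proof (rule Bochner_Integration.integral_cong[OF refl])
    fix z :: "'n torus"
    obtain y where "to_torus y = z" using surj_to_torus by blast
    then show "torus_wave q (to_torus x + z) = - torus_wave q z"
      by (auto simp: torus_wave[OF q(1)] wave_add x simp flip: to_torus_add)
  qed
  finally show ?thesis by simp
qed

lemma integrable_continuous_torus: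
  fixes g :: "'n::finite torus \<Rightarrow> 'b::{banach, second_countable_topology}"
  assumes g: "continuous_on UNIV g"
  shows "integrable torus_haar g"
proof -
  interpret prob_space "torus_haar :: 'n torus measure" by (rule prob_space_torus_haar)
  have "bounded (range g)"
    by (intro compact_imp_bounded compact_continuous_image g compact_torus)
  then obtain C where C: "\<And>z. norm (g z) \<le> C" unfolding bounded_iff by auto
  show ?thesis
    by (rule integrable_const_bound[of _ C])
       (use C borel_measurable_continuous_onI[OF g] in \<open>auto cong: measurable_cong_sets\<close>)
qed

lemma weyl_criterion:
  fixes y :: "nat \<Rightarrow> 'n::finite torus"
  assumes "\<And>q. integer_vector q \<Longrightarrow> q \<noteq> 0 \<Longrightarrow> (\<lambda>N. (\<Sum>m=1..N. torus_wave q (y m)) / of_nat N) \<longlonglongrightarrow> 0"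
  shows "equidistributed y torus_haar"
proof -
  interpret prob_space "torus_haar :: 'n torus measure" by (rule prob_space_torus_haar)
  have trig: "(\<lambda>N. (\<Sum>m=1..N. g (y m)) / of_nat N) \<longlonglongrightarrow> integral\<^sup>L torus_haar g" if "g \<in> trig" for g
    using that
  proof induction
    case (wave q)
    show ?case
    proof (cases "q = 0")
      case True
      have "(\<lambda>N. (\<Sum>m=1..N. torus_wave q (y m)) / of_nat N) \<longlonglongrightarrow> 1"
        by (rule Lim_transform_eventually[OF tendsto_const])
           (auto simp: True torus_wave_0 eventually_sequentially intro!: exI[of _ 1])
      moreover have "integral\<^sup>L torus_haar (torus_wave q) = 1"
        using prob_space by (simp add: True torus_wave_0[abs_def])
      ultimately show ?thesis by simp
    qed (use assms[OF wave] integral_torus_wave[OF wave] in simp)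
  next
    case (add g h)
    have "integral\<^sup>L torus_haar (\<lambda>z. g z + h z) = integral\<^sup>L torus_haar g + integral\<^sup>L torus_haar h"
      by (intro Bochner_Integration.integral_add integrable_continuous_torus continuous_trig add.hyps)
    then show ?case using tendsto_add[OF add.IH] by (simp add: sum.distrib add_divide_distrib)
  next
    case (cmult g c)
    then show ?case using tendsto_mult_left[OF cmult.IH, of c] by (simp flip: sum_distrib_left)
  qed
  show ?thesis unfolding equidistributed_def
  proof (intro allI impI LIMSEQ_I)
    fix f :: "'n torus \<Rightarrow> real" and e :: real
    assume f: "continuous_on UNIV f" and e: "0 < e"
    then obtain g where g: "(\<lambda>z. complex_of_real (g z)) \<in> trig" "\<And>z. \<bar>f z - g z\<bar> < e/3"
      using trig_dense[OF f, of "e/3"] by auto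
    have gc: "continuous_on UNIV g" using continuous_on_Re[OF continuous_trig[OF g(1)]] by simp
    have avg: "(\<Sum>m=1..N. complex_of_real (g (y m))) / of_nat N = complex_of_real ((\<Sum>m=1..N. g (y m)) / real N)" for N
      by simp
    have "(\<lambda>N. (\<Sum>m=1..N. g (y m)) / real N) \<longlonglongrightarrow> integral\<^sup>L torus_haar g"
      using tendsto_Re[OF trig[OF g(1)]]
      unfolding avg Re_complex_of_real integral_complex_of_real .
    from LIMSEQ_D[OF this, of "e/3"] e obtain N0 where
      N0: "\<And>N. N \<ge> N0 \<Longrightarrow> \<bar>(\<Sum>m=1..N. g (y m)) / real N - integral\<^sup>L torus_haar g\<bar> < e/3" by auto
    have int_fg: "\<bar>integral\<^sup>L torus_haar f - integral\<^sup>L torus_haar g\<bar> \<le> e/3"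
    proof -
      have "integral\<^sup>L torus_haar f - integral\<^sup>L torus_haar g = (LINT z|torus_haar. f z - g z)"
        by (intro Bochner_Integration.integral_diff[symmetric] integrable_continuous_torus f gc)
      moreover have "norm (LINT z|torus_haar. f z - g z) \<le> (LINT z|(torus_haar :: 'n torus measure). e/3)"
        by (rule order_trans[OF integral_norm_bound integral_mono])
           (use f gc g(2) in \<open>auto intro!: integrable_continuous_torus continuous_intros less_imp_le\<close>)
      ultimately show ?thesis using prob_space by simp
    qed
    have avg_fg: "\<bar>(\<Sum>m=1..N. f (y m)) / real N - (\<Sum>m=1..N. g (y m)) / real N\<bar> \<le> e/3" for N
    proof (cases "N = 0")
      case False
      have "\<bar>\<Sum>m=1..N. f (y m) - g (y m)\<bar> \<le> (\<Sum>m=1..N. e/3)"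
        by (rule order_trans[OF sum_abs]) (intro sum_mono less_imp_le g(2))
      then show ?thesis using False by (simp add: sum_subtractf field_simps flip: diff_divide_distrib)
    qed (use e in simp)
    have three: "\<bar>u - F\<bar> < e" if "\<bar>F - G\<bar> \<le> e/3" "\<bar>u - v\<bar> \<le> e/3" "\<bar>v - G\<bar> < e/3" for u v F G :: real
      using that by linarith
    have "\<bar>(\<Sum>m=1..N. f (y m)) / real N - integral\<^sup>L torus_haar f\<bar> < e" if "N \<ge> N0" for N
      by (rule three[OF int_fg avg_fg N0[OF that]])
    then show "\<exists>no. \<forall>n\<ge>no. norm ((\<Sum>m=1..n. f (y m)) / real n - integral\<^sup>L torus_haar f) < e"
      by auto
  qed
qed

section \<open>Equidistribution\<close>

text \<open>Otherwise the kernel of the character with frequency \<open>q\<close> is a proper closed subgroup that contains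
\<open>S\<close>.\<close>

lemma nonresonance_of_dense_subgroup:
  fixes S :: "(real^'n) set"
  assumes dense: "\<not> (\<exists>H. closed_subgroup H \<and> H \<noteq> UNIV \<and> to_torus ` S \<subseteq> H)"
    and q: "integer_vector q" "q \<noteq> 0"
  shows "\<exists>s\<in>S. q \<bullet> s \<notin> \<int>"
proof (rule ccontr)
  assume none: "\<not> ?thesis"
  define H where "H = {z. torus_wave q z = 1}"
  have mult: "torus_wave q (a + b) = torus_wave q a * torus_wave q b" for a b
  proof -
    obtain x y where "to_torus x = a" "to_torus y = b" using surj_to_torus by blast
    then show ?thesis
      by (auto simp: torus_wave[OF q(1)] wave_add simp flip: to_torus_add)
  qed
  have zero: "torus_wave q 0 = 1"
    using torus_wave[OF q(1), of 0] by (simp add: to_torus_0 wave_def)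
  have "closed_subgroup H"
    unfolding closed_subgroup_def
  proof (intro conjI ballI)
    show "closed H" unfolding H_def
      by (intro closed_Collect_eq continuous_torus_wave q(1) continuous_on_const)
    show "0 \<in> H" by (simp add: H_def zero)
    show "a + b \<in> H" if "a \<in> H" "b \<in> H" for a b using that by (simp add: H_def mult)
    show "- a \<in> H" if "a \<in> H" for a using that mult[of a "- a"] by (simp add: H_def zero)
  qed
  moreover have "H \<noteq> UNIV"
  proof -
    define x where "x = (1 / (2 * (q \<bullet> q))) *\<^sub>R q"
    have "torus_wave q (to_torus x) = -1"
      unfolding x_def torus_wave[OF q(1)] by (rule wave_half[OF q(2)])
    then have "to_torus x \<notin> H" by (simp add: H_def)
    then show ?thesis by blast
  qed
  moreover have "to_torus ` S \<subseteq> H"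
    using none by (auto simp: H_def torus_wave[OF q(1)] wave_eq_1_iff)
  ultimately show False using dense by blast
qed

lemma countable_integer_vectors: "countable {q :: real^'n. integer_vector q}"
  unfolding integer_vector_def by (rule unit_cell_decomposition(2)[of "{}"]) simp

lemma cesaro_null_measurable:
  assumes [measurable]: "\<And>n. a n \<in> borel_measurable M"
  shows "{x \<in> space M. cesaro_null (\<lambda>n. a n x)} \<in> sets M"
proof -
  have "cesaro_null (\<lambda>n. a n x) \<longleftrightarrow>
      (\<forall>k. \<exists>N0. \<forall>N\<ge>N0. norm ((\<Sum>j<N. a j x) / of_nat N) < inverse (real (Suc k)))" for x
  proof
    show "\<forall>k. \<exists>N0. \<forall>N\<ge>N0. norm ((\<Sum>j<N. a j x) / of_nat N) < inverse (real (Suc k))"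
      if "cesaro_null (\<lambda>n. a n x)"
    proof
      fix k
      show "\<exists>N0. \<forall>N\<ge>N0. norm ((\<Sum>j<N. a j x) / of_nat N) < inverse (real (Suc k))"
        using LIMSEQ_D[OF that[unfolded cesaro_null_def], of "inverse (real (Suc k))"] by simp
    qed
    assume *: "\<forall>k. \<exists>N0. \<forall>N\<ge>N0. norm ((\<Sum>j<N. a j x) / of_nat N) < inverse (real (Suc k))"
    show "cesaro_null (\<lambda>n. a n x)" unfolding cesaro_null_def
    proof (rule LIMSEQ_I)
      fix e :: real assume "e > 0"
      then obtain k where "inverse (real (Suc k)) < e" using reals_Archimedean by blast
      then show "\<exists>N0. \<forall>N\<ge>N0. norm ((\<Sum>j<N. a j x) / of_nat N - 0) < e"
        using * by (metis diff_zero less_trans)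
    qed
  qed
  then show ?thesis by simp
qed

text \<open>The coding map is measurable, so the almost sure statement for sequences of letters transfers to \<open>\<mu>\<close>
once the exceptional set is known to be measurable. This is done for the averages of a single
character; there are only countably many of these.\<close>

theorem theorem4:
  fixes D :: "real^'d^'d" and k :: nat and r :: "nat \<Rightarrow> nat" and t :: "nat \<Rightarrow> real^'d"
    and f :: "nat \<Rightarrow> real^'d \<Rightarrow> real^'d" and K :: "(real^'d) set" and \<mu> :: "(real^'d) measure"
  assumes "integer_matrix D" and "expanding D"
    and "\<forall>i\<in>{1..k}. 1 \<le> r i"
    and "\<forall>i\<in>{1..k}. \<forall>x. f i x = matpow (matrix_inv D) (r i) *v x + t i"
    and "is_attractor {1..k} f K"
    and "\<not> (\<exists>H. closed_subgroup H \<and> H \<noteq> UNIV \<and>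
          to_torus ` {((mat 1 - matpow D (r i)) ** matpow D (r j)) *v t j
                      - ((mat 1 - matpow D (r j)) ** matpow D (r i)) *v t i
                      | i j. i \<in> {1..k} \<and> j \<in> {1..k}} \<subseteq> H)"
    and "bernoulli_measure {1..k} f K \<mu>"
  shows "AE x in \<mu>. equidistributed (\<lambda>m. to_torus (matpow D m *v x)) torus_haar"
proof -
  from assms(7) obtain P where P: "prob_space P" "sets P = Pow {1..k}"
    "\<forall>i\<in>{1..k}. 0 < measure P {i}"
    and \<mu>: "\<mu> = distr (PiM UNIV (\<lambda>_. P)) (restrict_space borel K) (coding_map f)"
    unfolding bernoulli_measure_def by blast
  have K: "compact K" "K \<noteq> {}" "\<And>i x. i \<in> {1..k} \<Longrightarrow> x \<in> K \<Longrightarrow> f i x \<in> K"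
    using assms(5) unfolding is_attractor_def by blast+
  have space_\<mu>: "space \<mu> = K" by (simp add: \<mu> space_restrict_space)
  have "AE x in \<mu>. cesaro_null (\<lambda>n. wave q (matpow D n *v x))" if q: "integer_vector q" "q \<noteq> 0" for q
  proof -
    interpret coded_walk D "{1..k}" r t P q f K
      by (intro coded_walk.intro random_walk.intro expanding_system.intro bernoulli_shift.intro
          coded_walk_axioms.intro) (use assms(1-4) P K in auto)
    have p_pos: "0 < p i" if "i \<in> {1..k}" for i using that P(3) by (simp add: p_def)
    have dense: "\<exists>i\<in>{1..k}. \<exists>j\<in>{1..k}. q' \<bullet> commutator i j \<notin> \<int>"
      if "integer_vector q'" "q' \<noteq> 0" for q'
      using nonresonance_of_dense_subgroup[OF assms(6) that] unfolding commutator_def by blast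
    have "AE \<omega> in PiM UNIV (\<lambda>_. P). cesaro_null (\<lambda>n. wave q (matpow D n *v coding_map f \<omega>))"
      using AE_letters_average_out AE_space
    proof eventually_elim
      case (elim \<omega>)
      then have \<omega>: "\<And>j. \<omega> j \<in> {1..k}" by (simp add: space_\<Omega>)
      show ?case
        by (rule wave_averages_out_at_coded_point[OF elim(1) \<omega>])
           (rule average_tendsto_0[OF dense q p_pos elim(1) \<omega>])
    qed
    moreover have "{x \<in> space (restrict_space borel K). cesaro_null (\<lambda>n. wave q (matpow D n *v x))}
        \<in> sets (restrict_space borel K)"
    proof (rule cesaro_null_measurable)
      have "(\<lambda>x. wave q (matpow D n *v x)) \<in> borel_measurable borel" for n
        unfolding wave_def
        by (intro borel_measurable_continuous_onI continuous_intros linear_continuous_on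
            matrix_vector_mul_bounded_linear)
      then show "(\<lambda>x. wave q (matpow D n *v x)) \<in> borel_measurable (restrict_space borel K)" for n
        by (rule measurable_restrict_space1)
    qed
    ultimately show ?thesis
      unfolding \<mu> by (subst AE_distr_iff[OF coding_map_measurable])
  qed
  then have "AE x in \<mu>. \<forall>q\<in>{q. integer_vector q} - {0}. cesaro_null (\<lambda>n. wave q (matpow D n *v x))"
    using countable_integer_vectors by (subst AE_ball_countable) auto
  then show ?thesis
  proof eventually_elim
    case (elim x)
    show ?case
    proof (rule weyl_criterion)
      fix q :: "real^'d" assume q: "integer_vector q" "q \<noteq> 0"
      let ?a = "\<lambda>n. wave q (matpow D n *v x)"
      have "cesaro_null ?a" using elim q by simp
      \<comment> \<open>The averages of the criterion start at exponent \<open>1\<close> instead of \<open>0\<close>.\<close>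
      moreover have "cesaro_null (\<lambda>n. ?a (Suc n) - ?a n)"
        by (rule cesaro_null_shift[of _ 1]) simp
      ultimately have "cesaro_null (\<lambda>n. ?a n + (?a (Suc n) - ?a n))" by (rule cesaro_null_add)
      then have "cesaro_null (\<lambda>n. ?a (Suc n))" by simp
      then show "(\<lambda>N. (\<Sum>m=1..N. torus_wave q (to_torus (matpow D m *v x))) / of_nat N) \<longlonglongrightarrow> 0"
        unfolding cesaro_null_def torus_wave[OF q(1)] One_nat_def sum.atLeast1_atMost_eq .
    qed
  qed
qed

end
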